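(* Let $q\in(-1,1)$. For $x,y\in H$ and every $n\in\{0,2,3,4,\dots\}$, the following commutation relation holds on $H^{\otimes n}$: $$d_q(x)d_q^\ast(y)-q\,d_q^\ast(y)d_q(x)=\langle x,y\rangle I+\langle x,\overline{y}\rangle\,q^{2n}J .$$
   Context: $H$ is a complex Hilbert space with inner product $\langle\cdot,\cdot\rangle$ linear in the right argument and antilinear in the left one; $x\mapsto\overline{x}$ is a fixed selfadjoint involution on $H$, i.e. a bounded selfadjoint linear operator whose square is the identity. Let $B(n)$ be the group of permutations $\sigma$ of $\{\pm1,\dots,\pm n\}$ with $\sigma(-k)=-\sigma(k)$; put $\pi_i=(i,i+1)(-i,-i-1)$ for $1\le i\le n-1$, $\overline{\pi}_n=(n,-n)$ and $\widehat{\pi}_{n-1}=\overline{\pi}_n\pi_{n-1}\overline{\pi}_n$. The Coxeter group $D(n)$ of type D is $D(1)=\{e\}$ and, for $n\ge2$, the subgroup of $B(n)$ generated by $\pi_1,\dots,\pi_{n-1},\widehat{\pi}_{n-1}$; $\ell(\sigma)$ is the minimal number of these generators in a product expression of $\sigma\in D(n)$. For $n\ge 2$, $D(n)$ acts on $H^{\otimes n}$ by $\pi_i(x_1\otimes\cdots\otimes x_n)=x_1\otimes\cdots\otimes x_{i-1}\otimes x_{i+1}\otimes x_i\otimes x_{i+2}\otimes\cdots\otimes x_n$ and $\widehat{\pi}_{n-1}(x_1\otimes\cdots\otimes x_n)=x_1\otimes\cdots\otimes x_{n-2}\otimes\overline{x}_n\otimes\overline{x}_{n-1}$; $D(1)$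 acts trivially on $H$. Put $\widehat{P}_q^{(n)}=\sum_{\sigma\in D(n)}q^{\ell(\sigma)}\sigma$ for $n\ge1$ and $\widehat P_q^{(0)}=I$ (convention $0^0=1$). Let $\mathcal{F}_{\rm fin}(H)=\bigoplus_{n\ge0}H^{\otimes n}$ be the algebraic direct sum, $H^{\otimes0}=\mathbb{C}\Omega$ with $\Omega$ a unit vector, with the usual inner product $\langle x_1\otimes\cdots\otimes x_m,y_1\otimes\cdots\otimes y_n\rangle_0=\delta_{m,n}\prod_i\langle x_i,y_i\rangle$, and $\widehat P_q=\bigoplus_n\widehat P_q^{(n)}$. For $q\in(-1,1)$, $\widehat P_q$ is known to be strictly positive, so $\langle f,g\rangle_q:=\langle f,\widehat P_q g\rangle_0$ is an inner product. The creation operator is $d_q^\ast(x)(x_1\otimes\cdots\otimes x_n)=x\otimes x_1\otimes\cdots\otimes x_n$, $d_q^\ast(x)\Omega=x$, and $d_q(x)$ is its adjoint with respect to $\langle\cdot,\cdot\rangle_q$ (mapping $H^{\otimes(n+1)}$ to $H^{\otimes n}$ and $\Omega$ to $0$). $J$ is the linear operator with $J\Omega=0$ and $J(x_1\otimes\cdots\otimes x_n)=x_1\otimes\cdots\otimes x_{n-1}\otimes\overline{x}_n$ for $n\ge1$. *)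

theory Defs
  imports
    Complex_Main
    "HOL-Library.Function_Algebras"
    "HOL-Combinatorics.Permutations"
    "HOL-Algebra.Generated_Groups"
begin

section \<open>Complex Hilbert spaces\<close>

text \<open>The inner product is antilinear in the left and linear in the right argument.\<close>

class complex_hilbert_space = banach +
  fixes scaleC :: "complex \<Rightarrow> 'a \<Rightarrow> 'a" (infixr \<open>*\<^sub>C\<close> 75)
    and cinner :: "'a \<Rightarrow> 'a \<Rightarrow> complex"
  assumes scaleC_add_right: "a *\<^sub>C (x + y) = a *\<^sub>C x + a *\<^sub>C y"
    and scaleC_add_left: "(a + b) *\<^sub>C x = a *\<^sub>C x + b *\<^sub>C x"
    and scaleC_scaleC: "a *\<^sub>C (b *\<^sub>C x) = (a * b) *\<^sub>C x"
    and scaleC_of_real: "complex_of_real r *\<^sub>C x = r *\<^sub>R x"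
    and cinner_commute: "cinner x y = cnj (cinner y x)"
    and cinner_add_right: "cinner x (y + z) = cinner x y + cinner x z"
    and cinner_scaleC_right: "cinner x (a *\<^sub>C y) = a * cinner x y"
    and cinner_norm: "cinner x x = complex_of_real ((norm x)\<^sup>2)"

definition selfadjoint_involution :: "('a::complex_hilbert_space \<Rightarrow> 'a) \<Rightarrow> bool" where
  "selfadjoint_involution bar \<longleftrightarrow>
     bounded_linear bar \<and>
     (\<forall>c x. bar (c *\<^sub>C x) = c *\<^sub>C bar x) \<and>
     (\<forall>x y. cinner (bar x) y = cinner x (bar y)) \<and>
     (\<forall>x. bar (bar x) = x)"


section \<open>Tensor powers and the algebraic direct sum\<close>

text \<open>
  A tensor \<open>f\<close> is represented by the function \<open>ys \<mapsto> \<langle>y\<^sub>1 \<otimes> \<dots> \<otimes> y\<^sub>n, f\<rangle>\<^sub>0\<close> on lists of vectors, which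
  determines it. Tensors of degree \<open>n\<close> are functions vanishing on all lists of length other than \<open>n\<close>.
\<close>

type_synonym 'a fock = "'a list \<Rightarrow> complex"

definition smult_fock :: "complex \<Rightarrow> 'a fock \<Rightarrow> 'a fock" (infixr \<open>*\<^sub>F\<close> 75) where
  "c *\<^sub>F f = (\<lambda>ys. c * f ys)"

text \<open>\<open>x\<^sub>1 \<otimes> \<dots> \<otimes> x\<^sub>n\<close>; in particular \<open>ptensor []\<close> is the vacuum vector \<open>\<Omega>\<close>.\<close>

definition ptensor :: "'a::complex_hilbert_space list \<Rightarrow> 'a fock" where
  "ptensor xs = (\<lambda>ys. if length ys = length xs then \<Prod>i<length xs. cinner (ys ! i) (xs ! i) else 0)"

definition tensor_comb :: "('a::complex_hilbert_space list \<Rightarrow> complex) \<Rightarrow> 'a list set \<Rightarrow> 'a fock" where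
  "tensor_comb a A = (\<Sum>xs\<in>A. a xs *\<^sub>F ptensor xs)"

definition alg_tensor_power :: "nat \<Rightarrow> 'a::complex_hilbert_space fock set" where
  "alg_tensor_power n = {tensor_comb a A | a A. finite A \<and> A \<subseteq> {xs. length xs = n}}"

text \<open>
  The sesquilinear extension of
  \<open>\<langle>x\<^sub>1 \<otimes> \<dots> \<otimes> x\<^sub>n, z\<^sub>1 \<otimes> \<dots> \<otimes> z\<^sub>n\<rangle>\<^sub>0 = \<Prod>\<^sub>i \<langle>x\<^sub>i, z\<^sub>i\<rangle> = ptensor zs xs\<close>.
\<close>

definition alg_inner :: "'a::complex_hilbert_space fock \<Rightarrow> 'a fock \<Rightarrow> complex" where
  "alg_inner f g = (THE c. \<exists>a A b B. finite A \<and> finite B \<and> f = tensor_comb a A \<and> g = tensor_comb b B \<and>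
     c = (\<Sum>xs\<in>A. \<Sum>zs\<in>B. cnj (a xs) * b zs * ptensor zs xs))"

definition alg_norm :: "'a::complex_hilbert_space fock \<Rightarrow> real" where
  "alg_norm f = sqrt (Re (alg_inner f f))"

text \<open>
  \<open>H\<^sup>\<otimes>\<^sup>n\<close> is the Hilbert space completion of the algebraic tensor power. Since \<open>f \<mapsto> f ys\<close> is
  continuous, the limit of a Cauchy sequence is given by its pointwise limit.
\<close>

definition approximates :: "nat \<Rightarrow> (nat \<Rightarrow> 'a::complex_hilbert_space fock) \<Rightarrow> 'a fock \<Rightarrow> bool" where
  "approximates n s f \<longleftrightarrow>
     (\<forall>k. s k \<in> alg_tensor_power n) \<and>
     (\<forall>e>0. \<exists>N. \<forall>i\<ge>N. \<forall>j\<ge>N. alg_norm (s i - s j) < e) \<and>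
     (\<forall>ys. (\<lambda>k. s k ys) \<longlonglongrightarrow> f ys)"

definition tensor_power :: "nat \<Rightarrow> 'a::complex_hilbert_space fock set" where
  "tensor_power n = {f. \<exists>s. approximates n s f}"

definition tensor_inner :: "nat \<Rightarrow> 'a::complex_hilbert_space fock \<Rightarrow> 'a fock \<Rightarrow> complex" where
  "tensor_inner n f g = (THE c. \<forall>s t. approximates n s f \<longrightarrow> approximates n t g \<longrightarrow>
     (\<lambda>k. alg_inner (s k) (t k)) \<longlonglongrightarrow> c)"

definition fock_component :: "nat \<Rightarrow> 'a fock \<Rightarrow> 'a fock" where
  "fock_component n f = (\<lambda>ys. if length ys = n then f ys else 0)"

definition fock_fin :: "'a::complex_hilbert_space fock set" where
  "fock_fin = {f. (\<forall>n. fock_component n f \<in> tensor_power n) \<and> finite {n. fock_component n f \<noteq> 0}}"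

definition inner0 :: "'a::complex_hilbert_space fock \<Rightarrow> 'a fock \<Rightarrow> complex" where
  "inner0 f g = (\<Sum>n | fock_component n f \<noteq> 0 \<and> fock_component n g \<noteq> 0.
     tensor_inner n (fock_component n f) (fock_component n g))"


section \<open>The Coxeter group of type D\<close>

definition signed_points :: "nat \<Rightarrow> int set" where
  "signed_points n = {- int n..int n} - {0}"

definition B_group :: "nat \<Rightarrow> (int \<Rightarrow> int) monoid" where
  "B_group n = \<lparr>carrier = {\<sigma>. \<sigma> permutes signed_points n \<and> (\<forall>k. \<sigma> (- k) = - \<sigma> k)},
     mult = (\<circ>), one = id\<rparr>"

definition pi_gen :: "nat \<Rightarrow> int \<Rightarrow> int" where
  "pi_gen i = Transposition.transpose (int i) (int i + 1) \<circ>
     Transposition.transpose (- int i) (- int i - 1)"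

definition pi_bar :: "nat \<Rightarrow> int \<Rightarrow> int" where
  "pi_bar n = Transposition.transpose (int n) (- int n)"

text \<open>\<open>pi_hat n\<close> is the generator with subscript \<open>n - 1\<close>.\<close>

definition pi_hat :: "nat \<Rightarrow> int \<Rightarrow> int" where
  "pi_hat n = pi_bar n \<circ> pi_gen (n - 1) \<circ> pi_bar n"

definition D_gens :: "nat \<Rightarrow> (int \<Rightarrow> int) set" where
  "D_gens n = (if n \<ge> 2 then pi_gen ` {1..n - 1} \<union> {pi_hat n} else {})"

definition D_group :: "nat \<Rightarrow> (int \<Rightarrow> int) set" where
  "D_group n = (if n \<ge> 2 then generate (B_group n) (D_gens n) else {id})"

definition D_length :: "nat \<Rightarrow> (int \<Rightarrow> int) \<Rightarrow> nat" where
  "D_length n \<sigma> = (LEAST k. \<exists>ws. length ws = k \<and> set ws \<subseteq> D_gens n \<and> \<sigma> = foldr (\<circ>) ws id)"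


section \<open>Operators on the Fock space\<close>

text \<open>
  With \<open>x\<^sub>-\<^sub>k = bar x\<^sub>k\<close>, the action of \<open>\<sigma>\<close> is \<open>x\<^sub>1 \<otimes> \<dots> \<otimes> x\<^sub>n \<mapsto> x\<^bsub>\<sigma>\<^sup>-\<^sup>1(1)\<^esub> \<otimes> \<dots> \<otimes> x\<^bsub>\<sigma>\<^sup>-\<^sup>1(n)\<^esub>\<close>. That this is
  the left action determined by the prescribed action of the generators is proved below
  (\<open>group_act_ptensor\<close>, \<open>group_act_comp\<close>, \<open>group_act_pi_gen\<close>, \<open>group_act_pi_hat\<close>).
\<close>

definition signed_nth :: "('a \<Rightarrow> 'a) \<Rightarrow> 'a list \<Rightarrow> int \<Rightarrow> 'a" where
  "signed_nth bar xs k = (if k > 0 then xs ! (nat k - 1) else bar (xs ! (nat (- k) - 1)))"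

definition signed_permute :: "('a \<Rightarrow> 'a) \<Rightarrow> (int \<Rightarrow> int) \<Rightarrow> 'a list \<Rightarrow> 'a list" where
  "signed_permute bar \<sigma> xs = map (\<lambda>j. signed_nth bar xs (inv_into UNIV \<sigma> j)) [1..int (length xs)]"

text \<open>The operator \<open>\<sigma>\<close> is unitary, so \<open>\<langle>ys, \<sigma> f\<rangle>\<^sub>0 = \<langle>\<sigma>\<^sup>-\<^sup>1 ys, f\<rangle>\<^sub>0\<close>.\<close>

definition group_act :: "('a \<Rightarrow> 'a) \<Rightarrow> (int \<Rightarrow> int) \<Rightarrow> 'a fock \<Rightarrow> 'a fock" where
  "group_act bar \<sigma> f = (\<lambda>ys. f (signed_permute bar (inv_into UNIV \<sigma>) ys))"

definition P_level :: "('a \<Rightarrow> 'a) \<Rightarrow> real \<Rightarrow> nat \<Rightarrow> 'a fock \<Rightarrow> 'a fock" where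
  "P_level bar q n f = (\<Sum>\<sigma>\<in>D_group n. complex_of_real (q ^ D_length n \<sigma>) *\<^sub>F group_act bar \<sigma> f)"

definition P_op :: "('a \<Rightarrow> 'a) \<Rightarrow> real \<Rightarrow> 'a fock \<Rightarrow> 'a fock" where
  "P_op bar q f = (\<lambda>ys. P_level bar q (length ys) (fock_component (length ys) f) ys)"

definition inner_q :: "('a::complex_hilbert_space \<Rightarrow> 'a) \<Rightarrow> real \<Rightarrow> 'a fock \<Rightarrow> 'a fock \<Rightarrow> complex" where
  "inner_q bar q f g = inner0 f (P_op bar q g)"

definition creation :: "'a::complex_hilbert_space \<Rightarrow> 'a fock \<Rightarrow> 'a fock" where
  "creation x f = (\<lambda>ys. case ys of [] \<Rightarrow> 0 | y # ys' \<Rightarrow> cinner y x * f ys')"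

definition annihilation ::
    "('a::complex_hilbert_space \<Rightarrow> 'a) \<Rightarrow> real \<Rightarrow> 'a \<Rightarrow> 'a fock \<Rightarrow> 'a fock" where
  "annihilation bar q x g = (THE h. h \<in> fock_fin \<and>
     (\<forall>f\<in>fock_fin. inner_q bar q f h = inner_q bar q (creation x f) g))"

text \<open>\<open>J\<close> applies the selfadjoint \<open>bar\<close> to the last tensor factor (see \<open>J_op_ptensor\<close>).\<close>

definition J_op :: "('a \<Rightarrow> 'a) \<Rightarrow> 'a fock \<Rightarrow> 'a fock" where
  "J_op bar f = (\<lambda>ys. if ys = [] then 0 else f (butlast ys @ [bar (last ys)]))"


section \<open>The definitions act as prescribed on simple tensors\<close>

lemma creation_ptensor: "creation x (ptensor xs) = ptensor (x # xs)"
  by (auto simp: creation_def ptensor_def fun_eq_iff split: list.splits simp: prod.lessThan_Suc_shift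
      simp del: prod.lessThan_Suc)

lemma J_op_vacuum: "J_op bar (ptensor []) = 0"
  by (auto simp: J_op_def ptensor_def fun_eq_iff)

lemma J_op_ptensor:
  assumes "selfadjoint_involution bar"
  shows "J_op bar (ptensor (xs @ [x])) = ptensor (xs @ [bar x])"
proof
  fix ys
  show "J_op bar (ptensor (xs @ [x])) ys = ptensor (xs @ [bar x]) ys"
  proof (cases ys rule: rev_cases)
    case Nil
    then show ?thesis by (simp add: J_op_def ptensor_def)
  next
    case (snoc zs z)
    have "cinner (bar z) x = cinner z (bar x)"
      using assms by (simp add: selfadjoint_involution_def)
    then show ?thesis
      by (auto simp: snoc J_op_def ptensor_def nth_append)
  qed
qed

lemma ptensor_swap: "ptensor xs ys = cnj (ptensor ys xs)"
  by (simp add: ptensor_def cinner_commute[symmetric])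

lemma alg_inner_tensor_comb:
  assumes "finite A" "finite B"
  shows "alg_inner (tensor_comb a A) (tensor_comb b B) =
    (\<Sum>xs\<in>A. \<Sum>zs\<in>B. cnj (a xs) * b zs * ptensor zs xs)"
proof -
  have fin_apply: "(\<Sum>x\<in>S. F x) ys = (\<Sum>x\<in>S. F x ys)"
    for S :: "'a list set" and F :: "'a list \<Rightarrow> 'a fock" and ys
    by (induction S rule: infinite_finite_induct) auto
  have comb: "tensor_comb c C ys = (\<Sum>zs\<in>C. c zs * ptensor zs ys)" for c C and ys :: "'a list"
    by (simp add: tensor_comb_def smult_fock_def fin_apply)
  have right: "(\<Sum>xs\<in>C. \<Sum>zs\<in>D. cnj (c xs) * d zs * ptensor zs xs) =
      (\<Sum>xs\<in>C. cnj (c xs) * tensor_comb d D xs)" for c d and C D :: "'a list set"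
    by (simp add: comb sum_distrib_left mult.assoc)
  have left: "(\<Sum>xs\<in>C. \<Sum>zs\<in>D. cnj (c xs) * d zs * ptensor zs xs) =
      (\<Sum>zs\<in>D. d zs * cnj (tensor_comb c C zs))" for c d and C D :: "'a list set"
    by (subst sum.swap) (simp add: comb sum_distrib_left ptensor_swap[symmetric] mult.assoc mult.left_commute)
  show ?thesis
    unfolding alg_inner_def
  proof (rule the_equality)
    show "\<exists>a' A' b' B'. finite A' \<and> finite B' \<and> tensor_comb a A = tensor_comb a' A' \<and>
        tensor_comb b B = tensor_comb b' B' \<and>
        (\<Sum>xs\<in>A. \<Sum>zs\<in>B. cnj (a xs) * b zs * ptensor zs xs) =
        (\<Sum>xs\<in>A'. \<Sum>zs\<in>B'. cnj (a' xs) * b' zs * ptensor zs xs)"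
      using assms by blast
  next
    fix c
    assume "\<exists>a' A' b' B'. finite A' \<and> finite B' \<and> tensor_comb a A = tensor_comb a' A' \<and>
        tensor_comb b B = tensor_comb b' B' \<and>
        c = (\<Sum>xs\<in>A'. \<Sum>zs\<in>B'. cnj (a' xs) * b' zs * ptensor zs xs)"
    then obtain a' A' b' B' where eqs: "tensor_comb a A = tensor_comb a' A'"
        "tensor_comb b B = tensor_comb b' B'"
      and c: "c = (\<Sum>xs\<in>A'. \<Sum>zs\<in>B'. cnj (a' xs) * b' zs * ptensor zs xs)"
      by blast
    have "c = (\<Sum>xs\<in>A'. cnj (a' xs) * tensor_comb b B xs)"
      unfolding c right eqs ..
    also have "\<dots> = (\<Sum>zs\<in>B. b zs * cnj (tensor_comb a A zs))"
      unfolding right[symmetric] left eqs(1) ..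
    finally show "c = (\<Sum>xs\<in>A. \<Sum>zs\<in>B. cnj (a xs) * b zs * ptensor zs xs)"
      unfolding left .
  qed
qed

lemma ptensor_linear_factor: "\<exists>c. \<forall>x. ptensor (xs @ x # zs) ys = cinner (ys ! length xs) x * c"
proof (cases "length ys = length xs + Suc (length zs)")
  case True
  let ?R = "{..<length ys} - {length xs}"
  have "ptensor (xs @ x # zs) ys =
      cinner (ys ! length xs) x * (\<Prod>i\<in>?R. cinner (ys ! i) ((xs @ 0 # zs) ! i))" for x
  proof -
    have "ptensor (xs @ x # zs) ys = cinner (ys ! length xs) ((xs @ x # zs) ! length xs) *
        (\<Prod>i\<in>?R. cinner (ys ! i) ((xs @ x # zs) ! i))"
    proof -
      have "ptensor (xs @ x # zs) ys = (\<Prod>i<length ys. cinner (ys ! i) ((xs @ x # zs) ! i))"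
        using True unfolding ptensor_def by simp
      also have "\<dots> = cinner (ys ! length xs) ((xs @ x # zs) ! length xs) *
          (\<Prod>i\<in>?R. cinner (ys ! i) ((xs @ x # zs) ! i))"
        using True by (intro prod.remove) auto
      finally show ?thesis .
    qed
    also have "(\<Prod>i\<in>?R. cinner (ys ! i) ((xs @ x # zs) ! i)) =
        (\<Prod>i\<in>?R. cinner (ys ! i) ((xs @ 0 # zs) ! i))"
      by (rule prod.cong) (auto simp: nth_append nth_Cons')
    finally show ?thesis by simp
  qed
  then show ?thesis by blast
qed (auto simp: ptensor_def intro!: exI[of _ 0])

lemma ptensor_add:
  "ptensor (xs @ (x + y) # zs) = ptensor (xs @ x # zs) + ptensor (xs @ y # zs)"
proof
  fix ys
  obtain c where "\<And>x. ptensor (xs @ x # zs) ys = cinner (ys ! length xs) x * c"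
    using ptensor_linear_factor by blast
  then show "ptensor (xs @ (x + y) # zs) ys = (ptensor (xs @ x # zs) + ptensor (xs @ y # zs)) ys"
    by (simp add: cinner_add_right ring_distribs)
qed

lemma ptensor_scaleC: "ptensor (xs @ (c *\<^sub>C x) # zs) = c *\<^sub>F ptensor (xs @ x # zs)"
proof
  fix ys
  obtain d where "\<And>x. ptensor (xs @ x # zs) ys = cinner (ys ! length xs) x * d"
    using ptensor_linear_factor by blast
  then show "ptensor (xs @ (c *\<^sub>C x) # zs) ys = (c *\<^sub>F ptensor (xs @ x # zs)) ys"
    by (simp add: cinner_scaleC_right smult_fock_def)
qed

lemma length_signed_permute [simp]: "length (signed_permute bar \<sigma> xs) = length xs"
  by (simp add: signed_permute_def)

lemma nth_signed_permute:
  "i < length xs \<Longrightarrow> signed_permute bar \<sigma> xs ! i = signed_nth bar xs (inv_into UNIV \<sigma> (int i + 1))"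
  by (simp add: signed_permute_def nth_upto add.commute)

lemma B_groupD:
  assumes "\<sigma> \<in> carrier (B_group n)"
  shows "\<sigma> permutes signed_points n" "\<sigma> (- k) = - \<sigma> k" "bij \<sigma>"
    "inv_into UNIV (inv_into UNIV \<sigma>) = \<sigma>" "inv_into UNIV \<sigma> (- k) = - inv_into UNIV \<sigma> k"
proof -
  show p: "\<sigma> permutes signed_points n" and m: "\<And>k. \<sigma> (- k) = - \<sigma> k"
    using assms by (auto simp: B_group_def)
  show b: "bij \<sigma>" using p by (rule permutes_bij)
  then show "inv_into UNIV (inv_into UNIV \<sigma>) = \<sigma>" by (rule inv_inv_eq)
  show "inv_into UNIV \<sigma> (- k) = - inv_into UNIV \<sigma> k"
    by (metis b bij_inv_eq_iff m)
qed

lemma group_act_ptensor: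
  assumes bar: "selfadjoint_involution bar" and \<sigma>: "\<sigma> \<in> carrier (B_group (length xs))"
  shows "group_act bar \<sigma> (ptensor xs) = ptensor (signed_permute bar \<sigma> xs)"
proof
  fix ys
  let ?n = "length xs" and ?inv = "inv_into UNIV \<sigma>"
  note B = B_groupD[OF \<sigma>]
  show "group_act bar \<sigma> (ptensor xs) ys = ptensor (signed_permute bar \<sigma> xs) ys"
  proof (cases "length ys = ?n")
    case True
    define t where "t i = nat \<bar>\<sigma> (int i + 1)\<bar> - 1" for i
    define u where "u i = nat \<bar>?inv (int i + 1)\<bar> - 1" for i
    have in_S: "\<sigma> k \<in> signed_points ?n" "?inv k \<in> signed_points ?n" if "k \<in> signed_points ?n" for k
      using that permutes_in_image[OF B(1)] permutes_in_image[OF permutes_inv[OF B(1)]] by auto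
    have cancel: "?inv (\<sigma> k) = k" "\<sigma> (?inv k) = k" for k
      using permutes_inverses[OF B(1)] by auto
    have pt: "int i + 1 \<in> signed_points ?n" if "i < ?n" for i
      using that by (auto simp: signed_points_def)
    have t: "int (t i) + 1 = \<bar>\<sigma> (int i + 1)\<bar>" "t i < ?n" if "i < ?n" for i
      using in_S(1)[OF pt[OF that]] by (auto simp: t_def signed_points_def)
    have u: "int (u i) + 1 = \<bar>?inv (int i + 1)\<bar>" "u i < ?n" if "i < ?n" for i
      using in_S(2)[OF pt[OF that]] by (auto simp: u_def signed_points_def)
    have inv_t: "?inv (int (t i) + 1) = (if \<sigma> (int i + 1) > 0 then int i + 1 else - (int i + 1))"
      if "i < ?n" for i
      using t(1)[OF that] by (auto simp: cancel B(5) abs_if)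
    have \<sigma>_u: "\<sigma> (int (u i) + 1) = (if ?inv (int i + 1) > 0 then int i + 1 else - (int i + 1))"
      if "i < ?n" for i
      using u(1)[OF that] by (auto simp: cancel B(2) abs_if)
    have ut: "u (t i) = i" if "i < ?n" for i
      unfolding u_def inv_t[OF that] by auto
    have tu: "t (u i) = i" if "i < ?n" for i
      unfolding t_def \<sigma>_u[OF that] by auto
    have "group_act bar \<sigma> (ptensor xs) ys =
        (\<Prod>i<?n. cinner (signed_nth bar ys (\<sigma> (int i + 1))) (xs ! i))"
      using True by (simp add: group_act_def ptensor_def nth_signed_permute B(4))
    also have "\<dots> = (\<Prod>i<?n. cinner (ys ! t i) (signed_nth bar xs (?inv (int (t i) + 1))))"
    proof (rule prod.cong[OF refl])
      fix i assume "i \<in> {..<?n}"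
      then have i: "i < ?n" by simp
      show "cinner (signed_nth bar ys (\<sigma> (int i + 1))) (xs ! i) =
          cinner (ys ! t i) (signed_nth bar xs (?inv (int (t i) + 1)))"
      proof (cases "\<sigma> (int i + 1) > 0")
        case True
        then show ?thesis
          unfolding inv_t[OF i] by (simp add: signed_nth_def t_def nat_add_distrib)
      next
        case False
        have "cinner (bar v) w = cinner v (bar w)" for v w
          using bar by (simp add: selfadjoint_involution_def)
        with False show ?thesis
          unfolding inv_t[OF i] by (simp add: signed_nth_def t_def nat_add_distrib)
      qed
    qed
    also have "\<dots> = (\<Prod>j<?n. cinner (ys ! j) (signed_nth bar xs (?inv (int j + 1))))"
      by (rule prod.reindex_bij_witness[of _ u t]) (auto simp: ut tu t u)
    also have "\<dots> = ptensor (signed_permute bar \<sigma> xs) ys"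
      using True by (simp add: ptensor_def nth_signed_permute)
    finally show ?thesis .
  qed (simp add: group_act_def ptensor_def)
qed

lemma tensor_power_eq_0:
  assumes "f \<in> tensor_power n" "length ys \<noteq> n"
  shows "f ys = 0"
proof -
  have fin_apply: "(\<Sum>x\<in>S. F x) ys = (\<Sum>x\<in>S. F x ys)"
    for S :: "'a list set" and F :: "'a list \<Rightarrow> 'a fock"
    by (induction S rule: infinite_finite_induct) auto
  have *: "g ys = 0" if "g \<in> alg_tensor_power n" for g
    using that assms(2)
    by (force simp: alg_tensor_power_def tensor_comb_def smult_fock_def fin_apply ptensor_def
        intro!: sum.neutral)
  obtain s where "approximates n s f"
    using assms(1) by (auto simp: tensor_power_def)
  then have "(\<lambda>k. s k ys) \<longlonglongrightarrow> f ys" and "s k ys = 0" for k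
    using * by (auto simp: approximates_def)
  then show ?thesis by (simp add: LIMSEQ_const_iff)
qed

lemma group_act_comp:
  assumes bar: "selfadjoint_involution bar"
    and \<sigma>: "\<sigma> \<in> carrier (B_group n)" and \<tau>: "\<tau> \<in> carrier (B_group n)"
    and f: "f \<in> tensor_power n"
  shows "group_act bar (\<sigma> \<circ> \<tau>) f = group_act bar \<sigma> (group_act bar \<tau> f)"
proof
  fix ys
  note S = B_groupD[OF \<sigma>] and T = B_groupD[OF \<tau>]
  have inv_comp: "inv_into UNIV (inv_into UNIV (\<sigma> \<circ> \<tau>)) = \<sigma> \<circ> \<tau>"
    by (rule inv_inv_eq) (rule bij_comp[OF T(3) S(3)])
  show "group_act bar (\<sigma> \<circ> \<tau>) f ys = group_act bar \<sigma> (group_act bar \<tau> f) ys"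
  proof (cases "length ys = n")
    case True
    have "signed_permute bar (inv_into UNIV (\<sigma> \<circ> \<tau>)) ys =
        signed_permute bar (inv_into UNIV \<tau>) (signed_permute bar (inv_into UNIV \<sigma>) ys)"
    proof (rule nth_equalityI)
      fix i assume "i < length (signed_permute bar (inv_into UNIV (\<sigma> \<circ> \<tau>)) ys)"
      then have i: "i < length ys" by simp
      have "\<tau> (int i + 1) \<in> signed_points n"
        using permutes_in_image[OF T(1), of "int i + 1"] i True by (auto simp: signed_points_def)
      moreover have "signed_nth bar (signed_permute bar (inv_into UNIV \<sigma>) ys) k =
          signed_nth bar ys (\<sigma> k)" if k: "k \<in> signed_points n" for k
      proof (cases "k > 0")
        case pos: True
        define j where "j = nat k - 1"
        have j: "k = int j + 1" "j < length ys"
          using pos k True by (auto simp: j_def signed_points_def)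
        have "signed_nth bar (signed_permute bar (inv_into UNIV \<sigma>) ys) k =
            signed_permute bar (inv_into UNIV \<sigma>) ys ! j"
          using pos unfolding j_def by (simp add: signed_nth_def)
        also have "\<dots> = signed_nth bar ys (\<sigma> k)"
          using nth_signed_permute[OF j(2)] by (simp add: S(4) j(1))
        finally show ?thesis .
      next
        case neg: False
        define j where "j = nat (- k) - 1"
        have j: "k = - (int j + 1)" "j < length ys"
          using neg k True by (auto simp: j_def signed_points_def)
        have "\<sigma> (int j + 1) \<noteq> 0"
          using permutes_in_image[OF S(1), of "int j + 1"] j True by (auto simp: signed_points_def)
        then have inv_bar: "bar (signed_nth bar ys (\<sigma> (int j + 1))) = signed_nth bar ys (- \<sigma> (int j + 1))"
          using bar by (auto simp: signed_nth_def selfadjoint_involution_def)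
        have "signed_nth bar (signed_permute bar (inv_into UNIV \<sigma>) ys) k =
            bar (signed_permute bar (inv_into UNIV \<sigma>) ys ! j)"
          using neg unfolding j_def by (simp add: signed_nth_def)
        also have "\<dots> = bar (signed_nth bar ys (\<sigma> (int j + 1)))"
          using nth_signed_permute[OF j(2)] by (simp add: S(4))
        also have "\<dots> = signed_nth bar ys (\<sigma> k)"
          unfolding j(1) S(2) by (rule inv_bar)
        finally show ?thesis .
      qed
      ultimately have k: "signed_nth bar (signed_permute bar (inv_into UNIV \<sigma>) ys) (\<tau> (int i + 1)) =
          signed_nth bar ys (\<sigma> (\<tau> (int i + 1)))"
        by blast
      show "signed_permute bar (inv_into UNIV (\<sigma> \<circ> \<tau>)) ys ! i =
          signed_permute bar (inv_into UNIV \<tau>) (signed_permute bar (inv_into UNIV \<sigma>) ys) ! i"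
        using i k by (simp add: nth_signed_permute inv_comp T)
    qed simp
    then show ?thesis by (simp add: group_act_def)
  qed (use tensor_power_eq_0[OF f] in \<open>simp add: group_act_def\<close>)
qed

lemma pi_gen_apply:
  assumes "1 \<le> i"
  shows "pi_gen i k = (if k = int i then int i + 1 else if k = int i + 1 then int i
    else if k = - int i then - int i - 1 else if k = - int i - 1 then - int i else k)"
  using assms by (simp add: pi_gen_def Transposition.transpose_def)

lemma pi_hat_apply:
  assumes "2 \<le> n"
  shows "pi_hat n k = (if k = int n then 1 - int n else if k = int n - 1 then - int n
    else if k = - int n then int n - 1 else if k = 1 - int n then int n else k)"
proof -
  have n: "int (n - 1) = int n - 1" "1 \<le> n - 1" using assms by auto
  have bar: "pi_bar n k = (if k = int n then - int n else if k = - int n then int n else k)" for k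
    by (simp add: pi_bar_def Transposition.transpose_def)
  have gen: "pi_gen (n - Suc 0) k = (if k = int n - 1 then int n else if k = int n then int n - 1
      else if k = 1 - int n then - int n else if k = - int n then 1 - int n else k)" for k
    using pi_gen_apply[OF n(2), of k] unfolding n(1) by simp
  show ?thesis
  proof -
    consider "k = int n" | "k = int n - 1" | "k = - int n" | "k = 1 - int n"
      | "k \<noteq> int n" "k \<noteq> int n - 1" "k \<noteq> - int n" "k \<noteq> 1 - int n"
      by blast
    then show ?thesis
    proof cases
      case 5
      then show ?thesis by (simp add: pi_hat_def bar gen)
    qed (use assms in \<open>simp_all add: pi_hat_def bar gen\<close>)
  qed
qed

lemma pi_gen_in_B_group:
  assumes "1 \<le> i" "i < n"
  shows "pi_gen i \<in> carrier (B_group n)"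
proof -
  have "pi_gen i permutes signed_points n"
    unfolding pi_gen_def using assms
    by (intro permutes_compose permutes_swap_id) (simp_all add: signed_points_def)
  then show ?thesis
    using assms(1) by (simp add: B_group_def pi_gen_apply)
qed

lemma pi_hat_in_B_group:
  assumes "2 \<le> n"
  shows "pi_hat n \<in> carrier (B_group n)"
proof -
  have "pi_bar n permutes signed_points n"
    unfolding pi_bar_def using assms
    by (intro permutes_swap_id) (simp_all add: signed_points_def)
  moreover have "pi_gen (n - 1) permutes signed_points n"
    using pi_gen_in_B_group[of "n - 1" n] assms by (simp add: B_group_def)
  ultimately have "pi_hat n permutes signed_points n"
    unfolding pi_hat_def by (intro permutes_compose)
  then show ?thesis
    using assms by (simp add: B_group_def pi_hat_apply)
qed

lemma group_act_pi_gen: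
  assumes "selfadjoint_involution bar"
  shows "group_act bar (pi_gen (Suc (length xs))) (ptensor (xs @ x # y # zs)) = ptensor (xs @ y # x # zs)"
proof -
  define p where "p = pi_gen (Suc (length xs))"
  note p = pi_gen_apply[of "Suc (length xs)", folded p_def, simplified]
  have "p (p k) = k" for k
  proof -
    let ?n = "int (length xs)"
    consider "k = 1 + ?n" | "k = 2 + ?n" | "k = - 1 - ?n" | "k = - 2 - ?n"
      | "k \<noteq> 1 + ?n" "k \<noteq> 2 + ?n" "k \<noteq> - 1 - ?n" "k \<noteq> - 2 - ?n"
      by blast
    then show ?thesis
    proof cases
      case 5
      then have "p k = k" unfolding p by simp
      then show ?thesis by simp
    qed (simp_all add: p)
  qed
  then have inv: "inv_into UNIV p = p"
    by (intro inv_unique_comp) (simp_all add: fun_eq_iff)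
  have "signed_permute bar p (xs @ x # y # zs) = xs @ y # x # zs"
  proof (rule nth_equalityI)
    fix i assume i: "i < length (signed_permute bar p (xs @ x # y # zs))"
    consider "i < length xs" | "i = length xs" | "i = Suc (length xs)" | "i > Suc (length xs)"
      by linarith
    then show "signed_permute bar p (xs @ x # y # zs) ! i = (xs @ y # x # zs) ! i"
      using i by cases (simp_all add: nth_signed_permute inv p signed_nth_def nth_append nat_add_distrib
          nth_Cons')
  qed simp
  moreover have "p \<in> carrier (B_group (length (xs @ x # y # zs)))"
    unfolding p_def by (rule pi_gen_in_B_group) auto
  ultimately show ?thesis
    using group_act_ptensor[OF assms] unfolding p_def by metis
qed

lemma group_act_pi_hat:
  assumes "selfadjoint_involution bar"
  shows "group_act bar (pi_hat (length xs + 2)) (ptensor (xs @ [x, y])) = ptensor (xs @ [bar y, bar x])"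
proof -
  define p where "p = pi_hat (length xs + 2)"
  note p = pi_hat_apply[of "length xs + 2", folded p_def, simplified]
  have "p (p k) = k" for k
  proof -
    let ?n = "int (length xs)"
    consider "k = 1 + ?n" | "k = 2 + ?n" | "k = - 1 - ?n" | "k = - 2 - ?n"
      | "k \<noteq> 1 + ?n" "k \<noteq> 2 + ?n" "k \<noteq> - 1 - ?n" "k \<noteq> - 2 - ?n"
      by blast
    then show ?thesis
    proof cases
      case 5
      then have "p k = k" unfolding p by simp
      then show ?thesis by simp
    qed (simp_all add: p)
  qed
  then have inv: "inv_into UNIV p = p"
    by (intro inv_unique_comp) (simp_all add: fun_eq_iff)
  have "signed_permute bar p (xs @ [x, y]) = xs @ [bar y, bar x]"
  proof (rule nth_equalityI)
    fix i assume i: "i < length (signed_permute bar p (xs @ [x, y]))"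
    then consider "i < length xs" | "i = length xs" | "i = Suc (length xs)"
      by fastforce
    then show "signed_permute bar p (xs @ [x, y]) ! i = (xs @ [bar y, bar x]) ! i"
      by cases (simp_all add: nth_signed_permute inv p signed_nth_def nth_append nat_add_distrib)
  qed simp
  moreover have "p \<in> carrier (B_group (length (xs @ [x, y])))"
    using pi_hat_in_B_group[of "length xs + 2"] by (simp add: p_def)
  ultimately show ?thesis
    using group_act_ptensor[OF assms] unfolding p_def by metis
qed

end

theory Submission
  imports Defs
begin

text \<open>
  Read a tensor as the function that it induces on lists of vectors. A group element then acts by
  rearranging, with signs, the list at which the function is evaluated, and everything below reduces
  to counting with signed words. The proof has two halves: a formula for \<open>d\<^sub>q(x)\<close>, and the fact that the
  adjoint relation has only one solution, so that the formula really is \<open>d\<^sub>q(x)\<close>.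

  \<^bold>\<open>The formula.\<close> An element of \<open>D(n)\<close> is a signed word \<open>w\<^sub>1 \<dots> w\<^sub>n\<close> with an even number of negative
  letters, and its length is the number of positive roots \<open>e\<^sub>i \<plusminus> e\<^sub>j\<close> (\<open>i < j\<close>) that it makes negative
  (\<open>D_length_eq\<close>). A word of \<open>D(n + 1)\<close> comes from exactly one word of \<open>D(n)\<close>: shift the letters away
  from zero and insert \<open>1\<close> or \<open>- 1\<close> somewhere. Inserting \<open>- 1\<close> violates the parity, which is repaired
  by flipping the sign of the last letter of the shorter word, and this flip leaves the length
  unchanged. Behind \<open>i\<close> letters, inserting \<open>1\<close> costs \<open>i\<close> and inserting \<open>- 1\<close> costs \<open>2n - i\<close> in length.
  Summing over \<open>D(n + 1)\<close> in this way gives \<open>\<langle>x \<otimes> f, P g\<rangle>\<^sub>0 = \<langle>f, P (T g)\<rangle>\<^sub>0\<close>, where \<open>T g\<close> (\<open>twisted_contraction\<close>)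
  is a sum of values of \<open>g\<close> at lists with \<open>x\<close> or \<open>bar x\<close> inserted (\<open>contract_left_P_level\<close>). So \<open>T\<close> solves
  the relation that defines \<open>d\<^sub>q(x)\<close>.

  \<^bold>\<open>Uniqueness.\<close> What is needed is that \<open>P\<close> is injective in each degree (\<open>P_level_kernel\<close>). The length of
  \<open>\<sigma> \<tau>\<^sup>-\<^sup>1\<close> is the size of the symmetric difference of the inversion sets of \<open>\<sigma>\<close> and \<open>\<tau>\<close>. On the subsets
  of a finite set, the matrix of all \<open>q\<close> to the power \<open>\<bar>A \<Delta> B\<bar>\<close> is a tensor power of the two-by-two
  matrix with diagonal \<open>1\<close> and off-diagonal \<open>q\<close>, hence positive definite for \<open>\<bar>q\<bar> < 1\<close>
  (\<open>sym_diff_form_pos\<close>). Different elements have different inversion sets, so the matrix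
  of all \<open>q\<close> to the power \<open>length(\<sigma> \<tau>\<^sup>-\<^sup>1)\<close> is a principal submatrix of it and is nonsingular.

  \<^bold>\<open>The relation.\<close> Apply \<open>T\<close> to \<open>y \<otimes> f\<close>. The two insertions at the front pair \<open>x\<close> with \<open>y\<close> and yield the
  right-hand side: inserting \<open>x\<close> gives \<open>\<langle>x, y\<rangle> f\<close>, inserting \<open>bar x\<close> gives \<open>J f\<close> with the coefficient
  \<open>\<langle>x, bar y\<rangle> q\<^sup>2\<^sup>n\<close>. All other insertions leave \<open>y\<close> in front and add up to \<open>q\<close> times \<open>y \<otimes> T f\<close>, provided
  that the last letter, whose sign is flipped, is not the one paired with \<open>y\<close> itself; this is
  where \<open>n \<noteq> 1\<close> enters (\<open>twisted_contraction_creation\<close>).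

  The Hilbert space part provides that \<open>T\<close> maps completed tensor powers to completed tensor powers,
  and that creation and contraction remain adjoint after completion. Both follow by continuity from the
  algebraic tensor powers, where Gram matrices of simple tensors have to be shown positive.
\<close>

section \<open>Lengths in the Coxeter group of type D\<close>

text \<open>
  Reciprocals put the signed points in the order \<open>1 > 2 > \<dots> > n > - n > \<dots> > - 1\<close>. The root
  \<open>e\<^sub>a - e\<^sub>b\<close>, with \<open>e\<close> odd in its index, is positive iff \<open>a\<close> precedes \<open>b\<close> in this order, for every \<open>n\<close>
  alike.
\<close>

definition recip :: "int \<Rightarrow> real" where "recip k = 1 / real_of_int k"

lemma recip_minus [simp]: "recip (- k) = - recip k"
  by (simp add: recip_def)

lemma recip_eq_iff [simp]: "recip a = recip b \<longleftrightarrow> a = b"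
  by (cases "a = 0"; cases "b = 0") (auto simp: recip_def field_simps)

lemma recip_pos_iff [simp]: "0 < recip k \<longleftrightarrow> 0 < k"
  by (simp add: recip_def)

lemma recip_neg_iff [simp]: "recip k < 0 \<longleftrightarrow> k < 0"
  by (simp add: recip_def)

lemma recip_less_iff_pos: "0 < a \<Longrightarrow> 0 < b \<Longrightarrow> recip a < recip b \<longleftrightarrow> b < a"
  by (simp add: recip_def field_simps)

lemma recip_less_abs:
  assumes "0 < i" "i < \<bar>j\<bar>"
  shows "recip j < recip i"
proof (cases "0 < j")
  case False
  then have "recip j \<le> 0" by (simp add: recip_def)
  moreover have "0 < recip i" using assms by simp
  ultimately show ?thesis by linarith
qed (use assms in \<open>auto simp: recip_less_iff_pos\<close>)

text \<open>
  The pair \<open>(i, j)\<close> stands for the root \<open>e\<^sub>i - e\<^sub>j\<close>, where \<open>e\<close> is odd in its index; so \<open>(i, - j)\<close> is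
  \<open>e\<^sub>i + e\<^sub>j\<close>. Every positive root of type D has exactly one such representation.
\<close>

definition pos_roots :: "nat \<Rightarrow> (int \<times> int) set" where
  "pos_roots n = {(i, j). 0 < i \<and> i < \<bar>j\<bar> \<and> \<bar>j\<bar> \<le> int n}"

definition inversions :: "nat \<Rightarrow> (int \<Rightarrow> int) \<Rightarrow> (int \<times> int) set" where
  "inversions n \<sigma> = {(i, j) \<in> pos_roots n. recip (\<sigma> i) < recip (\<sigma> j)}"

abbreviation "inv_number n \<sigma> \<equiv> card (inversions n \<sigma>)"

abbreviation "signed_perms n \<equiv> carrier (B_group n)"

text \<open>
  All pairs that represent a root, positive or negative: both \<open>(i, j)\<close> and \<open>(- j, - i)\<close> represent
  \<open>e\<^sub>i - e\<^sub>j\<close>. This redundant set is mapped to itself by every signed permutation, which makes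
  changes of variables trivial.
\<close>

definition sign_pairs :: "nat \<Rightarrow> (int \<times> int) set" where
  "sign_pairs n = {(i, j). i \<in> signed_points n \<and> j \<in> signed_points n \<and> \<bar>i\<bar> \<noteq> \<bar>j\<bar>}"

lemma finite_signed_points [simp]: "finite (signed_points n)"
  by (simp add: signed_points_def)

lemma finite_sign_pairs: "finite (sign_pairs n)"
  by (rule finite_subset[of _ "signed_points n \<times> signed_points n"]) (auto simp: sign_pairs_def)

lemma pos_roots_subset: "pos_roots n \<subseteq> sign_pairs n"
  by (auto simp: pos_roots_def sign_pairs_def signed_points_def)

lemma finite_pos_roots [simp]: "finite (pos_roots n)"
  by (rule finite_subset[OF pos_roots_subset finite_sign_pairs])

lemma finite_inversions [simp]: "finite (inversions n \<sigma>)"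
  by (rule finite_subset[of _ "pos_roots n"]) (auto simp: inversions_def)

text \<open>
  A positive root has two representatives and so has its negative, which explains the factor.
\<close>

lemma card_eq_four_pos_roots:
  assumes "M \<subseteq> sign_pairs n"
    and swap: "\<And>i j. (i, j) \<in> M \<Longrightarrow> (j, i) \<in> M"
    and neg: "\<And>i j. (i, j) \<in> M \<Longrightarrow> (- i, - j) \<in> M"
  shows "card M = 4 * card (M \<inter> pos_roots n)"
proof -
  have fin: "finite M"
    by (rule finite_subset[OF assms(1) finite_sign_pairs])
  define M1 where "M1 = {(i, j) \<in> M. \<bar>i\<bar> < \<bar>j\<bar> \<and> 0 < i}"
  define M2 where "M2 = {(i, j) \<in> M. \<bar>i\<bar> < \<bar>j\<bar> \<and> i < 0}"
  define M3 where "M3 = {(i, j) \<in> M. \<bar>j\<bar> < \<bar>i\<bar> \<and> 0 < j}"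
  define M4 where "M4 = {(i, j) \<in> M. \<bar>j\<bar> < \<bar>i\<bar> \<and> j < 0}"
  note M = M1_def M2_def M3_def M4_def
  have M1: "M1 = M \<inter> pos_roots n"
    using assms(1) by (auto simp: M1_def pos_roots_def sign_pairs_def signed_points_def)
  have neg': "(i, j) \<in> M" if "(- i, - j) \<in> M" for i j
    using neg[OF that] by simp
  have "bij_betw (\<lambda>(i, j). (- i, - j)) M1 M2"
    by (rule bij_betw_byWitness[where f' = "\<lambda>(i, j). (- i, - j)"]) (auto simp: M neg)
  moreover have "bij_betw (\<lambda>(i, j). (j, i)) M1 M3"
    by (rule bij_betw_byWitness[where f' = "\<lambda>(i, j). (j, i)"]) (auto simp: M swap)
  moreover have "bij_betw (\<lambda>(i, j). (- j, - i)) M1 M4"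
    by (rule bij_betw_byWitness[where f' = "\<lambda>(i, j). (- j, - i)"]) (auto simp: M swap neg)
  ultimately have cards: "card M2 = card M1" "card M3 = card M1" "card M4 = card M1"
    by (simp_all add: bij_betw_same_card[symmetric])
  have "M = (M1 \<union> M2) \<union> (M3 \<union> M4)"
    using assms(1) by (force simp: M sign_pairs_def signed_points_def)
  moreover have "card ((M1 \<union> M2) \<union> (M3 \<union> M4)) = card (M1 \<union> M2) + card (M3 \<union> M4)"
    by (rule card_Un_disjoint) (auto simp: M intro: finite_subset[OF _ fin])
  moreover have "card (M1 \<union> M2) = card M1 + card M2"
    by (rule card_Un_disjoint) (auto simp: M intro: finite_subset[OF _ fin])
  moreover have "card (M3 \<union> M4) = card M3 + card M4"
    by (rule card_Un_disjoint) (auto simp: M intro: finite_subset[OF _ fin])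
  ultimately show ?thesis using cards M1 by simp
qed

lemma signed_perms_inj: "\<sigma> \<in> signed_perms n \<Longrightarrow> \<sigma> i = \<sigma> j \<longleftrightarrow> i = j"
  using B_groupD(3) bij_is_inj inj_eq by metis

lemma signed_perms_signed_points: "\<sigma> \<in> signed_perms n \<Longrightarrow> \<sigma> k \<in> signed_points n \<longleftrightarrow> k \<in> signed_points n"
  using B_groupD(1) permutes_in_image by metis

lemma signed_perms_abs_eq:
  assumes "\<sigma> \<in> signed_perms n"
  shows "\<bar>\<sigma> i\<bar> = \<bar>\<sigma> j\<bar> \<longleftrightarrow> \<bar>i\<bar> = \<bar>j\<bar>"
  using signed_perms_inj[OF assms, of i j] signed_perms_inj[OF assms, of i "- j"]
  by (simp add: abs_eq_iff B_groupD(2)[OF assms])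

lemma signed_perms_comp: "\<sigma> \<in> signed_perms n \<Longrightarrow> \<tau> \<in> signed_perms n \<Longrightarrow> \<sigma> \<circ> \<tau> \<in> signed_perms n"
  by (auto simp: B_group_def intro: permutes_compose)

lemma signed_perms_id: "id \<in> signed_perms n"
  by (auto simp: B_group_def permutes_id)

lemma signed_perms_inv:
  assumes "\<sigma> \<in> signed_perms n"
  shows "inv_into UNIV \<sigma> \<in> signed_perms n"
  using permutes_inv[OF B_groupD(1)[OF assms]] B_groupD(5)[OF assms] by (auto simp: B_group_def)

lemma signed_perms_inv_comp:
  assumes "\<sigma> \<in> signed_perms n"
  shows "\<sigma> \<circ> inv_into UNIV \<sigma> = id" "inv_into UNIV \<sigma> \<circ> \<sigma> = id"
  using permutes_inv_o[OF B_groupD(1)[OF assms]] by auto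

definition disagreements :: "nat \<Rightarrow> (int \<Rightarrow> int) \<Rightarrow> (int \<Rightarrow> int) \<Rightarrow> (int \<times> int) set" where
  "disagreements n \<sigma> \<tau> =
     {(i, j) \<in> sign_pairs n. (recip (\<sigma> i) < recip (\<sigma> j)) \<noteq> (recip (\<tau> i) < recip (\<tau> j))}"

lemma card_disagreements:
  assumes "\<sigma> \<in> signed_perms n" "\<tau> \<in> signed_perms n"
  shows "card (disagreements n \<sigma> \<tau>) = 4 * card (sym_diff (inversions n \<sigma>) (inversions n \<tau>))"
proof -
  have *: "recip (\<rho> j) < recip (\<rho> i) \<longleftrightarrow> \<not> recip (\<rho> i) < recip (\<rho> j)" if "\<rho> \<in> signed_perms n" "\<bar>i\<bar> \<noteq> \<bar>j\<bar>" for \<rho> i j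
  proof -
    have "i \<noteq> j" using that by auto
    then have "recip (\<rho> i) \<noteq> recip (\<rho> j)" using signed_perms_inj[OF that(1)] by simp
    then show ?thesis by linarith
  qed
  have "card (disagreements n \<sigma> \<tau>) = 4 * card (disagreements n \<sigma> \<tau> \<inter> pos_roots n)"
  proof (rule card_eq_four_pos_roots)
    show "disagreements n \<sigma> \<tau> \<subseteq> sign_pairs n"
      by (auto simp: disagreements_def)
    show "(j, i) \<in> disagreements n \<sigma> \<tau>" if "(i, j) \<in> disagreements n \<sigma> \<tau>" for i j
      using that *[OF assms(1), of i j] *[OF assms(2), of i j]
      by (auto simp: disagreements_def sign_pairs_def)
    show "(- i, - j) \<in> disagreements n \<sigma> \<tau>" if "(i, j) \<in> disagreements n \<sigma> \<tau>" for i j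
      using that *[OF assms(1), of i j] *[OF assms(2), of i j]
      by (auto simp: disagreements_def sign_pairs_def signed_points_def B_groupD(2)[OF assms(1)]
          B_groupD(2)[OF assms(2)])
  qed
  also have "disagreements n \<sigma> \<tau> \<inter> pos_roots n = sym_diff (inversions n \<sigma>) (inversions n \<tau>)"
    using pos_roots_subset by (auto simp: disagreements_def inversions_def)
  finally show ?thesis .
qed

text \<open>
  Inversion sets measure a right-invariant distance: \<open>\<sigma>\<close> and \<open>\<tau>\<close> disagree at \<open>\<rho> \<beta>\<close> iff \<open>\<sigma> \<rho>\<close> and
  \<open>\<tau> \<rho>\<close> disagree at \<open>\<beta>\<close>. Both subadditivity of the length and the positivity of the kernel rest on this.
\<close>

lemma sym_diff_inversions_comp:
  assumes "\<sigma> \<in> signed_perms n" "\<tau> \<in> signed_perms n" "\<rho> \<in> signed_perms n"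
  shows "card (sym_diff (inversions n (\<sigma> \<circ> \<rho>)) (inversions n (\<tau> \<circ> \<rho>))) =
    card (sym_diff (inversions n \<sigma>) (inversions n \<tau>))"
proof -
  let ?r = "inv_into UNIV \<rho>"
  have c: "\<rho> (?r k) = k" "?r (\<rho> k) = k" for k
    using signed_perms_inv_comp[OF assms(3)] by (auto simp: fun_eq_iff)
  note r = signed_perms_inv[OF assms(3)]
  have "bij_betw (\<lambda>(i, j). (\<rho> i, \<rho> j)) (disagreements n (\<sigma> \<circ> \<rho>) (\<tau> \<circ> \<rho>)) (disagreements n \<sigma> \<tau>)"
    by (rule bij_betw_byWitness[where f' = "\<lambda>(i, j). (?r i, ?r j)"])
      (auto simp: disagreements_def sign_pairs_def c signed_perms_signed_points[OF assms(3)]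
        signed_perms_signed_points[OF r] signed_perms_abs_eq[OF assms(3)] signed_perms_abs_eq[OF r])
  then have "card (disagreements n (\<sigma> \<circ> \<rho>) (\<tau> \<circ> \<rho>)) = card (disagreements n \<sigma> \<tau>)"
    by (rule bij_betw_same_card)
  then show ?thesis
    using assms by (simp add: card_disagreements signed_perms_comp)
qed

lemma inversions_id [simp]: "inversions n id = {}"
  using recip_less_abs by (force simp: inversions_def pos_roots_def)

lemma card_sym_diff_le:
  assumes "finite X" "finite Y" "finite Z"
  shows "card (sym_diff X Z) \<le> card (sym_diff X Y) + card (sym_diff Y Z)"
proof -
  have "card (sym_diff X Z) \<le> card (sym_diff X Y \<union> sym_diff Y Z)"
    by (rule card_mono) (use assms in auto)
  also have "\<dots> \<le> card (sym_diff X Y) + card (sym_diff Y Z)"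
    by (rule card_Un_le)
  finally show ?thesis .
qed

lemma inv_number_eq_sym_diff:
  assumes "\<sigma> \<in> signed_perms n" "\<tau> \<in> signed_perms n"
  shows "inv_number n (\<sigma> \<circ> inv_into UNIV \<tau>) = card (sym_diff (inversions n \<sigma>) (inversions n \<tau>))"
  using sym_diff_inversions_comp[OF assms signed_perms_inv[OF assms(2)]] signed_perms_inv_comp[OF assms(2)] by simp

lemma inv_number_comp_le:
  assumes "\<sigma> \<in> signed_perms n" "\<tau> \<in> signed_perms n"
  shows "inv_number n (\<sigma> \<circ> \<tau>) \<le> inv_number n \<sigma> + inv_number n \<tau>"
  using card_sym_diff_le[of "inversions n (\<sigma> \<circ> \<tau>)" "inversions n \<tau>" "{}"]
    sym_diff_inversions_comp[OF assms(1) signed_perms_id assms(2)] by simp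

lemma pos_root_or_dual:
  assumes "(i, j) \<in> sign_pairs n" "recip j < recip i"
  shows "(i, j) \<in> pos_roots n \<or> (- j, - i) \<in> pos_roots n"
proof -
  have nz: "i \<noteq> 0" "j \<noteq> 0" "\<bar>i\<bar> \<noteq> \<bar>j\<bar>" "\<bar>i\<bar> \<le> int n" "\<bar>j\<bar> \<le> int n"
    using assms(1) by (auto simp: sign_pairs_def signed_points_def)
  show ?thesis
  proof (cases "\<bar>i\<bar> < \<bar>j\<bar>")
    case True
    have "\<not> i < 0" using recip_less_abs[of "- i" j] recip_less_abs[of "- i" "- j"] True assms(2) by auto
    with True nz show ?thesis by (auto simp: pos_roots_def)
  next
    case False
    then have lt: "\<bar>j\<bar> < \<bar>i\<bar>" using nz by simp
    have "\<not> j > 0" using recip_less_abs[of j i] lt assms(2) by auto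
    with lt nz show ?thesis by (auto simp: pos_roots_def)
  qed
qed

text \<open>
  If \<open>s\<close> inverts only the root \<open>\<alpha>\<close>, then \<open>s \<sigma>\<close> and \<open>\<sigma>\<close> are at distance one, so their inversion sets
  differ in a single root. That root is \<open>- \<sigma>\<^sup>-\<^sup>1 \<alpha>\<close>, an inversion of \<open>\<sigma>\<close>.
\<close>

lemma inv_number_descent:
  assumes s: "s \<in> signed_perms n" and \<sigma>: "\<sigma> \<in> signed_perms n" and root: "inversions n s = {(a, b)}"
    and desc: "recip (inv_into UNIV \<sigma> a) < recip (inv_into UNIV \<sigma> b)"
  shows "inv_number n \<sigma> = Suc (inv_number n (s \<circ> \<sigma>))"
proof -
  let ?r = "inv_into UNIV \<sigma>"
  have c: "\<sigma> (?r k) = k" for k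
    using signed_perms_inv_comp[OF \<sigma>] by (auto simp: fun_eq_iff)
  note r = signed_perms_inv[OF \<sigma>]
  have ab: "(a, b) \<in> pos_roots n" "recip (s a) < recip (s b)"
    using root by (auto simp: inversions_def)
  then have ba: "recip b < recip a" by (auto simp: pos_roots_def recip_less_abs)
  have "(?r b, ?r a) \<in> sign_pairs n"
    using subsetD[OF pos_roots_subset ab(1)]
    by (auto simp: sign_pairs_def signed_perms_signed_points[OF r] signed_perms_abs_eq[OF r])
  \<comment> \<open>the root \<open>- \<sigma>\<^sup>-\<^sup>1 \<alpha>\<close>, in whichever of its two representations is the canonical one\<close>
  from pos_root_or_dual[OF this desc]
  obtain \<beta> where \<beta>: "\<beta> \<in> inversions n \<sigma>" "\<beta> \<notin> inversions n (s \<circ> \<sigma>)"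
  proof
    assume "(?r b, ?r a) \<in> pos_roots n"
    with ab(2) ba show thesis
      by (intro that[of "(?r b, ?r a)"]) (auto simp: inversions_def c)
  next
    assume "(- ?r a, - ?r b) \<in> pos_roots n"
    with ab(2) ba show thesis
      by (intro that[of "(- ?r a, - ?r b)"])
        (auto simp: inversions_def c B_groupD(2)[OF \<sigma>] B_groupD(2)[OF s])
  qed
  have "card (sym_diff (inversions n (s \<circ> \<sigma>)) (inversions n \<sigma>)) = 1"
    using sym_diff_inversions_comp[OF s signed_perms_id \<sigma>] root by simp
  then obtain \<gamma> where \<gamma>: "sym_diff (inversions n (s \<circ> \<sigma>)) (inversions n \<sigma>) = {\<gamma>}"
    by (auto simp: card_1_singleton_iff)
  have differ: "\<alpha> \<in> inversions n \<sigma> \<longleftrightarrow> \<alpha> \<notin> inversions n (s \<circ> \<sigma>)" if "\<alpha> = \<gamma>" for \<alpha>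
    using arg_cong[OF \<gamma>, of "\<lambda>S. \<alpha> \<in> S"] that by simp blast
  have same: "\<alpha> \<in> inversions n \<sigma> \<longleftrightarrow> \<alpha> \<in> inversions n (s \<circ> \<sigma>)" if "\<alpha> \<noteq> \<gamma>" for \<alpha>
    using arg_cong[OF \<gamma>, of "\<lambda>S. \<alpha> \<in> S"] that by simp blast
  have "\<beta> = \<gamma>" using \<beta> same[of \<beta>] by metis
  have "\<alpha> \<in> inversions n \<sigma> \<longleftrightarrow> \<alpha> \<in> insert \<beta> (inversions n (s \<circ> \<sigma>))" for \<alpha>
    using \<beta> same[of \<alpha>] \<open>\<beta> = \<gamma>\<close> by (cases "\<alpha> = \<gamma>") simp_all
  then have "inversions n \<sigma> = insert \<beta> (inversions n (s \<circ> \<sigma>))" by (rule Set.set_eqI)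
  with \<beta>(2) show ?thesis by simp
qed

text \<open>
  The parity of the number of sign changes, which separates type D inside type B.
\<close>

definition sign_prod :: "nat \<Rightarrow> (int \<Rightarrow> int) \<Rightarrow> int" where
  "sign_prod n \<sigma> = (\<Prod>i\<in>{1..int n}. sgn (\<sigma> i))"

lemma sign_prod_comp:
  assumes "\<sigma> \<in> signed_perms n" "\<tau> \<in> signed_perms n"
  shows "sign_prod n (\<sigma> \<circ> \<tau>) = sign_prod n \<sigma> * sign_prod n \<tau>"
proof -
  let ?r = "inv_into UNIV \<tau>"
  have c: "\<tau> (?r k) = k" "?r (\<tau> k) = k" for k
    using signed_perms_inv_comp[OF assms(2)] by (auto simp: fun_eq_iff)
  note m = B_groupD(2)[OF assms(1)] B_groupD(2)[OF assms(2)] B_groupD(5)[OF assms(2)]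
  have rng: "\<bar>\<rho> i\<bar> \<in> {1..int n}" if "\<rho> \<in> signed_perms n" "i \<in> {1..int n}" for \<rho> i
    using signed_perms_signed_points[OF that(1), of i] that(2) by (auto simp: signed_points_def)
  have "sgn (\<sigma> (\<tau> i)) = sgn (\<sigma> \<bar>\<tau> i\<bar>) * sgn (\<tau> i)" if "i \<in> {1..int n}" for i
    using rng[OF assms(2) that] by (auto simp: abs_if m sgn_if)
  then have "sign_prod n (\<sigma> \<circ> \<tau>) = (\<Prod>i\<in>{1..int n}. sgn (\<sigma> \<bar>\<tau> i\<bar>)) * sign_prod n \<tau>"
    by (simp add: sign_prod_def prod.distrib)
  also have "(\<Prod>i\<in>{1..int n}. sgn (\<sigma> \<bar>\<tau> i\<bar>)) = (\<Prod>i\<in>{1..int n}. sgn (\<sigma> i))"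
    by (rule prod.reindex_bij_witness[of _ "\<lambda>j. \<bar>?r j\<bar>" "\<lambda>i. \<bar>\<tau> i\<bar>"])
      (use rng[OF assms(2)] rng[OF signed_perms_inv[OF assms(2)]] in \<open>auto simp: abs_if m c split: if_splits\<close>)
  finally show ?thesis by (simp add: sign_prod_def)
qed

text \<open>
  Without descents the images \<open>\<rho> 1, \<dots>, \<rho> n\<close> are decreasing in the order given by \<open>recip\<close>, and \<open>\<rho> (n - 1)\<close>
  precedes both \<open>\<rho> n\<close> and \<open>- \<rho> n\<close>. Hence all of them are positive except possibly the last, whose sign
  is then forced by parity, and an increasing bijection of \<open>{1..n}\<close> is the identity.
\<close>

lemma no_descent_imp_id:
  assumes "\<rho> \<in> signed_perms n" "sign_prod n \<rho> = 1"
    and dec: "\<And>i. 1 \<le> i \<Longrightarrow> i < n \<Longrightarrow> recip (\<rho> (int i + 1)) < recip (\<rho> (int i))"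
    and last: "2 \<le> n \<Longrightarrow> recip (\<rho> (- int n)) < recip (\<rho> (int n - 1))"
  shows "\<rho> = id"
proof -
  note m = B_groupD(2)[OF assms(1)]
  have rng: "\<rho> (int i) \<noteq> 0" "\<bar>\<rho> (int i)\<bar> \<le> int n" if "1 \<le> i" "i \<le> n" for i
    using signed_perms_signed_points[OF assms(1), of "int i"] that by (auto simp: signed_points_def)
  have mono: "recip (\<rho> (int (i + k))) \<le> recip (\<rho> (int i))" if "1 \<le> i" "i + k \<le> n" for i k
    using that
  proof (induction k)
    case (Suc k)
    then show ?case using dec[of "i + k"] by (simp add: algebra_simps)
  qed simp
  have pos1: "0 < \<rho> (int i)" if "1 \<le> i" "i < n" for i
  proof -
    have n: "int (n - 1) = int n - 1" "2 \<le> n" using that by auto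
    have "recip (\<rho> (int (i + (n - 1 - i)))) \<le> recip (\<rho> (int i))"
      using that by (intro mono) auto
    then have 1: "recip (\<rho> (int n - 1)) \<le> recip (\<rho> (int i))" using that n by simp
    have "recip (\<rho> (int n)) < recip (\<rho> (int n - 1))"
      using dec[of "n - 1"] n by simp
    with 1 last[OF n(2)] have "0 < recip (\<rho> (int i))" by (simp add: m del: recip_pos_iff)
    then show ?thesis by simp
  qed
  have pos: "0 < \<rho> (int i)" if "1 \<le> i" "i \<le> n" for i
  proof (cases "i = n")
    case True
    have "{1..int n} = insert (int n) {1..int n - 1}" using True that by auto
    then have "sign_prod n \<rho> = sgn (\<rho> (int n)) * (\<Prod>i\<in>{1..int n - 1}. sgn (\<rho> i))"
      by (simp add: sign_prod_def)
    also have "(\<Prod>i\<in>{1..int n - 1}. sgn (\<rho> i)) = 1"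
    proof (rule prod.neutral, rule ballI)
      fix j assume "j \<in> {1..int n - 1}"
      then have "1 \<le> nat j" "nat j < n" "int (nat j) = j" by auto
      then show "sgn (\<rho> j) = 1" using pos1[of "nat j"] by simp
    qed
    finally show ?thesis using assms(2) True by (simp add: sgn_if split: if_splits)
  qed (use pos1 that in auto)
  have incr: "\<rho> (int i) < \<rho> (int i + 1)" if "1 \<le> i" "i < n" for i
    using dec[OF that] pos[of i] pos[of "Suc i"] that by (simp add: recip_less_iff_pos add.commute)
  have lower: "int i \<le> \<rho> (int i)" if "1 \<le> i" "i \<le> n" for i
    using that
  proof (induction i)
    case (Suc i)
    then show ?case using incr[of i] pos[of 1] by (cases "i = 0") (auto simp: algebra_simps)
  qed simp
  have upper: "\<rho> (int (n - k)) \<le> int (n - k)" if "k < n" for k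
    using that
  proof (induction k)
    case 0
    then show ?case using rng[of n] by auto
  next
    case (Suc k)
    then have "\<rho> (int (n - Suc k)) < \<rho> (int (n - Suc k) + 1)" by (intro incr) auto
    moreover have "int (n - Suc k) + 1 = int (n - k)" using Suc.prems by auto
    ultimately show ?case using Suc by auto
  qed
  have fix_pos: "\<rho> (int i) = int i" if "1 \<le> i" "i \<le> n" for i
    using lower[OF that] upper[of "n - i"] that by simp
  have "\<rho> k = k" for k
  proof (cases "k \<in> signed_points n")
    case True
    then show ?thesis
      using fix_pos[of "nat k"] fix_pos[of "nat (- k)"] m[of k]
      by (cases "k > 0") (auto simp: signed_points_def)
  next
    case False
    then show ?thesis using B_groupD(1)[OF assms(1)] by (simp add: permutes_def)
  qed
  then show ?thesis by auto
qed

lemma inversions_pi_gen: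
  assumes "1 \<le> i" "i < n"
  shows "inversions n (pi_gen i) = {(int i, int i + 1)}"
proof -
  have "(recip (pi_gen i a) < recip (pi_gen i b)) = (a = int i \<and> b = int i + 1)"
    if "0 < a" "a < \<bar>b\<bar>" for a b
  proof (cases "a = int i \<and> b = int i + 1")
    case True
    then show ?thesis using assms by (auto simp: pi_gen_apply recip_less_iff_pos)
  next
    case False
    have "recip (pi_gen i b) < recip (pi_gen i a)"
    proof (cases "a = int i \<and> b = - int i - 1")
      case True
      then have "recip (pi_gen i b) < 0" "0 < recip (pi_gen i a)" using assms by (auto simp: pi_gen_apply)
      then show ?thesis by (rule less_trans)
    next
      case other: False
      have "0 < pi_gen i a" "pi_gen i a < \<bar>pi_gen i b\<bar>"
        using that False other assms by (auto simp: pi_gen_apply)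
      then show ?thesis by (rule recip_less_abs)
    qed
    with False show ?thesis by auto
  qed
  then show ?thesis using assms by (auto simp: inversions_def pos_roots_def)
qed

lemma inversions_pi_hat:
  assumes "2 \<le> n"
  shows "inversions n (pi_hat n) = {(int n - 1, - int n)}"
proof -
  have "(recip (pi_hat n a) < recip (pi_hat n b)) = (a = int n - 1 \<and> b = - int n)"
    if "0 < a" "a < \<bar>b\<bar>" "\<bar>b\<bar> \<le> int n" for a b
  proof -
    have "a = int n - 1 \<and> b = - int n \<or> a = int n - 1 \<and> b = int n \<or> a < int n - 1"
      using that by arith
    then consider "a = int n - 1" "b = - int n" | "a = int n - 1" "b = int n" | "a < int n - 1"
      by blast
    then show ?thesis
    proof cases
      case 3
      then have "pi_hat n a = a" using that by (auto simp: pi_hat_apply[OF assms])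
      moreover have "a < \<bar>pi_hat n b\<bar>" using 3 that by (auto simp: pi_hat_apply[OF assms])
      ultimately show ?thesis using 3 that recip_less_abs[of a "pi_hat n b"] by auto
    qed (use that assms in \<open>auto simp: pi_hat_apply recip_less_iff_pos recip_def field_simps\<close>)
  qed
  then show ?thesis using assms by (auto simp: inversions_def pos_roots_def)
qed

lemma sign_prod_pi_gen: "1 \<le> i \<Longrightarrow> i < n \<Longrightarrow> sign_prod n (pi_gen i) = 1"
  by (auto simp: sign_prod_def pi_gen_apply intro!: prod.neutral)

lemma sign_prod_pi_hat:
  assumes "2 \<le> n"
  shows "sign_prod n (pi_hat n) = 1"
proof -
  have "{1..int n} = insert (int n) (insert (int n - 1) {1..int n - 2})" using assms by auto
  then have "sign_prod n (pi_hat n) = (\<Prod>i\<in>{1..int n - 2}. sgn (pi_hat n i))"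
    using assms by (simp add: sign_prod_def pi_hat_apply)
  also have "\<dots> = 1"
    by (rule prod.neutral) (auto simp: pi_hat_apply[OF assms])
  finally show ?thesis .
qed

text \<open>
  Each generator is the reflection in a simple root, and that root is the only positive root
  that it inverts.
\<close>

lemma D_gens_reflection:
  fixes s :: "int \<Rightarrow> int"
  assumes "s \<in> D_gens n"
  shows "s \<in> signed_perms n" "inv_number n s = 1" "sign_prod n s = 1" "s \<circ> s = id"
proof -
  have "2 \<le> n" using assms by (simp add: D_gens_def split: if_splits)
  have "s \<in> pi_gen ` {1..n - 1} \<or> s = pi_hat n"
    using assms \<open>2 \<le> n\<close> by (simp add: D_gens_def) blast
  then have cases: "(\<exists>i. 1 \<le> i \<and> i < n \<and> s = pi_gen i) \<or> s = pi_hat n"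
  proof
    assume "s \<in> pi_gen ` {1..n - 1}"
    then obtain i where "i \<in> {1..n - 1}" "s = pi_gen i" by blast
    then show ?thesis by (intro disjI1 exI[of _ i]) auto
  qed simp
  with \<open>2 \<le> n\<close> show "s \<in> signed_perms n" "inv_number n s = 1" "sign_prod n s = 1"
    by (auto simp: pi_gen_in_B_group pi_hat_in_B_group inversions_pi_gen inversions_pi_hat
        sign_prod_pi_gen sign_prod_pi_hat)
  have "pi_bar n \<circ> pi_bar n = id" by (simp add: pi_bar_def)
  moreover have gen: "pi_gen i \<circ> pi_gen i = id" if "1 \<le> i" for i
    using that by (auto simp: fun_eq_iff pi_gen_apply)
  ultimately have "pi_hat n \<circ> pi_hat n = id"
    using gen[of "n - 1"] \<open>2 \<le> n\<close> unfolding pi_hat_def fun_eq_iff by auto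
  with gen cases show "s \<circ> s = id" by auto
qed

abbreviation word_prod :: "(int \<Rightarrow> int) list \<Rightarrow> int \<Rightarrow> int" where
  "word_prod ws \<equiv> foldr (\<circ>) ws id"

lemma word_prod_Cons: "word_prod (s # ws) = s \<circ> word_prod ws"
  by simp

lemma word_prod_bounds:
  fixes ws :: "(int \<Rightarrow> int) list"
  assumes "set ws \<subseteq> D_gens n"
  shows "word_prod ws \<in> signed_perms n \<and> inv_number n (word_prod ws) \<le> length ws \<and>
    sign_prod n (word_prod ws) = 1"
  using assms
proof (induction ws)
  case Nil
  have "word_prod [] = (id :: int \<Rightarrow> int)" by simp
  then show ?case using signed_perms_id[of n] inversions_id[of n] by (simp only: sign_prod_def) simp
next
  case (Cons s ws)
  define p where "p = word_prod ws"
  have eq: "word_prod (s # ws) = s \<circ> p" unfolding p_def by (rule word_prod_Cons)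
  have s: "s \<in> D_gens n" and p: "p \<in> signed_perms n" "inv_number n p \<le> length ws" "sign_prod n p = 1"
    using Cons by (auto simp only: p_def set_simps insert_subset)
  note g = D_gens_reflection[OF s]
  have "inv_number n (s \<circ> p) \<le> length (s # ws)"
    using inv_number_comp_le[OF g(1) p(1)] p(2) g(2) by simp
  then show ?case
    unfolding eq using signed_perms_comp[OF g(1) p(1)] sign_prod_comp[OF g(1) p(1)]
    unfolding g(3) p(3) mult_1_left by blast
qed

text \<open>
  Peel off descents on the left until none remain. The induction never leaves the elements of even
  parity, so it also shows that these are exactly the elements of \<open>D(n)\<close>.
\<close>

lemma reduced_word_exists:
  assumes "\<sigma> \<in> signed_perms n" "sign_prod n \<sigma> = 1"
  shows "\<exists>ws :: (int \<Rightarrow> int) list. length ws = inv_number n \<sigma> \<and> set ws \<subseteq> D_gens n \<and> \<sigma> = word_prod ws"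
  using assms
proof (induction "inv_number n \<sigma>" arbitrary: \<sigma> rule: less_induct)
  case less
  let ?r = "inv_into UNIV \<sigma>"
  show ?case
  proof (cases "\<exists>s a b. s \<in> D_gens n \<and> inversions n s = {(a, b)} \<and> recip (?r a) < recip (?r b)")
    case True
    then obtain s a b where s: "s \<in> D_gens n" "inversions n s = {(a, b)}" "recip (?r a) < recip (?r b)"
      by blast
    note g = D_gens_reflection[OF s(1)]
    have len: "inv_number n \<sigma> = Suc (inv_number n (s \<circ> \<sigma>))"
      by (rule inv_number_descent[OF g(1) less.prems(1) s(2,3)])
    then obtain ws where ws: "length ws = inv_number n (s \<circ> \<sigma>)" "set ws \<subseteq> D_gens n"
        "s \<circ> \<sigma> = word_prod ws"
      using less.hyps[of "s \<circ> \<sigma>"] less.prems g by (auto simp: signed_perms_comp sign_prod_comp)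
    have "\<sigma> = s \<circ> (s \<circ> \<sigma>)"
      using g(4) by (simp add: o_assoc)
    also have "\<dots> = word_prod (s # ws)" unfolding ws(3) by simp
    finally have "\<sigma> = word_prod (s # ws)" .
    moreover have "length (s # ws) = inv_number n \<sigma>" using ws(1) len by simp
    moreover have "set (s # ws) \<subseteq> D_gens n" using ws(2) s(1) by simp
    ultimately show ?thesis by blast
  next
    case False
    note r = signed_perms_inv[OF less.prems(1)]
    have nd: "recip (?r b) < recip (?r a)" if "s \<in> D_gens n" "inversions n s = {(a, b)}" for s a b
    proof -
      have "\<not> recip (?r a) < recip (?r b)" using False that by blast
      moreover have "a \<noteq> b" using that(2) by (auto simp: inversions_def)
      then have "recip (?r a) \<noteq> recip (?r b)" using signed_perms_inj[OF r] by simp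
      ultimately show ?thesis by linarith
    qed
    have "sign_prod n ?r = 1"
      using sign_prod_comp[OF less.prems(1) r] signed_perms_inv_comp[OF less.prems(1)] less.prems(2)
      by (simp add: sign_prod_def)
    then have "?r = id"
    proof (rule no_descent_imp_id[OF r])
      show "recip (?r (int i + 1)) < recip (?r (int i))" if "1 \<le> i" "i < n" for i
        by (rule nd[of "pi_gen i"]) (use that in \<open>auto simp: D_gens_def inversions_pi_gen\<close>)
      show "recip (?r (- int n)) < recip (?r (int n - 1))" if "2 \<le> n"
        by (rule nd[of "pi_hat n"]) (use that in \<open>auto simp: D_gens_def inversions_pi_hat\<close>)
    qed
    then have "\<sigma> = id" using signed_perms_inv_comp[OF less.prems(1)] by simp
    then show ?thesis by (intro exI[of _ "[]"]) auto
  qed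
qed

lemma B_group_ops:
  fixes x y :: "int \<Rightarrow> int"
  shows "x \<otimes>\<^bsub>B_group n\<^esub> y = x \<circ> y" "\<one>\<^bsub>B_group n\<^esub> = (id :: int \<Rightarrow> int)"
  by (simp_all add: B_group_def)

lemma B_group_group: "group (B_group n)"
proof (rule groupI, unfold B_group_ops)
  show "\<exists>\<tau>\<in>signed_perms n. \<tau> \<circ> \<sigma> = id" if "\<sigma> \<in> signed_perms n" for \<sigma>
    using signed_perms_inv[OF that] signed_perms_inv_comp(2)[OF that] by blast
qed (simp_all only: signed_perms_comp signed_perms_id o_assoc id_o)

lemma D_group_eq: "D_group n = {\<sigma> \<in> signed_perms n. sign_prod n \<sigma> = 1}"
proof
  interpret group "B_group n" by (rule B_group_group)
  have gen: "\<sigma> \<in> signed_perms n \<and> sign_prod n \<sigma> = 1" if "\<sigma> \<in> generate (B_group n) (D_gens n)" for \<sigma>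
    using that
  proof (induction rule: generate.induct)
    case one
    show ?case using signed_perms_id[of n] by (simp add: B_group_ops sign_prod_def id_def)
  next
    case (incl h)
    then show ?case by (simp add: D_gens_reflection)
  next
    case (inv h)
    have "inv\<^bsub>B_group n\<^esub> h = h"
      using D_gens_reflection(1,4)[OF inv] by (intro inv_equality) (simp_all only: B_group_ops)
    then show ?case using inv by (simp add: D_gens_reflection)
  next
    case (eng h1 h2)
    then have h: "h1 \<in> signed_perms n" "h2 \<in> signed_perms n" "sign_prod n h1 = 1" "sign_prod n h2 = 1" by simp_all
    show ?case
      unfolding B_group_ops using signed_perms_comp[OF h(1,2)] sign_prod_comp[OF h(1,2)]
      unfolding h(3,4) mult_1_left by (rule conjI)
  qed
  show "D_group n \<subseteq> {\<sigma> \<in> signed_perms n. sign_prod n \<sigma> = 1}"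
  proof (cases "2 \<le> n")
    case True
    then show ?thesis using gen by (simp add: D_group_def subset_iff)
  next
    case False
    then have "D_group n = {id}" by (simp add: D_group_def)
    then show ?thesis using signed_perms_id[of n] by (simp add: sign_prod_def)
  qed
  show "{\<sigma> \<in> signed_perms n. sign_prod n \<sigma> = 1} \<subseteq> D_group n"
  proof clarify
    fix \<sigma> assume \<sigma>: "\<sigma> \<in> signed_perms n" "sign_prod n \<sigma> = 1"
    obtain ws where ws: "set ws \<subseteq> D_gens n" "\<sigma> = word_prod ws"
      using reduced_word_exists[OF \<sigma>] by blast
    have "word_prod ws \<in> D_group n"
    proof (cases "2 \<le> n")
      case True
      have "word_prod ws \<in> generate (B_group n) (D_gens n)"
        using ws(1)
      proof (induction ws)
        case Nil
        show ?case using generate.one[of "B_group n" "D_gens n"] by (simp add: B_group_ops id_def)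
      next
        case (Cons s ws)
        have "s \<in> generate (B_group n) (D_gens n)"
          using Cons.prems by (intro generate.incl) simp
        moreover have "word_prod ws \<in> generate (B_group n) (D_gens n)"
          by (rule Cons.IH) (use Cons.prems in simp)
        ultimately have
          "s \<otimes>\<^bsub>B_group n\<^esub> word_prod ws \<in> generate (B_group n) (D_gens n)"
          by (rule generate.eng)
        then show ?case unfolding word_prod_Cons B_group_ops .
      qed
      then show ?thesis using True by (simp add: D_group_def)
    next
      case False
      then have "ws = []" using ws(1) by (simp add: D_gens_def)
      then show ?thesis using False by (simp add: D_group_def)
    qed
    then show "\<sigma> \<in> D_group n" using ws(2) by simp
  qed
qed

lemma D_length_eq:
  assumes "\<sigma> \<in> D_group n"
  shows "D_length n \<sigma> = inv_number n \<sigma>"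
  unfolding D_length_def
proof (rule Least_equality)
  show "\<exists>ws :: (int \<Rightarrow> int) list. length ws = inv_number n \<sigma> \<and> set ws \<subseteq> D_gens n \<and> \<sigma> = word_prod ws"
    using assms by (intro reduced_word_exists) (auto simp: D_group_eq)
next
  fix k assume "\<exists>ws :: (int \<Rightarrow> int) list. length ws = k \<and> set ws \<subseteq> D_gens n \<and> \<sigma> = word_prod ws"
  then obtain ws where ws: "length ws = k" "set ws \<subseteq> D_gens n" "\<sigma> = word_prod ws"
    by blast
  show "inv_number n \<sigma> \<le> k"
    using word_prod_bounds[OF ws(2)] unfolding ws(3) ws(1) by blast
qed

lemma D_group_subset_B: "\<sigma> \<in> D_group n \<Longrightarrow> \<sigma> \<in> signed_perms n"
  by (simp add: D_group_eq)

lemma finite_D_group [simp]: "finite (D_group n)"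
  by (rule finite_subset[OF _ finite_permutations[of "signed_points n"]])
    (auto simp: D_group_eq B_group_def)

lemma D_comp: "\<sigma> \<in> D_group n \<Longrightarrow> \<tau> \<in> D_group n \<Longrightarrow> \<sigma> \<circ> \<tau> \<in> D_group n"
  by (simp add: D_group_eq signed_perms_comp sign_prod_comp)

lemma D_inv:
  assumes "\<sigma> \<in> D_group n"
  shows "inv_into UNIV \<sigma> \<in> D_group n"
proof -
  have s: "\<sigma> \<in> signed_perms n" "sign_prod n \<sigma> = 1" using assms by (auto simp: D_group_eq)
  then show ?thesis
    using sign_prod_comp[OF s(1) signed_perms_inv[OF s(1)]] signed_perms_inv_comp[OF s(1)]
    by (simp add: D_group_eq signed_perms_inv sign_prod_def)
qed

text \<open>
  If \<open>\<sigma>\<close> and \<open>\<tau>\<close> have the same inversions, then \<open>\<sigma> \<tau>\<^sup>-\<^sup>1\<close> has length zero.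
\<close>

lemma inversions_inj_on_D: "inj_on (inversions n) (D_group n)"
proof (rule inj_onI)
  fix \<sigma> \<tau> assume D: "\<sigma> \<in> D_group n" "\<tau> \<in> D_group n" and eq: "inversions n \<sigma> = inversions n \<tau>"
  note S = D_group_subset_B[OF D(1)] and T = D_group_subset_B[OF D(2)]
  let ?r = "inv_into UNIV \<tau>"
  have "inv_number n (\<sigma> \<circ> ?r) = 0"
    using eq by (simp add: inv_number_eq_sym_diff[OF S T] del: card_eq_0_iff)
  moreover have "\<sigma> \<circ> ?r \<in> D_group n" using D by (simp add: D_comp D_inv)
  ultimately have "\<sigma> \<circ> ?r = id"
    using reduced_word_exists[of "\<sigma> \<circ> ?r" n] by (auto simp: D_group_eq)
  then have "(\<sigma> \<circ> ?r) \<circ> \<tau> = \<tau>" by simp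
  then show "\<sigma> = \<tau>" using signed_perms_inv_comp(2)[OF T] by (simp add: o_assoc[symmetric])
qed

section \<open>A positive definite kernel on a power set\<close>

lemma sum_Pow_insert:
  fixes F :: "'b set \<Rightarrow> real"
  assumes "finite R" "r \<notin> R"
  shows "(\<Sum>A\<in>Pow (insert r R). F A) = (\<Sum>A\<in>Pow R. F A + F (insert r A))"
proof -
  have "(\<Sum>A\<in>Pow (insert r R). F A) = (\<Sum>A\<in>Pow R. F A) + (\<Sum>A\<in>insert r ` Pow R. F A)"
    unfolding Pow_insert by (rule sum.union_disjoint) (use assms in auto)
  also have "(\<Sum>A\<in>insert r ` Pow R. F A) = (\<Sum>A\<in>Pow R. F (insert r A))"
    by (rule sum.reindex_cong[of "insert r" "Pow R"])
      (use assms(2) in \<open>auto simp: inj_on_def dest!: insert_ident[THEN iffD1, rotated 2]\<close>)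
  finally show ?thesis by (simp add: sum.distrib)
qed

definition sym_diff_form :: "real \<Rightarrow> 'b set \<Rightarrow> ('b set \<Rightarrow> real) \<Rightarrow> ('b set \<Rightarrow> real) \<Rightarrow> real" where
  "sym_diff_form q R u v = (\<Sum>A\<in>Pow R. \<Sum>B\<in>Pow R. u A * v B * q ^ card (sym_diff A B))"

lemma sym_diff_form_add:
  "sym_diff_form q R (\<lambda>A. u A + s * v A) (\<lambda>A. u A + s * v A) =
    sym_diff_form q R u u + s * sym_diff_form q R u v + s * sym_diff_form q R v u
      + s * s * sym_diff_form q R v v"
  by (simp add: sym_diff_form_def sum.distrib sum_distrib_left algebra_simps)

lemma sym_diff_form_insert:
  assumes "finite R" "r \<notin> R"
  shows "sym_diff_form q (insert r R) u u =
    sym_diff_form q R u u + sym_diff_form q R (\<lambda>A. u (insert r A)) (\<lambda>A. u (insert r A))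
    + q * sym_diff_form q R u (\<lambda>A. u (insert r A)) + q * sym_diff_form q R (\<lambda>A. u (insert r A)) u"
proof -
  have 1: "card (sym_diff (insert r A) C) = Suc (card (sym_diff A C))"
    "card (sym_diff A (insert r C)) = Suc (card (sym_diff A C))"
    "sym_diff (insert r A) (insert r C) = sym_diff A C" if "A \<in> Pow R" "C \<in> Pow R" for A C
  proof -
    have "sym_diff (insert r A) C = insert r (sym_diff A C)"
      "sym_diff A (insert r C) = insert r (sym_diff A C)"
      and n: "r \<notin> sym_diff A C"
      using that assms(2) by auto
    moreover have "finite (sym_diff A C)"
      using that by (auto intro: finite_subset[OF _ assms(1)])
    ultimately show "card (sym_diff (insert r A) C) = Suc (card (sym_diff A C))"
      "card (sym_diff A (insert r C)) = Suc (card (sym_diff A C))" by simp_all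
    show "sym_diff (insert r A) (insert r C) = sym_diff A C"
      using that assms(2) by auto
  qed
  have "sym_diff_form q (insert r R) u u = (\<Sum>A\<in>Pow R. \<Sum>B\<in>Pow R.
      u A * u B * q ^ card (sym_diff A B) + u (insert r A) * u (insert r B) * q ^ card (sym_diff A B)
      + q * (u A * u (insert r B) * q ^ card (sym_diff A B))
      + q * (u (insert r A) * u B * q ^ card (sym_diff A B)))"
    unfolding sym_diff_form_def sum_Pow_insert[OF assms] sum.distrib[symmetric]
    by (intro sum.cong refl) (simp only: 1 power_Suc mult_ac)
  also have "\<dots> = sym_diff_form q R u u
    + sym_diff_form q R (\<lambda>A. u (insert r A)) (\<lambda>A. u (insert r A))
    + q * sym_diff_form q R u (\<lambda>A. u (insert r A)) + q * sym_diff_form q R (\<lambda>A. u (insert r A)) u"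
    by (simp only: sym_diff_form_def sum.distrib sum_distrib_left)
  finally show ?thesis .
qed

text \<open>
  Adding one point \<open>r\<close> to the ground set splits \<open>u\<close> into the parts \<open>u\<close> and \<open>v\<close> on sets without and with
  \<open>r\<close>. With \<open>s\<close> the sign of \<open>q\<close>, the form becomes \<open>(1 - \<bar>q\<bar>) (Q u + Q v) + \<bar>q\<bar> Q (u + s v)\<close>, a sum of
  nonnegative terms of which the first vanishes only for \<open>u = v = 0\<close>.
\<close>

lemma sym_diff_form_pos:
  assumes "finite R" "\<bar>q\<bar> < 1"
  shows "0 \<le> sym_diff_form q R u u \<and> (sym_diff_form q R u u = 0 \<longrightarrow> (\<forall>A\<subseteq>R. u A = 0))"
  using assms(1)
proof (induction R arbitrary: u)
  case empty
  then show ?case by (simp add: sym_diff_form_def)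
next
  case (insert r R)
  define v where "v = (\<lambda>A. u (insert r A))"
  define s where "s = sgn q"
  have s: "\<bar>q\<bar> * s = q" "q * s = \<bar>q\<bar>"
    by (auto simp: s_def sgn_if)
  let ?Q = "sym_diff_form q R"
  have "\<bar>q\<bar> * ?Q (\<lambda>A. u A + s * v A) (\<lambda>A. u A + s * v A) =
      \<bar>q\<bar> * ?Q u u + (\<bar>q\<bar> * s) * ?Q u v + (\<bar>q\<bar> * s) * ?Q v u + (\<bar>q\<bar> * s * s) * ?Q v v"
    unfolding sym_diff_form_add by (simp add: algebra_simps)
  then have eq: "sym_diff_form q (insert r R) u u =
      (1 - \<bar>q\<bar>) * ?Q u u + (1 - \<bar>q\<bar>) * ?Q v v + \<bar>q\<bar> * ?Q (\<lambda>A. u A + s * v A) (\<lambda>A. u A + s * v A)"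
    unfolding sym_diff_form_insert[OF insert.hyps] s v_def[symmetric] by (simp add: algebra_simps)
  have nonneg: "0 \<le> (1 - \<bar>q\<bar>) * ?Q u u" "0 \<le> (1 - \<bar>q\<bar>) * ?Q v v"
    "0 \<le> \<bar>q\<bar> * ?Q (\<lambda>A. u A + s * v A) (\<lambda>A. u A + s * v A)"
    using insert.IH assms(2) by (simp_all add: mult_nonneg_nonneg)
  show ?case
  proof (intro conjI impI allI)
    show "0 \<le> sym_diff_form q (insert r R) u u" using eq nonneg by simp
    fix A assume 0: "sym_diff_form q (insert r R) u u = 0" and A: "A \<subseteq> insert r R"
    have "(1 - \<bar>q\<bar>) * ?Q u u = 0" "(1 - \<bar>q\<bar>) * ?Q v v = 0"
      using eq nonneg 0 by linarith+
    then have "?Q u u = 0" "?Q v v = 0" using assms(2) by simp_all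
    then have uv: "u C = 0" "v C = 0" if "C \<subseteq> R" for C using insert.IH that by blast+
    show "u A = 0"
    proof (cases "r \<in> A")
      case True
      then have "A = insert r (A - {r})" "A - {r} \<subseteq> R" using A by auto
      then show ?thesis using uv(2)[of "A - {r}"] by (simp add: v_def)
    qed (use A uv(1)[of A] in auto)
  qed
qed

text \<open>
  Extending \<open>v\<close> by zero to all subsets of \<open>R\<close> turns the linear system into the vanishing of the
  quadratic form.
\<close>

lemma sym_diff_kernel_real:
  fixes v :: "'c \<Rightarrow> real"
  assumes "finite R" "\<bar>q\<bar> < 1" "N ` D \<subseteq> Pow R" "inj_on N D"
    and 0: "\<And>\<tau>. \<tau> \<in> D \<Longrightarrow> (\<Sum>\<sigma>\<in>D. q ^ card (sym_diff (N \<tau>) (N \<sigma>)) * v \<sigma>) = 0"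
    and "\<tau> \<in> D"
  shows "v \<tau> = 0"
proof -
  define u where "u A = (if A \<in> N ` D then v (inv_into D N A) else 0)" for A
  have u: "u (N \<sigma>) = v \<sigma>" if "\<sigma> \<in> D" for \<sigma>
    using that assms(4) by (simp add: u_def)
  have restrict: "(\<Sum>A\<in>Pow R. u A * F A) = (\<Sum>\<sigma>\<in>D. v \<sigma> * F (N \<sigma>))" for F
  proof -
    have "(\<Sum>A\<in>Pow R. u A * F A) = (\<Sum>A\<in>N ` D. u A * F A)"
      using assms(1,3) by (intro sum.mono_neutral_right) (auto simp: u_def)
    also have "\<dots> = (\<Sum>\<sigma>\<in>D. v \<sigma> * F (N \<sigma>))"
      using assms(4) by (simp add: sum.reindex u)
    finally show ?thesis .
  qed
  have "sym_diff_form q R u u =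
      (\<Sum>A\<in>Pow R. u A * (\<Sum>B\<in>Pow R. u B * q ^ card (sym_diff A B)))"
    by (simp add: sym_diff_form_def sum_distrib_left mult.assoc)
  also have "\<dots> = (\<Sum>\<tau>\<in>D. v \<tau> * (\<Sum>\<sigma>\<in>D. v \<sigma> * q ^ card (sym_diff (N \<tau>) (N \<sigma>))))"
    unfolding restrict ..
  also have "\<dots> = 0"
    using 0 by (intro sum.neutral) (simp add: mult.commute)
  finally have "u (N \<tau>) = 0"
    using sym_diff_form_pos[OF assms(1,2), of u] assms(3,6) by blast
  then show ?thesis using u assms(6) by simp
qed

lemma sym_diff_kernel:
  fixes v :: "'c \<Rightarrow> complex"
  assumes "finite R" "\<bar>q\<bar> < 1" "N ` D \<subseteq> Pow R" "inj_on N D"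
    and 0: "\<And>\<tau>. \<tau> \<in> D \<Longrightarrow> (\<Sum>\<sigma>\<in>D. complex_of_real (q ^ card (sym_diff (N \<tau>) (N \<sigma>))) * v \<sigma>) = 0"
    and "\<tau> \<in> D"
  shows "v \<tau> = 0"
proof (rule complex_eqI)
  show "Re (v \<tau>) = Re 0" unfolding zero_complex.sel
  proof (rule sym_diff_kernel_real[OF assms(1-4) _ assms(6)])
    show "(\<Sum>\<sigma>\<in>D. q ^ card (sym_diff (N \<tau>) (N \<sigma>)) * Re (v \<sigma>)) = 0" if "\<tau> \<in> D" for \<tau>
      using arg_cong[OF 0[OF that], of Re] by (simp add: Re_sum)
  qed
  show "Im (v \<tau>) = Im 0" unfolding zero_complex.sel
  proof (rule sym_diff_kernel_real[OF assms(1-4) _ assms(6)])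
    show "(\<Sum>\<sigma>\<in>D. q ^ card (sym_diff (N \<tau>) (N \<sigma>)) * Im (v \<sigma>)) = 0" if "\<tau> \<in> D" for \<tau>
      using arg_cong[OF 0[OF that], of Im] by (simp add: Im_sum)
  qed
qed

section \<open>Elements of the group as signed words\<close>

definition signed_words :: "nat \<Rightarrow> int list set" where
  "signed_words n = {w. length w = n \<and> distinct (map abs w) \<and> abs ` set w = {1..int n}}"

definition even_words :: "nat \<Rightarrow> int list set" where
  "even_words n = {w \<in> signed_words n. prod_list (map sgn w) = 1}"

definition arrange :: "('a \<Rightarrow> 'a) \<Rightarrow> 'a list \<Rightarrow> int list \<Rightarrow> 'a list" where
  "arrange bar ys w = map (signed_nth bar ys) w"

definition window :: "nat \<Rightarrow> (int \<Rightarrow> int) \<Rightarrow> int list" where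
  "window n \<sigma> = map \<sigma> [1..int n]"

text \<open>
  The signed permutation whose window \<open>\<sigma> 1, \<dots>, \<sigma> n\<close> is the given word, extended oddly to negative
  arguments and by the identity beyond them.
\<close>

definition of_window :: "int list \<Rightarrow> int \<Rightarrow> int" where
  "of_window w k = (if k \<in> signed_points (length w) then signed_nth uminus w k else k)"

lemma length_arrange [simp]: "length (arrange bar ys w) = length w"
  by (simp add: arrange_def)

lemma signed_permute_inv:
  assumes "\<sigma> \<in> signed_perms n" "length ys = n"
  shows "signed_permute bar (inv_into UNIV \<sigma>) ys = arrange bar ys (window n \<sigma>)"
  using assms(2) B_groupD(4)[OF assms(1)]
  by (simp add: signed_permute_def arrange_def window_def)

lemma window_in_signed_words:
  assumes "\<sigma> \<in> signed_perms n"
  shows "window n \<sigma> \<in> signed_words n"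
proof -
  have rng: "\<bar>\<rho> i\<bar> \<in> {1..int n}" if "\<rho> \<in> signed_perms n" "i \<in> {1..int n}" for \<rho> i
    using signed_perms_signed_points[OF that(1), of i] that(2) by (auto simp: signed_points_def)
  have "inj_on (\<lambda>i. \<bar>\<sigma> i\<bar>) {1..int n}"
    by (auto simp: inj_on_def signed_perms_abs_eq[OF assms])
  moreover have "(\<lambda>i. \<bar>\<sigma> i\<bar>) ` {1..int n} = {1..int n}"
    by (rule endo_inj_surj) (use calculation rng[OF assms] in auto)
  moreover have "distinct (map abs (window n \<sigma>))"
    using calculation(1) unfolding window_def map_map distinct_map by (simp add: o_def)
  ultimately show ?thesis
    by (simp add: signed_words_def window_def image_image)
qed

lemma abs_nth_signed_words:
  assumes "w \<in> signed_words n" "i < n"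
  shows "\<bar>w ! i\<bar> \<in> {1..int n}"
  using assms unfolding signed_words_def by (metis (mono_tags, lifting) image_eqI mem_Collect_eq nth_mem)

lemma of_window_in_B:
  assumes "w \<in> signed_words n"
  shows "of_window w \<in> signed_perms n"
proof -
  let ?f = "of_window w"
  have len: "length w = n" using assms by (simp add: signed_words_def)
  have f: "?f k = (if k > 0 then w ! (nat \<bar>k\<bar> - 1) else - w ! (nat \<bar>k\<bar> - 1))"
    and lt: "nat \<bar>k\<bar> - 1 < n" if "k \<in> signed_points n" for k
    using that by (auto simp: of_window_def len signed_nth_def signed_points_def abs_if)
  have maps: "?f k \<in> signed_points n" if "k \<in> signed_points n" for k
    using abs_nth_signed_words[OF assms lt[OF that]] by (auto simp: f[OF that] signed_points_def)
  have inj: "inj_on ?f (signed_points n)"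
  proof (rule inj_onI)
    fix j k assume j: "j \<in> signed_points n" and k: "k \<in> signed_points n" and eq: "?f j = ?f k"
    have "\<bar>w ! (nat \<bar>j\<bar> - 1)\<bar> = \<bar>w ! (nat \<bar>k\<bar> - 1)\<bar>"
      using arg_cong[OF eq, of abs] by (simp add: f[OF j] f[OF k] split: if_splits)
    moreover have "distinct (map abs w)" using assms by (simp add: signed_words_def)
    ultimately have i: "nat \<bar>j\<bar> - 1 = nat \<bar>k\<bar> - 1"
      using lt[OF j] lt[OF k] len by (metis length_map nth_eq_iff_index_eq nth_map)
    then have "\<bar>j\<bar> = \<bar>k\<bar>" using j k by (auto simp: signed_points_def)
    moreover have "w ! (nat \<bar>k\<bar> - 1) \<noteq> 0" using abs_nth_signed_words[OF assms lt[OF k]] by auto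
    ultimately show "j = k"
      using eq i j k by (auto simp: f[OF j] f[OF k] signed_points_def abs_if split: if_splits)
  qed
  have "bij_betw ?f (signed_points n) (signed_points n)"
    unfolding bij_betw_def
    by (intro conjI inj endo_inj_surj) (use maps in auto)
  then have "?f permutes signed_points n"
    by (rule bij_imp_permutes) (simp add: of_window_def len)
  moreover have "?f (- k) = - ?f k" for k
  proof (cases "k \<in> signed_points n")
    case True
    then have "- k \<in> signed_points n" by (auto simp: signed_points_def)
    with True show ?thesis by (auto simp: f signed_points_def)
  next
    case False
    then have "- k \<notin> signed_points n" by (auto simp: signed_points_def)
    with False show ?thesis by (simp add: of_window_def len)
  qed
  ultimately show ?thesis by (simp add: B_group_def)
qed

lemma window_of_window:
  assumes "length w = n"
  shows "window n (of_window w) = w"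
  by (rule nth_equalityI)
    (use assms in \<open>auto simp: window_def of_window_def signed_nth_def signed_points_def nth_upto nat_add_distrib\<close>)

lemma window_eq_imp_eq:
  assumes "\<sigma> \<in> signed_perms n" "\<tau> \<in> signed_perms n" "window n \<sigma> = window n \<tau>"
  shows "\<sigma> = \<tau>"
proof
  fix k
  have pos: "\<sigma> k = \<tau> k" if "k \<in> {1..int n}" for k
    using assms(3) that by (auto simp: window_def map_eq_conv)
  show "\<sigma> k = \<tau> k"
  proof (cases "k \<in> signed_points n")
    case True
    then have "k \<in> {1..int n} \<or> - k \<in> {1..int n}" by (auto simp: signed_points_def)
    then show ?thesis
      using pos[of k] pos[of "- k"] B_groupD(2)[OF assms(1), of k] B_groupD(2)[OF assms(2), of k] by auto
  next
    case False
    then show ?thesis using B_groupD(1)[OF assms(1)] B_groupD(1)[OF assms(2)] by (simp add: permutes_def)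
  qed
qed

lemma sign_prod_window: "prod_list (map sgn (window n \<sigma>)) = sign_prod n \<sigma>"
proof -
  have "prod_list (map sgn (window n \<sigma>)) = prod_list (map (\<lambda>i. sgn (\<sigma> i)) [1..int n])"
    by (simp add: window_def o_def)
  also have "\<dots> = (\<Prod>i\<in>set [1..int n]. sgn (\<sigma> i))"
    by (rule prod.distinct_set_conv_list[symmetric]) simp
  finally show ?thesis by (simp add: sign_prod_def)
qed

lemma bij_betw_window: "bij_betw (window n) (D_group n) (even_words n)"
proof (rule bij_betw_imageI)
  show "inj_on (window n) (D_group n)"
    by (auto intro!: inj_onI window_eq_imp_eq D_group_subset_B)
  show "window n ` D_group n = even_words n"
  proof (intro equalityI subsetI)
    fix w assume "w \<in> even_words n"
    then have w: "w \<in> signed_words n" "prod_list (map sgn w) = 1" "length w = n"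
      by (auto simp: even_words_def signed_words_def)
    have "of_window w \<in> D_group n"
      using sign_prod_window[of n "of_window w"] w
      by (simp add: D_group_eq of_window_in_B window_of_window)
    then show "w \<in> window n ` D_group n"
      using window_of_window[OF w(3)] by (metis image_eqI)
  qed (auto simp: even_words_def D_group_eq window_in_signed_words sign_prod_window)
qed

text \<open>
  The two roots \<open>e\<^sub>i - e\<^sub>j\<close> and \<open>e\<^sub>i + e\<^sub>j\<close> for a fixed pair of positions, carrying the letters \<open>a\<close> and \<open>b\<close>.
\<close>

definition pair_inv :: "int \<Rightarrow> int \<Rightarrow> nat" where
  "pair_inv a b = of_bool (recip a < recip b) + of_bool (recip a < - recip b)"

fun word_inv :: "int list \<Rightarrow> nat" where
  "word_inv [] = 0"
| "word_inv (a # w) = sum_list (map (pair_inv a) w) + word_inv w"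

lemma word_inv_append:
  "word_inv (u @ v) = word_inv u + word_inv v + (\<Sum>a\<leftarrow>u. \<Sum>b\<leftarrow>v. pair_inv a b)"
  by (induction u) simp_all

lemma word_inv_upto:
  "word_inv (map \<sigma> [m..int n]) =
    (\<Sum>i\<in>{m..int n}. \<Sum>j\<in>{i + 1..int n}. pair_inv (\<sigma> i) (\<sigma> j))"
proof (induction "nat (int n + 1 - m)" arbitrary: m)
  case 0
  then show ?case by simp
next
  case (Suc k)
  then have le: "m \<le> int n" and ih: "k = nat (int n + 1 - (m + 1))" by auto
  have *: "{m..int n} = insert m {m + 1..int n}" using le by auto
  have "sum_list (map (\<lambda>j. pair_inv (\<sigma> m) (\<sigma> j)) [m + 1..int n]) =
      (\<Sum>j\<in>{m + 1..int n}. pair_inv (\<sigma> m) (\<sigma> j))"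
    by (simp add: sum_list_distinct_conv_sum_set)
  then show ?case
    unfolding upto_rec1[OF le] * using Suc.hyps(1)[OF ih] by (simp add: o_def)
qed

lemma inv_number_eq_word_inv:
  assumes "\<sigma> \<in> signed_perms n"
  shows "inv_number n \<sigma> = word_inv (window n \<sigma>)"
proof -
  have "inversions n \<sigma> = (SIGMA i:{1..int n}. {j \<in> {i + 1..int n}. recip (\<sigma> i) < recip (\<sigma> j)} \<union>
      uminus ` {j \<in> {i + 1..int n}. recip (\<sigma> i) < - recip (\<sigma> j)})" (is "_ = Sigma _ (\<lambda>i. ?P i \<union> ?N i)")
  proof (intro equalityI subsetI)
    fix p assume "p \<in> inversions n \<sigma>"
    then obtain i j where p: "p = (i, j)" "0 < i" "i < \<bar>j\<bar>" "\<bar>j\<bar> \<le> int n" "recip (\<sigma> i) < recip (\<sigma> j)"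
      by (auto simp: inversions_def pos_roots_def)
    show "p \<in> Sigma {1..int n} (\<lambda>i. ?P i \<union> ?N i)"
    proof (cases "0 < j")
      case False
      then have "- j \<in> {j \<in> {i + 1..int n}. recip (\<sigma> i) < - recip (\<sigma> j)}"
        using p by (auto simp: B_groupD(2)[OF assms])
      then have "j \<in> ?N i" by (intro image_eqI[of _ _ "- j"]) auto
      then show ?thesis using p by auto
    qed (use p in auto)
  qed (auto simp: inversions_def pos_roots_def B_groupD(2)[OF assms])
  moreover have fin: "finite (?P i)" "finite (?N i)" for i
    by (auto intro!: finite_imageI intro: finite_subset[of _ "{i + 1..int n}"])
  ultimately have "inv_number n \<sigma> = card (Sigma {1..int n} (\<lambda>i. ?P i \<union> ?N i))"
    by (simp only:)
  also have "\<dots> = (\<Sum>i\<in>{1..int n}. card (?P i \<union> ?N i))"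
    using fin by (intro card_SigmaI) simp_all
  also have "\<dots> = (\<Sum>i\<in>{1..int n}. card (?P i) + card (?N i))"
    by (intro sum.cong refl card_Un_disjoint fin) auto
  also have "\<dots> = (\<Sum>i\<in>{1..int n}. \<Sum>j\<in>{i + 1..int n}. pair_inv (\<sigma> i) (\<sigma> j))"
  proof (intro sum.cong refl)
    fix i
    have count: "card {j \<in> {i + 1..int n}. Q j} = (\<Sum>j\<in>{i + 1..int n}. of_bool (Q j))" for Q
    proof -
      have "{j \<in> {i + 1..int n}. Q j} = {i + 1..int n} \<inter> {j. Q j}" by auto
      then show ?thesis by (simp add: sum_of_bool_eq)
    qed
    have "card (?N i) = card {j \<in> {i + 1..int n}. recip (\<sigma> i) < - recip (\<sigma> j)}"
      by (intro card_image) simp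
    then show "card (?P i) + card (?N i) = (\<Sum>j\<in>{i + 1..int n}. pair_inv (\<sigma> i) (\<sigma> j))"
      unfolding pair_inv_def sum.distrib count by simp
  qed
  finally show ?thesis by (simp add: window_def word_inv_upto)
qed

definition insert_at :: "nat \<Rightarrow> 'b \<Rightarrow> 'b list \<Rightarrow> 'b list" where
  "insert_at i x w = take i w @ x # drop i w"

definition map_last :: "('b \<Rightarrow> 'b) \<Rightarrow> 'b list \<Rightarrow> 'b list" where
  "map_last g w = (if w = [] then [] else butlast w @ [g (last w)])"

text \<open>
  Moves the letters away from zero, so that \<open>1\<close> and \<open>- 1\<close> become free for the inserted letter. This
  matches the index shift in \<open>x # zs\<close>.
\<close>

definition shift :: "int \<Rightarrow> int" where "shift k = k + sgn k"

lemma length_insert_at [simp]: "length (insert_at i x w) = Suc (length w)"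
  by (simp add: insert_at_def min_def)

lemma set_insert_at [simp]: "set (insert_at i x w) = insert x (set w)"
  by (simp add: insert_at_def) (metis Un_insert_right append_take_drop_id set_append)

lemma map_insert_at: "map g (insert_at i x w) = insert_at i (g x) (map g w)"
  by (simp add: insert_at_def take_map drop_map)

lemma prod_list_insert_at: "prod_list (insert_at i x w) = x * prod_list (w :: 'b::comm_monoid_mult list)"
proof -
  have "prod_list (insert_at i x w) = x * (prod_list (take i w) * prod_list (drop i w))"
    by (simp add: insert_at_def mult_ac)
  then show ?thesis by (simp flip: prod_list.append)
qed

lemma distinct_insert_at: "distinct (insert_at i x w) \<longleftrightarrow> x \<notin> set w \<and> distinct w"
proof -
  have "mset (insert_at i x w) = mset (x # w)"
    by (simp add: insert_at_def) (metis append_take_drop_id mset_append)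
  then have "distinct (insert_at i x w) \<longleftrightarrow> distinct (x # w)"
    by (rule mset_eq_imp_distinct_iff)
  then show ?thesis by simp
qed

lemma insert_at_inject:
  assumes "x \<notin> set u" "x \<notin> set v" "i \<le> length u" "j \<le> length v"
  shows "insert_at i x u = insert_at j x v \<longleftrightarrow> u = v \<and> i = j"
proof
  assume "insert_at i x u = insert_at j x v"
  then have "take i u = take j v \<and> drop i u = drop j v"
    unfolding insert_at_def using assms by (subst (asm) append_Cons_eq_iff) (auto dest: in_set_takeD in_set_dropD)
  then show "u = v \<and> i = j"
    using assms(3,4) by (metis append_take_drop_id length_take min.absorb2)
qed auto

lemma length_map_last [simp]: "length (map_last g w) = length w"
  by (simp add: map_last_def)

lemma map_last_Nil [simp]: "map_last g [] = []"
  by (simp add: map_last_def)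

lemma map_last_snoc [simp]: "map_last g (w @ [a]) = w @ [g a]"
  by (simp add: map_last_def)

lemma map_map_last:
  assumes "\<And>a. a \<in> set w \<Longrightarrow> h (g a) = k (h a)"
  shows "map h (map_last g w) = map_last k (map h w)"
  using assms by (cases w rule: rev_cases) auto

lemma shift_simps: "k \<noteq> 0 \<Longrightarrow> 2 \<le> \<bar>shift k\<bar>" "shift (- k) = - shift k" "sgn (shift k) = sgn k"
  "\<bar>shift k\<bar> = \<bar>k\<bar> + \<bar>sgn k\<bar>"
  by (auto simp: shift_def sgn_if)

lemma recip_shift_less:
  assumes "a \<noteq> 0" "b \<noteq> 0"
  shows "recip (shift a) < recip (shift b) \<longleftrightarrow> recip a < recip b"
proof -
  have neg: "recip x < recip y \<longleftrightarrow> recip (- y) < recip (- x)" for x y by simp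
  have mixed: "recip x < recip y" if "x < 0" "0 < y" for x y
    using that recip_neg_iff[of x] recip_pos_iff[of y] by linarith
  consider "0 < a" "0 < b" | "a < 0" "b < 0" | "a < 0" "0 < b" | "0 < a" "b < 0"
    using assms by linarith
  then show ?thesis
  proof cases
    case 1
    then show ?thesis by (auto simp: shift_def recip_less_iff_pos)
  next
    case 2
    then show ?thesis
      unfolding neg[of a b] neg[of "shift a" "shift b"]
      by (auto simp: shift_def recip_less_iff_pos simp del: recip_minus)
  next
    case 3
    then show ?thesis by (simp add: shift_def mixed)
  next
    case 4
    then show ?thesis using mixed[of b a] mixed[of "shift b" "shift a"] by (simp add: shift_def)
  qed
qed

lemma pair_inv_shift: "a \<noteq> 0 \<Longrightarrow> b \<noteq> 0 \<Longrightarrow> pair_inv (shift a) (shift b) = pair_inv a b"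
  using recip_shift_less[of a b] recip_shift_less[of a "- b"] by (simp add: pair_inv_def shift_simps)

lemma pair_inv_uminus [simp]: "pair_inv a (- b) = pair_inv a b"
  by (simp add: pair_inv_def)

lemma pair_inv_one:
  assumes "2 \<le> \<bar>a\<bar>"
  shows "pair_inv a 1 = 1" "pair_inv 1 a = 0" "pair_inv (- 1) a = 2"
proof -
  have "recip a < recip 1" "recip (- a) < recip 1" using assms by (auto intro!: recip_less_abs simp del: recip_minus)
  then show "pair_inv a 1 = 1" "pair_inv 1 a = 0" "pair_inv (- 1) a = 2"
    by (auto simp: pair_inv_def simp flip: recip_minus) (auto simp: pair_inv_def)
qed

lemma word_inv_map_shift: "0 \<notin> set w \<Longrightarrow> word_inv (map shift w) = word_inv w"
proof (induction w)
  case (Cons a w)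
  then have "map (pair_inv (shift a)) (map shift w) = map (pair_inv a) w"
    by (auto intro!: pair_inv_shift)
  moreover have "word_inv (map shift w) = word_inv w" using Cons by simp
  ultimately show "word_inv (map shift (a # w)) = word_inv (a # w)"
    by (simp only: word_inv.simps list.map)
qed simp

text \<open>
  Flipping the last letter exchanges the two roots counted for each pair that contains it.
\<close>

lemma word_inv_map_last: "word_inv (map_last uminus w) = word_inv w"
  by (cases w rule: rev_cases) (simp_all add: word_inv_append)

lemma sum_list_constant_on:
  assumes "\<And>a. a \<in> set u \<Longrightarrow> g a = (c::nat)"
  shows "(\<Sum>a\<leftarrow>u. g a) = length u * c"
  using assms by (induction u) auto

text \<open>
  In the order of signed points, \<open>1\<close> comes before and \<open>- 1\<close> after all other letters. A letter in front
  of the inserted one contributes one inverted root in either case; a letter behind it contributes none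
  for \<open>1\<close> and two for \<open>- 1\<close>.
\<close>

lemma word_inv_insert_at:
  assumes "\<And>a. a \<in> set w \<Longrightarrow> 2 \<le> \<bar>a\<bar>" "i \<le> length w"
  shows "word_inv (insert_at i 1 w) = word_inv w + i"
    and "word_inv (insert_at i (- 1) w) = word_inv w + (2 * length w - i)"
proof -
  have w: "word_inv w = word_inv (take i w) + word_inv (drop i w) +
      (\<Sum>a\<leftarrow>take i w. \<Sum>b\<leftarrow>drop i w. pair_inv a b)"
    using word_inv_append[of "take i w" "drop i w"] by simp
  have ins: "word_inv (insert_at i s w) = word_inv w + sum_list (map (pair_inv s) (drop i w)) +
      (\<Sum>a\<leftarrow>take i w. pair_inv a s)" for s
    unfolding w by (simp add: insert_at_def word_inv_append sum_list_addf)
  have in_w: "2 \<le> \<bar>a\<bar>" if "a \<in> set (take i w) \<or> a \<in> set (drop i w)" for a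
    using that assms(1) by (auto dest: in_set_takeD in_set_dropD)
  have "sum_list (map (pair_inv 1) (drop i w)) = length (drop i w) * 0"
    by (rule sum_list_constant_on) (simp add: in_w pair_inv_one)
  moreover have "sum_list (map (pair_inv (- 1)) (drop i w)) = length (drop i w) * 2"
    by (rule sum_list_constant_on) (simp add: in_w pair_inv_one)
  moreover have "(\<Sum>a\<leftarrow>take i w. pair_inv a 1) = length (take i w) * 1"
    by (rule sum_list_constant_on) (simp add: in_w pair_inv_one)
  ultimately show "word_inv (insert_at i 1 w) = word_inv w + i"
    "word_inv (insert_at i (- 1) w) = word_inv w + (2 * length w - i)"
    using assms(2) by (simp_all add: ins)
qed

lemma signed_words_nz: "w \<in> signed_words n \<Longrightarrow> a \<in> set w \<Longrightarrow> a \<noteq> 0"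
  by (force simp: signed_words_def)

lemma finite_signed_words [simp]: "finite (signed_words n)"
proof (rule finite_subset)
  show "signed_words n \<subseteq> {w. set w \<subseteq> {- int n..int n} \<and> length w = n}"
    by (auto simp: signed_words_def) (smt (verit) atLeastAtMost_iff image_eqI)+
qed (simp add: finite_lists_length_eq)

lemma insert_at_in_signed_words:
  assumes "w \<in> signed_words n" "\<bar>s\<bar> = 1"
  shows "insert_at i s (map shift w) \<in> signed_words (Suc n)"
proof -
  have w: "length w = n" "distinct (map abs w)" "abs ` set w = {1..int n}" "\<And>a. a \<in> set w \<Longrightarrow> a \<noteq> 0"
    using assms(1) signed_words_nz by (auto simp: signed_words_def)
  have sh: "\<bar>shift a\<bar> = \<bar>a\<bar> + 1" if "a \<in> set w" for a
    using w(4)[OF that] by (simp add: shift_simps sgn_if)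
  then have eq: "map abs (map shift w) = map (\<lambda>k. k + 1) (map abs w)"
    by simp
  have "distinct (map (\<lambda>k. k + 1) (map abs w))"
    using w(2) by (subst distinct_map) (auto simp: inj_on_def)
  moreover have img: "(\<lambda>k. k + 1) ` abs ` set w = {2..int n + 1}"
    unfolding w(3) by (simp add: image_add_atLeastAtMost')
  have "abs ` set (map shift w) = {2..int n + 1}"
    using arg_cong[OF eq, of set] unfolding set_map img .
  ultimately have shifted: "abs ` set (map shift w) = {2..int n + 1}" "distinct (map abs (map shift w))"
    unfolding eq by blast+
  have "\<bar>s\<bar> \<notin> set (map abs (map shift w))"
    unfolding set_map[of abs] shifted(1) assms(2) by simp
  with shifted(2) have "distinct (map abs (insert_at i s (map shift w)))"
    unfolding map_insert_at distinct_insert_at by blast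
  moreover have "abs ` set (insert_at i s (map shift w)) = {1..int (Suc n)}"
    unfolding set_insert_at image_insert shifted(1) assms(2) by auto
  ultimately show ?thesis
    using w(1) unfolding signed_words_def by simp
qed

lemma map_last_in_signed_words:
  assumes "w \<in> signed_words n"
  shows "map_last uminus w \<in> signed_words n"
proof -
  have "map abs (map_last uminus w) = map_last id (map abs w)"
    by (rule map_map_last) simp
  also have "map_last id (map abs w) = map abs w"
    by (cases w rule: rev_cases) auto
  finally have eq: "map abs (map_last uminus w) = map abs w" .
  have "abs ` set (map_last uminus w) = abs ` set w"
    using arg_cong[OF eq, of set] unfolding set_map .
  with eq show ?thesis using assms by (simp add: signed_words_def)
qed

lemma prod_sgn_map_last:
  "w \<noteq> [] \<Longrightarrow> prod_list (map sgn (map_last uminus w)) = - prod_list (map sgn (w :: int list))"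
  by (cases w rule: rev_cases) (auto simp: sgn_minus)

lemma signed_words_SucE:
  assumes "w' \<in> signed_words (Suc n)"
  obtains w i s where "w \<in> signed_words n" "i \<le> n" "\<bar>s\<bar> = 1" "w' = insert_at i s (map shift w)"
proof -
  have w': "length w' = Suc n" "distinct (map abs w')" "abs ` set w' = {1..int n + 1}"
    using assms by (auto simp: signed_words_def)
  have "1 \<in> abs ` set w'" unfolding w'(3) by simp
  then obtain s where s: "s \<in> set w'" "\<bar>s\<bar> = 1" by auto
  obtain u v where uv: "w' = u @ s # v" using split_list[OF s(1)] by blast
  \<comment> \<open>inverse of \<open>shift\<close> on the letters other than \<open>1\<close> and \<open>- 1\<close>\<close>
  define r :: "int \<Rightarrow> int" where "r k = k - sgn k" for k
  define w where "w = map r (u @ v)"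
  have ones: "1 \<notin> abs ` set (u @ v)" using w'(2) s(2) by (auto simp: uv)
  have full: "insert 1 (abs ` set (u @ v)) = {1..int n + 1}"
    using w'(3) s(2) by (auto simp: uv)
  have img: "abs ` set (u @ v) = {2..int n + 1}"
  proof -
    have "abs ` set (u @ v) = insert 1 (abs ` set (u @ v)) - {1}"
      using Diff_insert_absorb[OF ones] by (rule sym)
    also have "\<dots> = {1..int n + 1} - {1}" by (simp only: full)
    also have "\<dots> = {2..int n + 1}" by auto
    finally show ?thesis .
  qed
  have big: "2 \<le> \<bar>a\<bar>" if "a \<in> set (u @ v)" for a
    using img that by (metis atLeastAtMost_iff image_eqI)
  have rsh: "shift (r a) = a" "\<bar>r a\<bar> = \<bar>a\<bar> - 1" if "a \<in> set (u @ v)" for a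
    using big[OF that] by (auto simp: shift_def r_def sgn_if)
  have eq: "map abs w = map (\<lambda>k. k - 1) (map abs (u @ v))"
    unfolding w_def using rsh(2) by simp
  have "distinct (map abs w)"
    unfolding eq using w'(2) by (subst distinct_map) (auto simp: inj_on_def uv)
  moreover have "abs ` set w = {1..int n}"
  proof -
    have "abs ` set w = (\<lambda>k. k - 1) ` {2..int n + 1}"
      using arg_cong[OF eq, of set] unfolding set_map img .
    also have "\<dots> = {1..int n}"
    proof (intro equalityI subsetI)
      fix k assume "k \<in> {1..int n}"
      then show "k \<in> (\<lambda>k. k - 1) ` {2..int n + 1}" by (intro image_eqI[of _ _ "k + 1"]) auto
    qed auto
    finally show ?thesis .
  qed
  moreover have "length w = n" using w'(1) by (simp add: uv w_def)
  ultimately have "w \<in> signed_words n" unfolding signed_words_def by blast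
  moreover have "map shift w = u @ v"
    unfolding w_def map_map by (rule map_idI) (use rsh(1) in auto)
  then have "w' = insert_at (length u) s (map shift w)" by (simp add: insert_at_def uv)
  moreover have "length u \<le> n" using w'(1) by (simp add: uv)
  ultimately show thesis using that s(2) by blast
qed

text \<open>
  The coset decomposition of \<open>D(n + 1)\<close> with respect to \<open>D(n)\<close>. Inserting \<open>- 1\<close> has to be accompanied by
  another sign change, and the last letter is the one that can be flipped without affecting the length.
  For \<open>n = 0\<close> there is no letter to flip, and indeed \<open>D(1)\<close> is trivial.
\<close>

lemma even_words_Suc:
  fixes F :: "int list \<Rightarrow> 'b::comm_monoid_add"
  shows "(\<Sum>w\<in>even_words (Suc n). F w) =
    (\<Sum>w\<in>even_words n. (\<Sum>i\<le>n. F (insert_at i 1 (map shift w))) +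
      (if n = 0 then 0 else \<Sum>i\<le>n. F (insert_at i (- 1) (map shift (map_last uminus w)))))"
proof -
  let ?S = "even_words n \<times> {..n}"
  define P where "P = (\<lambda>(w, i). insert_at i (1::int) (map shift w))"
  define N where "N = (\<lambda>(w, i). insert_at i (-1::int) (map shift (map_last uminus w)))"
  have fin: "finite (even_words m)" for m
    by (simp add: even_words_def)
  have len: "length w = n" and nz: "a \<in> set w \<Longrightarrow> a \<noteq> 0" if "w \<in> signed_words n" for w a
    using that signed_words_nz by (auto simp: signed_words_def)
  have ml: "map_last uminus w \<in> signed_words n" if "w \<in> even_words n" for w
    using that by (auto simp: even_words_def map_last_in_signed_words)
  have shift_inj: "u = v" if "map shift u = map shift v" "0 \<notin> set u" "0 \<notin> set v" for u v
  proof -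
    have inj: "inj_on shift (set u \<union> set v)"
      by (auto simp: inj_on_def shift_def sgn_if split: if_splits)
    show ?thesis using that(1) map_inj_on[OF _ inj] by blast
  qed
  have ones: "s \<notin> set (map shift w)" if "w \<in> signed_words n" "\<bar>s\<bar> = 1" for w s
  proof
    assume "s \<in> set (map shift w)"
    then obtain a where "a \<in> set w" "s = shift a" by auto
    then show False using shift_simps(1)[OF nz[OF that(1)], of a] that(2) by simp
  qed
  have ins_inj: "insert_at i s (map shift u) = insert_at j s (map shift v) \<longleftrightarrow> u = v \<and> i = j"
    if "u \<in> signed_words n" "v \<in> signed_words n" "i \<le> n" "j \<le> n" "\<bar>s\<bar> = 1" for u v i j s
  proof -
    have "insert_at i s (map shift u) = insert_at j s (map shift v) \<longleftrightarrow>
        map shift u = map shift v \<and> i = j"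
      using that len by (intro insert_at_inject ones) auto
    then show ?thesis using shift_inj[of u v] nz that(1,2) by blast
  qed
  have ml_inv: "map_last uminus (map_last uminus w) = w" for w :: "int list"
    by (cases w rule: rev_cases) auto
  have injP: "inj_on P ?S"
    by (rule inj_onI) (auto simp: P_def ins_inj even_words_def)
  have injN: "inj_on N ?S"
  proof (rule inj_onI)
    fix p p' assume p: "p \<in> ?S" "p' \<in> ?S" and Np: "N p = N p'"
    obtain u i v j where uv: "p = (u, i)" "p' = (v, j)" by (cases p, cases p')
    have u: "u \<in> even_words n" and v: "v \<in> even_words n"
      and ij: "i \<in> {..n}" "j \<in> {..n}" and eq: "N (u, i) = N (v, j)"
      using p Np by (simp_all add: uv)
    have "map_last uminus u = map_last uminus v \<and> i = j"
      using ins_inj[OF ml[OF u] ml[OF v], of i j "- 1"] ij eq by (simp add: N_def)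
    then show "p = p'" unfolding uv by (metis ml_inv)
  qed
  have sgn_ins: "prod_list (map sgn (insert_at i s (map shift w))) = s * prod_list (map sgn w)"
    if "\<bar>s\<bar> = 1" for i s and w :: "int list"
    using that by (simp add: map_insert_at prod_list_insert_at o_def shift_simps)
      (auto simp: sgn_if abs_if split: if_splits)
  have disj: "P ` ?S \<inter> N ` ?S = {}"
  proof -
    have P1: "1 \<in> set (P p)" for p by (cases p) (simp add: P_def)
    have N1: "1 \<notin> set (N p)" if "p \<in> ?S" for p
      using that ones[OF ml, of _ 1] by (cases p) (simp add: N_def)
    have "P p \<noteq> N p'" if "p' \<in> ?S" for p p'
      using P1[of p] N1[OF that] by metis
    then show ?thesis by auto
  qed
  have union: "even_words (Suc n) = P ` ?S \<union> (if n = 0 then {} else N ` ?S)"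
  proof (intro equalityI subsetI)
    fix w' assume w': "w' \<in> even_words (Suc n)"
    then obtain w i s where w: "w \<in> signed_words n" "i \<le> n" "\<bar>s\<bar> = 1" "w' = insert_at i s (map shift w)"
      by (auto simp: even_words_def elim: signed_words_SucE)
    have sg: "s * prod_list (map sgn w) = 1"
      using w' sgn_ins[OF w(3)] by (simp add: even_words_def w(4))
    show "w' \<in> P ` ?S \<union> (if n = 0 then {} else N ` ?S)"
    proof (cases "s = 1")
      case True
      then have "(w, i) \<in> ?S" "w' = P (w, i)" using w sg by (auto simp: even_words_def P_def)
      then show ?thesis by blast
    next
      case False
      then have s: "s = - 1" using w(3) by linarith
      have "n \<noteq> 0" using sg s w(1) by (auto simp: signed_words_def)
      moreover have "w \<noteq> []" using \<open>n \<noteq> 0\<close> len[OF w(1)] by auto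
      then have "(map_last uminus w, i) \<in> ?S"
        using w sg s by (simp add: even_words_def prod_sgn_map_last map_last_in_signed_words)
      moreover have "w' = N (map_last uminus w, i)" using w s by (simp add: N_def ml_inv)
      ultimately show ?thesis by auto
    qed
  next
    fix w' assume "w' \<in> P ` ?S \<union> (if n = 0 then {} else N ` ?S)"
    then show "w' \<in> even_words (Suc n)"
    proof
      assume "w' \<in> P ` ?S"
      then show ?thesis
        by (auto simp: P_def even_words_def insert_at_in_signed_words sgn_ins)
    next
      assume "w' \<in> (if n = 0 then {} else N ` ?S)"
      then obtain w i where n: "n \<noteq> 0" and w: "w \<in> even_words n"
          "w' = insert_at i (- 1) (map shift (map_last uminus w))"
        by (auto simp: N_def split: if_splits)
      have "w \<noteq> []" using n w(1) by (auto simp: even_words_def signed_words_def)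
      then show ?thesis
        using w ml[OF w(1)] by (simp add: even_words_def insert_at_in_signed_words sgn_ins prod_sgn_map_last)
    qed
  qed
  have "(\<Sum>w\<in>even_words (Suc n). F w) = (\<Sum>p\<in>?S. F (P p)) + (if n = 0 then 0 else \<Sum>p\<in>?S. F (N p))"
    unfolding union using disj fin
    by (auto simp: sum.union_disjoint sum.reindex[OF injP] sum.reindex[OF injN])
  also have "\<dots> = (\<Sum>w\<in>even_words n. \<Sum>i\<le>n. F (P (w, i))) +
      (if n = 0 then 0 else \<Sum>w\<in>even_words n. \<Sum>i\<le>n. F (N (w, i)))"
    by (simp add: sum.cartesian_product)
  finally show ?thesis by (auto simp: P_def N_def sum.distrib)
qed

section \<open>The inner product on algebraic tensor powers\<close>

lemma sum_fun_apply: "(\<Sum>x\<in>S. F x) y = (\<Sum>x\<in>S. F x y)" for F :: "'b \<Rightarrow> 'c \<Rightarrow> 'd::comm_monoid_add"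
  by (induction S rule: infinite_finite_induct) auto

lemma smult_fock_apply [simp]: "(c *\<^sub>F f) ys = c * f ys"
  by (simp add: smult_fock_def)

lemma tensor_comb_apply: "tensor_comb a A ys = (\<Sum>xs\<in>A. a xs * ptensor xs ys)"
  by (simp add: tensor_comb_def sum_fun_apply)

lemma cinner_scaleC_left: "cinner (a *\<^sub>C x) y = cnj a * cinner x y"
  by (metis cinner_commute cinner_scaleC_right complex_cnj_mult)

lemma cinner_0_right [simp]: "cinner x 0 = 0"
  using cinner_add_right[of x 0 0] by simp

lemma cinner_diff_right: "cinner x (y - z) = cinner x y - cinner x z"
  using cinner_add_right[of x "y - z" z] by (simp add: algebra_simps)

lemma cinner_sum_right: "cinner x (\<Sum>i\<in>I. f i) = (\<Sum>i\<in>I. cinner x (f i))"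
  by (induction I rule: infinite_finite_induct) (simp_all add: cinner_add_right)

lemma scaleC_0_left [simp]: "0 *\<^sub>C x = (0 :: 'a::complex_hilbert_space)"
  using scaleC_of_real[of 0 x] by simp

lemma scaleC_1_left [simp]: "1 *\<^sub>C x = (x :: 'a::complex_hilbert_space)"
  using scaleC_of_real[of 1 x] by simp

text \<open>
  Gram-Schmidt orthogonalization, in the form needed to write inner products as finite sums over an
  orthonormal set.
\<close>

lemma orthonormal_expansion:
  fixes X :: "'a::complex_hilbert_space set"
  assumes "finite X"
  shows "\<exists>E. finite E \<and> (\<forall>d\<in>E. \<forall>e\<in>E. cinner d e = of_bool (d = e)) \<and>
    (\<forall>x\<in>X. x = (\<Sum>e\<in>E. cinner e x *\<^sub>C e))"
  using assms
proof (induction X)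
  case empty
  then show ?case by (intro exI[of _ "{}"]) auto
next
  case (insert y X)
  then obtain E where fin: "finite E"
    and on: "\<And>d e. d \<in> E \<Longrightarrow> e \<in> E \<Longrightarrow> cinner d e = of_bool (d = e)"
    and ex: "\<And>x. x \<in> X \<Longrightarrow> x = (\<Sum>e\<in>E. cinner e x *\<^sub>C e)"
    by metis
  define r where "r = y - (\<Sum>e\<in>E. cinner e y *\<^sub>C e)"
  have y: "y = (\<Sum>e\<in>E. cinner e y *\<^sub>C e) + r" by (simp add: r_def)
  have orth: "cinner e r = 0" if "e \<in> E" for e
  proof -
    have "cinner e (\<Sum>d\<in>E. cinner d y *\<^sub>C d) = (\<Sum>d\<in>E. cinner d y * of_bool (e = d))"
      using on that by (simp add: cinner_sum_right cinner_scaleC_right)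
    also have "\<dots> = (\<Sum>d\<in>E. if e = d then cinner d y else 0)"
      by (intro sum.cong refl) simp
    also have "\<dots> = cinner e y" using fin that by simp
    finally show ?thesis by (simp add: r_def cinner_diff_right)
  qed
  show ?case
  proof (cases "r = 0")
    case True
    then show ?thesis using fin on ex y by (intro exI[of _ E]) auto
  next
    case False
    define c where "c = complex_of_real (1 / norm r)"
    define d where "d = c *\<^sub>C r"
    have cc: "c * cinner r r * c = 1" "cnj c = c"
      using False by (simp_all add: c_def cinner_norm power2_eq_square)
    have dd: "cinner d d = 1"
      using cc by (simp add: d_def cinner_scaleC_left cinner_scaleC_right mult_ac)
    have ed: "cinner e d = 0" "cinner d e = 0" if "e \<in> E" for e
      using orth[OF that] cinner_commute[of d e] by (simp_all add: d_def cinner_scaleC_right)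
    have dE: "d \<notin> E" using ed dd by fastforce
    have dx: "cinner d (\<Sum>e\<in>E. f e *\<^sub>C e) = 0" for f
      using ed by (simp add: cinner_sum_right cinner_scaleC_right)
    have "cinner d y = cinner d r" using dx by (subst y) (simp add: cinner_add_right)
    then have "cinner d y = c * cinner r r"
      unfolding d_def cinner_scaleC_left cc(2) .
    then have "cinner d y *\<^sub>C d = r"
      using cc(1) by (simp add: d_def scaleC_scaleC)
    then have "y = (\<Sum>e\<in>insert d E. cinner e y *\<^sub>C e)"
      using dE fin y by (simp add: add.commute)
    moreover have "x = (\<Sum>e\<in>insert d E. cinner e x *\<^sub>C e)" if "x \<in> X" for x
    proof -
      have "cinner d x = 0" using dx ex[OF that] by metis
      then show ?thesis using dE fin ex[OF that] by simp
    qed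
    ultimately show ?thesis
      using fin on dd ed dE by (intro exI[of _ "insert d E"]) auto
  qed
qed

lemma ptensor_Cons: "ptensor (z # zs) (x # xs) = cinner x z * ptensor zs xs"
  by (auto simp: ptensor_def prod.lessThan_Suc_shift simp del: prod.lessThan_Suc)

text \<open>
  The entrywise product of Gram matrices is positive semidefinite: peel off the first tensor factor and
  expand its inner products over an orthonormal set, which leaves a sum of Gram sums of length \<open>n\<close>.
\<close>

lemma ptensor_gram_nonneg:
  fixes X :: "'i \<Rightarrow> 'a::complex_hilbert_space list"
  assumes "finite I" "\<And>i. i \<in> I \<Longrightarrow> length (X i) = n"
  shows "0 \<le> Re (\<Sum>i\<in>I. \<Sum>j\<in>I. cnj (c i) * c j * ptensor (X j) (X i))"
  using assms(2)
proof (induction n arbitrary: X c)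
  case 0
  then have "(\<Sum>i\<in>I. \<Sum>j\<in>I. cnj (c i) * c j * ptensor (X j) (X i)) =
      (\<Sum>i\<in>I. \<Sum>j\<in>I. cnj (c i) * c j)"
    by (simp add: ptensor_def)
  also have "\<dots> = (\<Sum>i\<in>I. c i) * cnj (\<Sum>i\<in>I. c i)"
    by (subst mult.commute) (simp add: sum_product)
  also have "\<dots> = complex_of_real ((cmod (\<Sum>i\<in>I. c i))\<^sup>2)"
    by (rule complex_norm_square[symmetric])
  finally show ?case by (simp only: Re_complex_of_real zero_le_power2)
next
  case (Suc n)
  define h where "h i = hd (X i)" for i
  define t where "t i = tl (X i)" for i
  have X: "X i = h i # t i" "length (t i) = n" if "i \<in> I" for i
    using Suc.prems[OF that] by (cases "X i"; simp add: h_def t_def)+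
  obtain E where E: "finite E" "\<And>x. x \<in> h ` I \<Longrightarrow> x = (\<Sum>e\<in>E. cinner e x *\<^sub>C e)"
    using orthonormal_expansion[of "h ` I"] assms(1) by auto
  have ip: "cinner x (h j) = (\<Sum>e\<in>E. cnj (cinner e x) * cinner e (h j))" if "j \<in> I" for x j
  proof -
    have "cinner x (h j) = cinner x (\<Sum>e\<in>E. cinner e (h j) *\<^sub>C e)"
      using E(2)[of "h j"] that by simp
    also have "\<dots> = (\<Sum>e\<in>E. cnj (cinner e x) * cinner e (h j))"
      by (simp add: cinner_sum_right cinner_scaleC_right cinner_commute[symmetric] mult.commute)
    finally show ?thesis .
  qed
  have "(\<Sum>i\<in>I. \<Sum>j\<in>I. cnj (c i) * c j * ptensor (X j) (X i)) =
      (\<Sum>i\<in>I. \<Sum>j\<in>I. \<Sum>e\<in>E. cnj (c i * cinner e (h i)) * (c j * cinner e (h j)) * ptensor (t j) (t i))"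
    by (intro sum.cong refl)
      (simp add: X ptensor_Cons ip sum_distrib_left sum_distrib_right mult_ac)
  also have "\<dots> = (\<Sum>e\<in>E. \<Sum>i\<in>I. \<Sum>j\<in>I.
      cnj (c i * cinner e (h i)) * (c j * cinner e (h j)) * ptensor (t j) (t i))"
    by (simp only: sum.swap[where A = I and B = E])
  finally have eq: "(\<Sum>i\<in>I. \<Sum>j\<in>I. cnj (c i) * c j * ptensor (X j) (X i)) = \<dots>" .
  show ?case
    unfolding eq by (subst Re_sum) (intro sum_nonneg Suc.IH X(2))
qed

lemma alg_tensor_powerE:
  assumes "f \<in> alg_tensor_power n"
  obtains a A where "finite A" "A \<subseteq> {xs. length xs = n}" "f = tensor_comb a A"
  using assms by (auto simp: alg_tensor_power_def)

lemma alg_tensor_power_add: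
  assumes "f \<in> alg_tensor_power n" "g \<in> alg_tensor_power n"
  shows "f + g \<in> alg_tensor_power n"
proof -
  obtain a A b B where *: "finite A" "A \<subseteq> {xs. length xs = n}" "f = tensor_comb a A"
      "finite B" "B \<subseteq> {xs. length xs = n}" "g = tensor_comb b B"
    using assms by (elim alg_tensor_powerE)
  let ?c = "\<lambda>xs. (if xs \<in> A then a xs else 0) + (if xs \<in> B then b xs else 0)"
  have "f + g = tensor_comb ?c (A \<union> B)"
  proof
    fix ys
    have A: "(\<Sum>xs\<in>A \<union> B. (if xs \<in> A then a xs else 0) * ptensor xs ys) = f ys"
      unfolding *(3) tensor_comb_apply using *(1,4) by (intro sum.mono_neutral_cong_right) auto
    have B: "(\<Sum>xs\<in>A \<union> B. (if xs \<in> B then b xs else 0) * ptensor xs ys) = g ys"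
      unfolding *(6) tensor_comb_apply using *(1,4) by (intro sum.mono_neutral_cong_right) auto
    show "(f + g) ys = tensor_comb ?c (A \<union> B) ys"
      by (simp only: tensor_comb_apply distrib_right sum.distrib A B plus_fun_apply)
  qed
  then show ?thesis using * unfolding alg_tensor_power_def by blast
qed

lemma alg_tensor_power_smult:
  assumes "f \<in> alg_tensor_power n"
  shows "c *\<^sub>F f \<in> alg_tensor_power n"
proof -
  obtain a A where *: "finite A" "A \<subseteq> {xs. length xs = n}" "f = tensor_comb a A"
    using assms by (rule alg_tensor_powerE)
  have "c *\<^sub>F f = tensor_comb (\<lambda>xs. c * a xs) A"
    by (simp add: fun_eq_iff *(3) tensor_comb_apply sum_distrib_left mult.assoc)
  then show ?thesis using * unfolding alg_tensor_power_def by blast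
qed

lemma alg_tensor_power_0: "0 \<in> alg_tensor_power n"
  unfolding alg_tensor_power_def by (rule CollectI, rule exI[of _ "\<lambda>_. 0"], rule exI[of _ "{}"])
    (simp add: tensor_comb_def)

lemma alg_tensor_power_ptensor: "length xs = n \<Longrightarrow> ptensor xs \<in> alg_tensor_power n"
  unfolding alg_tensor_power_def by (rule CollectI, rule exI[of _ "\<lambda>_. 1"], rule exI[of _ "{xs}"])
    (simp add: fun_eq_iff tensor_comb_apply)

lemma fock_diff_eq: "f - g = f + (- 1) *\<^sub>F g"
  by (simp add: fun_eq_iff)

lemma alg_tensor_power_diff:
  "f \<in> alg_tensor_power n \<Longrightarrow> g \<in> alg_tensor_power n \<Longrightarrow> f - g \<in> alg_tensor_power n"
  unfolding fock_diff_eq by (intro alg_tensor_power_add alg_tensor_power_smult)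

lemma alg_tensor_power_induct [consumes 1, case_names zero add]:
  assumes "f \<in> alg_tensor_power n" "P 0"
    and step: "\<And>c xs g. length xs = n \<Longrightarrow> g \<in> alg_tensor_power n \<Longrightarrow> P g \<Longrightarrow> P (c *\<^sub>F ptensor xs + g)"
  shows "P f"
proof -
  obtain a A where *: "finite A" "A \<subseteq> {xs. length xs = n}" "f = tensor_comb a A"
    using assms(1) by (rule alg_tensor_powerE)
  have "P (tensor_comb a A)"
    using *(1,2)
  proof (induction A)
    case empty
    show ?case unfolding tensor_comb_def sum.empty by (rule assms(2))
  next
    case (insert xs A)
    then have "tensor_comb a A \<in> alg_tensor_power n"
      unfolding alg_tensor_power_def by blast
    then have "P (a xs *\<^sub>F ptensor xs + tensor_comb a A)"
      using insert by (intro step) auto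
    then show ?case unfolding tensor_comb_def sum.insert[OF insert.hyps] .
  qed
  then show ?thesis by (simp add: *(3))
qed

lemma alg_inner_left:
  assumes "finite A" "g \<in> alg_tensor_power n"
  shows "alg_inner (tensor_comb a A) g = (\<Sum>xs\<in>A. cnj (a xs) * g xs)"
proof -
  obtain b B where *: "finite B" "g = tensor_comb b B"
    using assms(2) by (rule alg_tensor_powerE)
  show ?thesis
    unfolding *(2) alg_inner_tensor_comb[OF assms(1) *(1)]
    by (simp add: tensor_comb_apply sum_distrib_left mult.assoc)
qed

lemma alg_inner_add_right:
  assumes "f \<in> alg_tensor_power n" "g \<in> alg_tensor_power n" "h \<in> alg_tensor_power n"
  shows "alg_inner f (g + h) = alg_inner f g + alg_inner f h"
proof -
  obtain a A where *: "finite A" "f = tensor_comb a A"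
    using assms(1) by (rule alg_tensor_powerE)
  show ?thesis
    unfolding *(2) using assms
    by (simp add: alg_inner_left[OF *(1), of _ n] alg_tensor_power_add distrib_left sum.distrib)
qed

lemma alg_inner_smult_right:
  assumes "f \<in> alg_tensor_power n" "g \<in> alg_tensor_power n"
  shows "alg_inner f (c *\<^sub>F g) = c * alg_inner f g"
proof -
  obtain a A where *: "finite A" "f = tensor_comb a A"
    using assms(1) by (rule alg_tensor_powerE)
  show ?thesis
    unfolding *(2) using assms
    by (simp add: alg_inner_left[OF *(1), of _ n] alg_tensor_power_smult sum_distrib_left mult_ac)
qed

lemma alg_inner_commute:
  assumes "f \<in> alg_tensor_power n" "g \<in> alg_tensor_power n"
  shows "alg_inner f g = cnj (alg_inner g f)"
proof -
  obtain a A b B where *: "finite A" "f = tensor_comb a A" "finite B" "g = tensor_comb b B"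
    using assms by (elim alg_tensor_powerE)
  show ?thesis
    unfolding *(2,4) alg_inner_tensor_comb[OF *(1,3)] alg_inner_tensor_comb[OF *(3,1)]
    by (subst sum.swap) (simp add: ptensor_swap[symmetric] mult_ac)
qed

lemma alg_inner_add_left:
  assumes "f \<in> alg_tensor_power n" "g \<in> alg_tensor_power n" "h \<in> alg_tensor_power n"
  shows "alg_inner (f + g) h = alg_inner f h + alg_inner g h"
  using assms alg_inner_commute[of _ n h] alg_inner_add_right[of h n f g]
  by (simp add: alg_tensor_power_add)

lemma alg_inner_smult_left:
  assumes "f \<in> alg_tensor_power n" "g \<in> alg_tensor_power n"
  shows "alg_inner (c *\<^sub>F f) g = cnj c * alg_inner f g"
  using assms alg_inner_commute[of _ n g] alg_inner_smult_right[of g n f c]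
  by (simp add: alg_tensor_power_smult)

lemma alg_inner_diff_right:
  assumes "f \<in> alg_tensor_power n" "g \<in> alg_tensor_power n" "h \<in> alg_tensor_power n"
  shows "alg_inner f (g - h) = alg_inner f g - alg_inner f h"
  using assms unfolding fock_diff_eq
  by (simp add: alg_inner_add_right alg_inner_smult_right alg_tensor_power_smult)

lemma alg_inner_diff_left:
  assumes "f \<in> alg_tensor_power n" "g \<in> alg_tensor_power n" "h \<in> alg_tensor_power n"
  shows "alg_inner (f - g) h = alg_inner f h - alg_inner g h"
  using assms unfolding fock_diff_eq
  by (simp add: alg_inner_add_left alg_inner_smult_left alg_tensor_power_smult)

lemma alg_inner_ptensor:
  assumes "g \<in> alg_tensor_power n"
  shows "alg_inner (ptensor xs) g = g xs"
proof -
  have "ptensor xs = tensor_comb (\<lambda>_. 1) {xs}"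
    by (simp add: fun_eq_iff tensor_comb_apply)
  then show ?thesis using alg_inner_left[of "{xs}" g n "\<lambda>_. 1"] assms by simp
qed

lemma alg_inner_zero_left [simp]: "g \<in> alg_tensor_power n \<Longrightarrow> alg_inner 0 g = 0"
  using alg_inner_left[of "{}" g n "\<lambda>_. 0"] by (simp add: tensor_comb_def)

lemma alg_inner_nonneg:
  assumes "f \<in> alg_tensor_power n"
  shows "0 \<le> Re (alg_inner f f)"
proof -
  obtain a A where *: "finite A" "A \<subseteq> {xs. length xs = n}" "f = tensor_comb a A"
    using assms by (rule alg_tensor_powerE)
  show ?thesis
    unfolding *(3) alg_inner_tensor_comb[OF *(1,1)]
    by (rule ptensor_gram_nonneg[of A "\<lambda>xs. xs" n a]) (use * in auto)
qed

lemma alg_inner_self: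
  assumes "f \<in> alg_tensor_power n"
  shows "alg_inner f f = complex_of_real ((alg_norm f)\<^sup>2)"
proof -
  have "Im (alg_inner f f) = 0"
    using arg_cong[OF alg_inner_commute[OF assms assms], of Im] by simp
  then show ?thesis
    using alg_inner_nonneg[OF assms] by (simp add: complex_eq_iff alg_norm_def)
qed

lemma alg_norm_nonneg: "f \<in> alg_tensor_power n \<Longrightarrow> 0 \<le> alg_norm f"
  by (simp add: alg_norm_def alg_inner_nonneg)

lemma alg_norm_sq: "f \<in> alg_tensor_power n \<Longrightarrow> (alg_norm f)\<^sup>2 = Re (alg_inner f f)"
  by (simp add: alg_norm_def alg_inner_nonneg)

text \<open>
  Positivity of the square of \<open>f - s \<langle>g, f\<rangle> g\<close> for every real \<open>s\<close>. If the norm of \<open>g\<close> vanishes, a large \<open>s\<close>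
  forces \<open>\<langle>g, f\<rangle> = 0\<close>; otherwise the minimizing \<open>s\<close> gives the inequality.
\<close>

lemma alg_cauchy_schwarz:
  assumes f: "f \<in> alg_tensor_power n" and g: "g \<in> alg_tensor_power n"
  shows "cmod (alg_inner f g) \<le> alg_norm f * alg_norm g"
proof -
  define c where "c = alg_inner g f"
  have c: "alg_inner f g = cnj c" "cmod (alg_inner f g) = cmod c"
    using alg_inner_commute[OF f g] by (simp_all add: c_def)
  have quad: "0 \<le> (alg_norm f)\<^sup>2 - 2 * s * (cmod c)\<^sup>2 + s\<^sup>2 * (cmod c)\<^sup>2 * (alg_norm g)\<^sup>2" for s :: real
  proof -
    let ?t = "complex_of_real s * c"
    have tg: "?t *\<^sub>F g \<in> alg_tensor_power n" using g by (rule alg_tensor_power_smult)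
    have cc: "c * cnj c = complex_of_real ((cmod c)\<^sup>2)" by (rule complex_norm_square[symmetric])
    have "alg_inner (f - ?t *\<^sub>F g) (f - ?t *\<^sub>F g) =
        alg_inner f f - ?t * cnj c - cnj ?t * c + cnj ?t * ?t * alg_inner g g"
      using f g tg
      by (simp add: alg_inner_diff_left[of _ n] alg_inner_diff_right[of _ n] alg_tensor_power_diff
          alg_inner_smult_left[of _ n] alg_inner_smult_right[of _ n] c(1) c_def[symmetric]
          algebra_simps)
    also have "\<dots> = complex_of_real ((alg_norm f)\<^sup>2) - 2 * complex_of_real s * (c * cnj c)
        + (complex_of_real s)\<^sup>2 * (c * cnj c) * complex_of_real ((alg_norm g)\<^sup>2)"
      unfolding alg_inner_self[OF f] alg_inner_self[OF g] by (simp add: power2_eq_square algebra_simps)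
    also have "\<dots> = complex_of_real ((alg_norm f)\<^sup>2 - 2 * s * (cmod c)\<^sup>2
        + s\<^sup>2 * (cmod c)\<^sup>2 * (alg_norm g)\<^sup>2)"
      unfolding cc by simp
    finally show ?thesis
      using alg_inner_nonneg[OF alg_tensor_power_diff[OF f tg]] by (simp del: of_real_add of_real_diff)
  qed
  have "(cmod c)\<^sup>2 \<le> (alg_norm f)\<^sup>2 * (alg_norm g)\<^sup>2"
  proof (cases "alg_norm g = 0")
    case True
    have "(cmod c)\<^sup>2 = 0"
    proof (rule ccontr)
      assume nz: "(cmod c)\<^sup>2 \<noteq> 0"
      show False
        \<comment> \<open>the bound is linear in \<open>s\<close> here, and this \<open>s\<close> makes it equal to \<open>- 1\<close>\<close>
        using quad[of "((alg_norm f)\<^sup>2 + 1) / (2 * (cmod c)\<^sup>2)"] nz True by (simp add: field_simps)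
    qed
    then show ?thesis by simp
  next
    case False
    \<comment> \<open>the minimizing \<open>s\<close>\<close>
    have "0 \<le> (alg_norm f)\<^sup>2 - (cmod c)\<^sup>2 / (alg_norm g)\<^sup>2"
      using quad[of "1 / (alg_norm g)\<^sup>2"] False by (simp add: power2_eq_square field_simps)
    then show ?thesis using False by (simp add: field_simps)
  qed
  then have "(cmod c)\<^sup>2 \<le> (alg_norm f * alg_norm g)\<^sup>2" by (simp add: power_mult_distrib)
  then show ?thesis
    unfolding c(2) by (rule power2_le_imp_le) (simp add: alg_norm_nonneg[OF f] alg_norm_nonneg[OF g])
qed

lemma alg_norm_triangle:
  assumes f: "f \<in> alg_tensor_power n" and g: "g \<in> alg_tensor_power n"
  shows "alg_norm (f + g) \<le> alg_norm f + alg_norm g"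
proof (rule power2_le_imp_le)
  have "alg_inner (f + g) (f + g) = alg_inner f f + alg_inner g g + (alg_inner f g + cnj (alg_inner f g))"
    using f g alg_inner_commute[OF g f]
    by (simp add: alg_inner_add_left[of _ n] alg_inner_add_right[of _ n] alg_tensor_power_add algebra_simps)
  then have "(alg_norm (f + g))\<^sup>2 = (alg_norm f)\<^sup>2 + (alg_norm g)\<^sup>2 + 2 * Re (alg_inner f g)"
    using f g by (simp add: alg_norm_sq[of _ n] alg_tensor_power_add)
  also have "Re (alg_inner f g) \<le> alg_norm f * alg_norm g"
    using alg_cauchy_schwarz[OF f g] complex_Re_le_cmod order_trans by blast
  finally show "(alg_norm (f + g))\<^sup>2 \<le> (alg_norm f + alg_norm g)\<^sup>2"
    by (simp add: power2_sum)
qed (use f g in \<open>simp add: alg_norm_nonneg[of _ n]\<close>)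

lemma alg_norm_smult:
  assumes f: "f \<in> alg_tensor_power n"
  shows "alg_norm (c *\<^sub>F f) = cmod c * alg_norm f"
proof (rule power2_eq_imp_eq)
  have "alg_inner (c *\<^sub>F f) (c *\<^sub>F f) = (c * cnj c) * alg_inner f f"
    using f by (simp add: alg_inner_smult_left[of _ n] alg_inner_smult_right[of _ n] alg_tensor_power_smult)
  also have "\<dots> = complex_of_real ((cmod c * alg_norm f)\<^sup>2)"
    unfolding alg_inner_self[OF f] complex_norm_square[symmetric] by (simp add: power_mult_distrib)
  finally show "(alg_norm (c *\<^sub>F f))\<^sup>2 = (cmod c * alg_norm f)\<^sup>2"
    using f by (simp add: alg_norm_sq[of _ n] alg_tensor_power_smult)
qed (use f in \<open>simp_all add: alg_norm_nonneg[of _ n] alg_tensor_power_smult\<close>)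

section \<open>Completed tensor powers\<close>

lemma approximatesD:
  assumes "approximates n s f"
  shows "s k \<in> alg_tensor_power n" "(\<lambda>k. s k ys) \<longlonglongrightarrow> f ys"
    and "0 < e \<Longrightarrow> \<exists>N. \<forall>i\<ge>N. \<forall>j\<ge>N. alg_norm (s i - s j) < e"
  using assms by (simp_all add: approximates_def)

lemma alg_norm_zero [simp]: "alg_norm 0 = 0"
  by (simp add: alg_norm_def alg_inner_zero_left[OF alg_tensor_power_0])

lemma approximates_const: "f \<in> alg_tensor_power n \<Longrightarrow> approximates n (\<lambda>_. f) f"
  by (simp add: approximates_def)

lemma approximates_add:
  assumes s: "approximates n s f" and t: "approximates n t g"
  shows "approximates n (\<lambda>k. s k + t k) (f + g)"
  unfolding approximates_def
proof (intro conjI allI impI)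
  fix e :: real assume "0 < e"
  then have e: "0 < e / 2" by simp
  obtain N where N: "\<And>i j. N \<le> i \<Longrightarrow> N \<le> j \<Longrightarrow> alg_norm (s i - s j) < e / 2"
    using approximatesD(3)[OF s e] by blast
  obtain M where M: "\<And>i j. M \<le> i \<Longrightarrow> M \<le> j \<Longrightarrow> alg_norm (t i - t j) < e / 2"
    using approximatesD(3)[OF t e] by blast
  have "alg_norm (s i + t i - (s j + t j)) < e" if "max N M \<le> i" "max N M \<le> j" for i j
  proof -
    have "s i + t i - (s j + t j) = (s i - s j) + (t i - t j)" by simp
    then have "alg_norm (s i + t i - (s j + t j)) \<le> alg_norm (s i - s j) + alg_norm (t i - t j)"
      using alg_norm_triangle[OF alg_tensor_power_diff alg_tensor_power_diff] approximatesD(1)[OF s]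
        approximatesD(1)[OF t] by metis
    then show ?thesis using N[of i j] M[of i j] that by simp
  qed
  then show "\<exists>N. \<forall>i\<ge>N. \<forall>j\<ge>N. alg_norm (s i + t i - (s j + t j)) < e" by blast
qed (use approximatesD[OF s] approximatesD[OF t] in \<open>auto intro: alg_tensor_power_add tendsto_add\<close>)

text \<open>
  A bounded operator that is continuous for pointwise convergence extends to the completion.
\<close>

lemma approximates_map:
  assumes s: "approximates n s f"
    and maps: "\<And>f. f \<in> alg_tensor_power n \<Longrightarrow> T f \<in> alg_tensor_power m"
    and diff: "\<And>f g. T (f - g) = T f - T g"
    and bound: "\<And>f. f \<in> alg_tensor_power n \<Longrightarrow> alg_norm (T f) \<le> C * alg_norm f"
    and lim: "\<And>ys. (\<lambda>k. T (s k) ys) \<longlonglongrightarrow> T f ys"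
  shows "approximates m (\<lambda>k. T (s k)) (T f)"
  unfolding approximates_def
proof (intro conjI allI impI)
  fix e :: real assume e: "0 < e"
  \<comment> \<open>a positive bound, so that dividing by it is harmless\<close>
  define D where "D = \<bar>C\<bar> + 1"
  have D: "0 < D" "C \<le> D" by (auto simp: D_def)
  obtain N where N: "\<And>i j. N \<le> i \<Longrightarrow> N \<le> j \<Longrightarrow> alg_norm (s i - s j) < e / D"
    using approximatesD(3)[OF s, of "e / D"] e D by auto
  have "alg_norm (T (s i) - T (s j)) < e" if "N \<le> i" "N \<le> j" for i j
  proof -
    have mem: "s i - s j \<in> alg_tensor_power n"
      using approximatesD(1)[OF s] by (intro alg_tensor_power_diff)
    have "alg_norm (T (s i) - T (s j)) \<le> C * alg_norm (s i - s j)"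
      using bound[OF mem] by (simp add: diff)
    also have "\<dots> \<le> D * alg_norm (s i - s j)"
      using D alg_norm_nonneg[OF mem] by (intro mult_right_mono)
    also have "\<dots> < e" using N[OF that] D by (simp add: field_simps)
    finally show ?thesis .
  qed
  then show "\<exists>N. \<forall>i\<ge>N. \<forall>j\<ge>N. alg_norm (T (s i) - T (s j)) < e" by blast
qed (use approximatesD(1)[OF s] maps lim in auto)

lemma approximates_smult:
  assumes "approximates n s f"
  shows "approximates n (\<lambda>k. c *\<^sub>F s k) (c *\<^sub>F f)"
proof (rule approximates_map[OF assms, where C = "cmod c"])
  show "(\<lambda>k. (c *\<^sub>F s k) ys) \<longlonglongrightarrow> (c *\<^sub>F f) ys" for ys
    using approximatesD(2)[OF assms] by (auto intro: tendsto_mult)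
  show "c *\<^sub>F (f - g) = c *\<^sub>F f - c *\<^sub>F g" for f g :: "'a fock"
    by (simp add: fun_eq_iff algebra_simps)
  fix f :: "'a fock" assume f: "f \<in> alg_tensor_power n"
  show "c *\<^sub>F f \<in> alg_tensor_power n" using f by (rule alg_tensor_power_smult)
  show "alg_norm (c *\<^sub>F f) \<le> cmod c * alg_norm f" by (simp only: alg_norm_smult[OF f])
qed

lemma approximates_diff:
  assumes "approximates n s f" "approximates n t g"
  shows "approximates n (\<lambda>k. s k - t k) (f - g)"
  unfolding fock_diff_eq by (intro approximates_add approximates_smult assms)

lemma approximates_bounded:
  assumes s: "approximates n s f"
  obtains M where "0 < M" "\<And>k. alg_norm (s k) \<le> M"
proof -
  obtain N where N: "\<And>i j. N \<le> i \<Longrightarrow> N \<le> j \<Longrightarrow> alg_norm (s i - s j) < 1"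
    using approximatesD(3)[OF s, of 1] by auto
  define M where "M = (\<Sum>k\<le>N. alg_norm (s k)) + 1"
  have nn: "0 \<le> alg_norm (s k)" for k using approximatesD(1)[OF s] by (rule alg_norm_nonneg)
  have small: "alg_norm (s k) \<le> (\<Sum>k\<le>N. alg_norm (s k))" if "k \<le> N" for k
    using nn that by (intro member_le_sum) auto
  have "alg_norm (s k) \<le> M" for k
  proof (cases "k \<le> N")
    case False
    have "alg_norm (s k) \<le> alg_norm (s N) + alg_norm (s k - s N)"
      using alg_norm_triangle[of "s N" n "s k - s N"] approximatesD(1)[OF s]
      by (simp add: alg_tensor_power_diff)
    then show ?thesis using N[of k N] False small[of N] by (simp add: M_def)
  qed (use small in \<open>force simp: M_def\<close>)
  moreover have "0 < M" using nn by (simp add: M_def add_nonneg_pos sum_nonneg)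
  ultimately show thesis using that by blast
qed

text \<open>
  Pointwise convergence determines the norm limit of a Cauchy sequence: \<open>u k\<close> is close to a fixed
  \<open>u N\<close>, and pairing with \<open>u N\<close> involves only finitely many values of \<open>u k\<close>, all of which tend to zero.
\<close>

lemma approximates_zero:
  assumes u: "approximates n u 0"
  shows "(\<lambda>k. alg_norm (u k)) \<longlonglongrightarrow> 0"
proof (rule LIMSEQ_I)
  fix e :: real assume e: "0 < e"
  note mem = approximatesD(1)[OF u]
  obtain M where M: "0 < M" "\<And>k. alg_norm (u k) \<le> M"
    using approximates_bounded[OF u] by blast
  have "0 < e\<^sup>2 / (2 * M)" using e M(1) by simp
  then obtain N where N: "\<And>i j. N \<le> i \<Longrightarrow> N \<le> j \<Longrightarrow> alg_norm (u i - u j) < e\<^sup>2 / (2 * M)"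
    using approximatesD(3)[OF u] by meson
  obtain a A where A: "finite A" "u N = tensor_comb a A"
    using mem[of N] by (rule alg_tensor_powerE)
  have "(\<lambda>k. \<Sum>xs\<in>A. cnj (a xs) * u k xs) \<longlonglongrightarrow> (\<Sum>xs\<in>A. cnj (a xs) * 0)"
    using approximatesD(2)[OF u] by (intro tendsto_sum tendsto_mult tendsto_const) simp
  then have "(\<lambda>k. alg_inner (u N) (u k)) \<longlonglongrightarrow> 0"
    using alg_inner_left[OF A(1) mem] by (simp add: A(2))
  then obtain K where K: "\<And>k. K \<le> k \<Longrightarrow> cmod (alg_inner (u N) (u k)) < e\<^sup>2 / 2"
    using LIMSEQ_D[of _ 0 "e\<^sup>2 / 2"] e by fastforce
  have "norm (alg_norm (u k) - 0) < e" if k: "max N K \<le> k" for k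
  proof -
    have "alg_inner (u k) (u k) = alg_inner (u k - u N) (u k) + alg_inner (u N) (u k)"
      using mem by (simp add: alg_inner_diff_left[of _ n])
    then have "(alg_norm (u k))\<^sup>2 \<le> cmod (alg_inner (u k - u N) (u k)) + cmod (alg_inner (u N) (u k))"
      using alg_norm_sq[OF mem, of k] norm_triangle_ineq complex_Re_le_cmod order_trans by metis
    also have "cmod (alg_inner (u k - u N) (u k)) \<le> alg_norm (u k - u N) * alg_norm (u k)"
      using mem by (intro alg_cauchy_schwarz[of _ n] alg_tensor_power_diff)
    also have "\<dots> \<le> e\<^sup>2 / (2 * M) * M"
      using N[of k N] k M alg_norm_nonneg[OF mem] alg_norm_nonneg[OF alg_tensor_power_diff[OF mem mem]]
      by (intro mult_mono) (auto simp: less_imp_le)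
    also have "\<dots> = e\<^sup>2 / 2" using M(1) by simp
    finally have "(alg_norm (u k))\<^sup>2 < e\<^sup>2" using K[of k] k by simp
    then have "alg_norm (u k) < e" using e by (simp add: power_less_imp_less_base)
    then show ?thesis using alg_norm_nonneg[OF mem] by simp
  qed
  then show "\<exists>no. \<forall>k\<ge>no. norm (alg_norm (u k) - 0) < e" by blast
qed

lemma alg_inner_tendsto_zero:
  assumes s: "approximates n s f" and u: "approximates n u 0"
  shows "(\<lambda>k. alg_inner (s k) (u k)) \<longlonglongrightarrow> 0" "(\<lambda>k. alg_inner (u k) (s k)) \<longlonglongrightarrow> 0"
proof -
  obtain M where M: "0 < M" "\<And>k. alg_norm (s k) \<le> M"
    using approximates_bounded[OF s] by blast
  have bound: "cmod (alg_inner (s k) (u k)) \<le> norm (alg_norm (u k)) * M" for k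
    using alg_cauchy_schwarz[OF approximatesD(1)[OF s] approximatesD(1)[OF u]]
      mult_right_mono[OF M(2)[of k] alg_norm_nonneg[OF approximatesD(1)[OF u, of k]]]
      alg_norm_nonneg[OF approximatesD(1)[OF u, of k]] order_trans
    by (fastforce simp: mult.commute)
  show "(\<lambda>k. alg_inner (s k) (u k)) \<longlonglongrightarrow> 0"
    by (rule tendsto_0_le[OF approximates_zero[OF u] always_eventually, of _ M]) (simp only: bound simp_thms)
  then have "(\<lambda>k. cnj (alg_inner (s k) (u k))) \<longlonglongrightarrow> 0"
    using tendsto_cnj by fastforce
  then show "(\<lambda>k. alg_inner (u k) (s k)) \<longlonglongrightarrow> 0"
    using alg_inner_commute[OF approximatesD(1)[OF u] approximatesD(1)[OF s]] by simp
qed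

lemma alg_inner_convergent:
  assumes s: "approximates n s f" and t: "approximates n t g"
  shows "convergent (\<lambda>k. alg_inner (s k) (t k))"
proof (rule Cauchy_convergent, rule CauchyI)
  fix e :: real assume e: "0 < e"
  note S = approximatesD(1)[OF s] and T = approximatesD(1)[OF t]
  obtain M L where M: "0 < M" "\<And>k. alg_norm (s k) \<le> M" and L: "0 < L" "\<And>k. alg_norm (t k) \<le> L"
    using approximates_bounded[OF s] approximates_bounded[OF t] by metis
  have eL: "0 < e / (2 * L)" and eM: "0 < e / (2 * M)" using e L(1) M(1) by simp_all
  obtain N where N: "\<And>i j. N \<le> i \<Longrightarrow> N \<le> j \<Longrightarrow> alg_norm (s i - s j) < e / (2 * L)"
    using approximatesD(3)[OF s eL] by blast
  obtain K where K: "\<And>i j. K \<le> i \<Longrightarrow> K \<le> j \<Longrightarrow> alg_norm (t i - t j) < e / (2 * M)"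
    using approximatesD(3)[OF t eM] by blast
  have "norm (alg_inner (s i) (t i) - alg_inner (s j) (t j)) < e" if "max N K \<le> i" "max N K \<le> j" for i j
  proof -
    have "alg_inner (s i) (t i) - alg_inner (s j) (t j) =
        alg_inner (s i) (t i - t j) + alg_inner (s i - s j) (t j)"
      using S T by (simp add: alg_inner_diff_left[of _ n] alg_inner_diff_right[of _ n])
    then have "norm (alg_inner (s i) (t i) - alg_inner (s j) (t j)) \<le>
        cmod (alg_inner (s i) (t i - t j)) + cmod (alg_inner (s i - s j) (t j))"
      by (simp add: norm_triangle_ineq)
    also have "\<dots> \<le> alg_norm (s i) * alg_norm (t i - t j) + alg_norm (s i - s j) * alg_norm (t j)"
      using S T by (intro add_mono alg_cauchy_schwarz[of _ n] alg_tensor_power_diff)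
    also have "\<dots> \<le> M * alg_norm (t i - t j) + alg_norm (s i - s j) * L"
      using M(2) L(2) alg_norm_nonneg[OF alg_tensor_power_diff[OF S S]]
        alg_norm_nonneg[OF alg_tensor_power_diff[OF T T]]
      by (intro add_mono mult_right_mono mult_left_mono)
    also have "\<dots> < M * (e / (2 * M)) + e / (2 * L) * L"
      using N[of i j] K[of i j] that M(1) L(1) by (intro add_strict_mono mult_strict_left_mono mult_strict_right_mono) auto
    also have "\<dots> = e" using M(1) L(1) by simp
    finally show ?thesis .
  qed
  then show "\<exists>N. \<forall>i\<ge>N. \<forall>j\<ge>N. norm (alg_inner (s i) (t i) - alg_inner (s j) (t j)) < e" by blast
qed

text \<open>
  The limit that defines \<open>tensor_inner\<close> exists, and replacing either sequence by another approximation of the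
  same tensor changes the inner products by a null sequence.
\<close>

lemma tensor_inner_tendsto:
  assumes s: "approximates n s f" and t: "approximates n t g"
  shows "(\<lambda>k. alg_inner (s k) (t k)) \<longlonglongrightarrow> tensor_inner n f g"
proof -
  obtain c where c: "(\<lambda>k. alg_inner (s k) (t k)) \<longlonglongrightarrow> c"
    using alg_inner_convergent[OF s t] by (auto simp: convergent_def)
  have all: "(\<lambda>k. alg_inner (s' k) (t' k)) \<longlonglongrightarrow> c"
    if s': "approximates n s' f" and t': "approximates n t' g" for s' t'
  proof -
    have ds: "approximates n (\<lambda>k. s' k - s k) 0" and dt: "approximates n (\<lambda>k. t' k - t k) 0"
      using approximates_diff[OF s' s] approximates_diff[OF t' t] by simp_all
    have "(\<lambda>k. alg_inner (s k) (t k) + alg_inner (s k) (t' k - t k) + alg_inner (s' k - s k) (t' k))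
        \<longlonglongrightarrow> c + 0 + 0"
      by (intro tendsto_add c alg_inner_tendsto_zero(1)[OF s dt] alg_inner_tendsto_zero(2)[OF t' ds])
    moreover have "alg_inner (s k) (t k) + alg_inner (s k) (t' k - t k) + alg_inner (s' k - s k) (t' k)
        = alg_inner (s' k) (t' k)" for k
      using approximatesD(1)[OF s] approximatesD(1)[OF t] approximatesD(1)[OF s'] approximatesD(1)[OF t']
      by (simp add: alg_inner_diff_left[of _ n] alg_inner_diff_right[of _ n])
    ultimately show ?thesis by simp
  qed
  have "tensor_inner n f g = c"
    unfolding tensor_inner_def
    by (rule the_equality) (use all s t c LIMSEQ_unique in blast)+
  then show ?thesis using c by simp
qed

lemma tensor_powerE:
  assumes "f \<in> tensor_power n"
  obtains s where "approximates n s f"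
  using assms by (auto simp: tensor_power_def)

lemma approximates_tensor_power: "approximates n s f \<Longrightarrow> f \<in> tensor_power n"
  by (auto simp: tensor_power_def)

lemma alg_subset_tensor_power: "f \<in> alg_tensor_power n \<Longrightarrow> f \<in> tensor_power n"
  using approximates_const approximates_tensor_power by blast

lemma tensor_power_0: "0 \<in> tensor_power n"
  by (rule alg_subset_tensor_power[OF alg_tensor_power_0])

lemma tensor_power_add: "f \<in> tensor_power n \<Longrightarrow> g \<in> tensor_power n \<Longrightarrow> f + g \<in> tensor_power n"
  by (meson tensor_powerE approximates_add approximates_tensor_power)

lemma tensor_power_smult: "f \<in> tensor_power n \<Longrightarrow> c *\<^sub>F f \<in> tensor_power n"
  by (meson tensor_powerE approximates_smult approximates_tensor_power)

lemma tensor_power_sum: "(\<And>i. i \<in> I \<Longrightarrow> f i \<in> tensor_power n) \<Longrightarrow> (\<Sum>i\<in>I. f i) \<in> tensor_power n"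
  by (induction I rule: infinite_finite_induct) (auto simp: tensor_power_0 tensor_power_add)

lemma tensor_inner_ptensor:
  assumes "length ys = n" "g \<in> tensor_power n"
  shows "tensor_inner n (ptensor ys) g = g ys"
proof -
  obtain t where t: "approximates n t g" using assms(2) by (rule tensor_powerE)
  have "(\<lambda>k. alg_inner (ptensor ys) (t k)) \<longlonglongrightarrow> tensor_inner n (ptensor ys) g"
    by (rule tensor_inner_tendsto[OF approximates_const t]) (use assms in \<open>simp add: alg_tensor_power_ptensor\<close>)
  moreover have "(\<lambda>k. alg_inner (ptensor ys) (t k)) \<longlonglongrightarrow> g ys"
    using approximatesD(2)[OF t] alg_inner_ptensor[OF approximatesD(1)[OF t]] by simp
  ultimately show ?thesis by (rule LIMSEQ_unique)
qed

lemma tensor_inner_zero: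
  assumes "f \<in> tensor_power n"
  shows "tensor_inner n f 0 = 0" "tensor_inner n 0 f = 0"
proof -
  obtain s where s: "approximates n s f" using assms by (rule tensor_powerE)
  have 0: "approximates n (\<lambda>_. 0) 0" by (rule approximates_const[OF alg_tensor_power_0])
  show "tensor_inner n f 0 = 0" "tensor_inner n 0 f = 0"
    using tensor_inner_tendsto[OF s 0] tensor_inner_tendsto[OF 0 s] alg_inner_tendsto_zero[OF s 0]
      LIMSEQ_unique by blast+
qed

section \<open>Creation and contraction operators\<close>

text \<open>
  The adjoint of the creation operator for \<open>\<langle>\<cdot>, \<cdot>\<rangle>\<^sub>0\<close>.
\<close>

definition contract_left :: "'a \<Rightarrow> 'a fock \<Rightarrow> 'a fock" where
  "contract_left x g = (\<lambda>zs. g (x # zs))"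

lemma creation_lin: "creation x (f + g) = creation x f + creation x g"
  "creation x (c *\<^sub>F f) = c *\<^sub>F creation x f" "creation x (f - g) = creation x f - creation x g"
  "creation x 0 = 0"
  by (auto simp: creation_def fun_eq_iff algebra_simps split: list.splits)

lemma contract_left_lin: "contract_left x (f + g) = contract_left x f + contract_left x g"
  "contract_left x (c *\<^sub>F f) = c *\<^sub>F contract_left x f"
  "contract_left x (f - g) = contract_left x f - contract_left x g" "contract_left x 0 = 0"
  by (auto simp: contract_left_def fun_eq_iff)

lemma creation_alg:
  assumes "f \<in> alg_tensor_power n"
  shows "creation x f \<in> alg_tensor_power (Suc n)"
  using assms
proof (induction rule: alg_tensor_power_induct)
  case zero
  show "creation x 0 \<in> alg_tensor_power (Suc n)" by (simp only: creation_lin alg_tensor_power_0)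
next
  case (add c xs g)
  then show "creation x (c *\<^sub>F ptensor xs + g) \<in> alg_tensor_power (Suc n)"
    by (simp add: creation_lin creation_ptensor alg_tensor_power_add alg_tensor_power_smult
        alg_tensor_power_ptensor)
qed

lemma contract_left_alg:
  assumes "g \<in> alg_tensor_power (Suc n)"
  shows "contract_left x g \<in> alg_tensor_power n"
  using assms
proof (induction rule: alg_tensor_power_induct)
  case zero
  show "contract_left x 0 \<in> alg_tensor_power n" by (simp only: contract_left_lin alg_tensor_power_0)
next
  case (add c xs g)
  obtain z zs where xs: "xs = z # zs" "length zs = n" using add(1) by (cases xs) auto
  have "contract_left x (ptensor xs) = cinner x z *\<^sub>F ptensor zs"
    by (simp add: contract_left_def xs(1) ptensor_Cons fun_eq_iff)
  with add xs(2) show "contract_left x (c *\<^sub>F ptensor xs + g) \<in> alg_tensor_power n"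
    by (simp add: contract_left_lin alg_tensor_power_add alg_tensor_power_smult alg_tensor_power_ptensor)
qed

lemma alg_inner_creation:
  assumes "f \<in> alg_tensor_power n" "g \<in> alg_tensor_power (Suc n)"
  shows "alg_inner (creation x f) g = alg_inner f (contract_left x g)"
  using assms(1)
proof (induction rule: alg_tensor_power_induct)
  case zero
  show "alg_inner (creation x 0) g = alg_inner 0 (contract_left x g)"
    using alg_inner_zero_left[OF assms(2)] alg_inner_zero_left[OF contract_left_alg[OF assms(2)]]
    by (simp only: creation_lin)
next
  case (add c xs f)
  note g = contract_left_alg[OF assms(2), of x]
  have "alg_inner (creation x (c *\<^sub>F ptensor xs + f)) g =
      cnj c * alg_inner (ptensor (x # xs)) g + alg_inner (creation x f) g"
    using add assms(2)
    by (simp add: creation_lin creation_ptensor alg_inner_add_left[of _ "Suc n"] creation_alg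
        alg_inner_smult_left[of _ "Suc n"] alg_tensor_power_smult alg_tensor_power_ptensor)
  also have "alg_inner (ptensor (x # xs)) g = alg_inner (ptensor xs) (contract_left x g)"
    using alg_inner_ptensor[OF assms(2)] alg_inner_ptensor[OF g] by (simp add: contract_left_def)
  also have "cnj c * \<dots> + alg_inner (creation x f) g = alg_inner (c *\<^sub>F ptensor xs + f) (contract_left x g)"
    using add g
    by (simp add: alg_inner_add_left[of _ n] alg_inner_smult_left[of _ n] alg_tensor_power_smult
        alg_tensor_power_ptensor)
  finally show ?case .
qed

lemma alg_norm_creation:
  assumes "f \<in> alg_tensor_power n"
  shows "alg_norm (creation x f) = norm x * alg_norm f"
proof (rule power2_eq_imp_eq)
  have "contract_left x (creation x f) = cinner x x *\<^sub>F f"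
    by (simp add: contract_left_def creation_def fun_eq_iff)
  then have "alg_inner (creation x f) (creation x f) = cinner x x * alg_inner f f"
    using assms by (simp add: alg_inner_creation creation_alg alg_inner_smult_right)
  also have "\<dots> = complex_of_real ((norm x * alg_norm f)\<^sup>2)"
    by (simp add: cinner_norm alg_inner_self[OF assms] power_mult_distrib)
  finally show "(alg_norm (creation x f))\<^sup>2 = (norm x * alg_norm f)\<^sup>2"
    using alg_norm_sq[OF creation_alg[OF assms]] by simp
qed (use assms in \<open>simp_all add: alg_norm_nonneg[OF creation_alg] alg_norm_nonneg\<close>)

text \<open>
  As for any adjoint, \<open>\<parallel>h\<parallel>\<^sup>2 = \<langle>x \<otimes> h, g\<rangle>\<close> for the contraction \<open>h\<close> of \<open>g\<close>, and creation multiplies norms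
  by \<open>\<parallel>x\<parallel>\<close>.
\<close>

lemma alg_norm_contract_left:
  assumes "g \<in> alg_tensor_power (Suc n)"
  shows "alg_norm (contract_left x g) \<le> norm x * alg_norm g"
proof -
  let ?h = "contract_left x g"
  note h = contract_left_alg[OF assms, of x]
  have "(alg_norm ?h)\<^sup>2 = Re (alg_inner (creation x ?h) g)"
    using assms h by (simp add: alg_norm_sq alg_inner_creation)
  also have "\<dots> \<le> cmod (alg_inner (creation x ?h) g)" by (rule complex_Re_le_cmod)
  also have "\<dots> \<le> alg_norm (creation x ?h) * alg_norm g"
    using assms by (intro alg_cauchy_schwarz[of _ "Suc n"] creation_alg h)
  finally have "alg_norm ?h * alg_norm ?h \<le> (norm x * alg_norm g) * alg_norm ?h"
    by (simp add: alg_norm_creation[OF h] power2_eq_square mult_ac)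
  then show ?thesis
    using alg_norm_nonneg[OF h] alg_norm_nonneg[OF assms]
    by (cases "alg_norm ?h = 0") (auto simp: mult_le_cancel_right)
qed

lemma approximates_creation:
  assumes "approximates n s f"
  shows "approximates (Suc n) (\<lambda>k. creation x (s k)) (creation x f)"
proof (rule approximates_map[OF assms, where C = "norm x"])
  show "(\<lambda>k. creation x (s k) ys) \<longlonglongrightarrow> creation x f ys" for ys
    using approximatesD(2)[OF assms] by (cases ys) (auto simp: creation_def intro: tendsto_mult)
  show "creation x (f - g) = creation x f - creation x g" for f g by (rule creation_lin)
qed (simp_all only: creation_alg alg_norm_creation order_refl)

lemma approximates_contract_left:
  assumes "approximates (Suc n) s f"
  shows "approximates n (\<lambda>k. contract_left x (s k)) (contract_left x f)"
proof (rule approximates_map[OF assms, where C = "norm x"])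
  show "(\<lambda>k. contract_left x (s k) ys) \<longlonglongrightarrow> contract_left x f ys" for ys
    using approximatesD(2)[OF assms] by (auto simp: contract_left_def)
  show "contract_left x (f - g) = contract_left x f - contract_left x g" for f g
    by (rule contract_left_lin)
qed (simp_all only: contract_left_alg alg_norm_contract_left)

lemma tensor_power_creation: "f \<in> tensor_power n \<Longrightarrow> creation x f \<in> tensor_power (Suc n)"
  by (meson tensor_powerE approximates_creation approximates_tensor_power)

lemma tensor_power_contract_left:
  "f \<in> tensor_power (Suc n) \<Longrightarrow> contract_left x f \<in> tensor_power n"
  by (meson tensor_powerE approximates_contract_left approximates_tensor_power)

lemma tensor_inner_creation:
  assumes "f \<in> tensor_power n" "g \<in> tensor_power (Suc n)"
  shows "tensor_inner (Suc n) (creation x f) g = tensor_inner n f (contract_left x g)"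
proof -
  obtain s t where st: "approximates n s f" "approximates (Suc n) t g"
    using assms by (elim tensor_powerE)
  have "(\<lambda>k. alg_inner (creation x (s k)) (t k)) \<longlonglongrightarrow> tensor_inner (Suc n) (creation x f) g"
    by (intro tensor_inner_tendsto approximates_creation st)
  moreover have "(\<lambda>k. alg_inner (s k) (contract_left x (t k))) \<longlonglongrightarrow> tensor_inner n f (contract_left x g)"
    by (intro tensor_inner_tendsto approximates_contract_left st)
  moreover have "alg_inner (creation x (s k)) (t k) = alg_inner (s k) (contract_left x (t k))" for k
    by (rule alg_inner_creation[OF approximatesD(1)[OF st(1)] approximatesD(1)[OF st(2)]])
  ultimately show ?thesis using LIMSEQ_unique by (simp only:)
qed

section \<open>Unitarity of the group action\<close>

lemma group_act_lin: "group_act bar \<sigma> (f + g) = group_act bar \<sigma> f + group_act bar \<sigma> g"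
  "group_act bar \<sigma> (c *\<^sub>F f) = c *\<^sub>F group_act bar \<sigma> f"
  "group_act bar \<sigma> (f - g) = group_act bar \<sigma> f - group_act bar \<sigma> g" "group_act bar \<sigma> 0 = 0"
  by (auto simp: group_act_def fun_eq_iff)

lemma group_act_alg:
  assumes bar: "selfadjoint_involution bar" and \<sigma>: "\<sigma> \<in> signed_perms n"
    and "f \<in> alg_tensor_power n"
  shows "group_act bar \<sigma> f \<in> alg_tensor_power n"
  using assms(3)
proof (induction rule: alg_tensor_power_induct)
  case zero
  show "group_act bar \<sigma> 0 \<in> alg_tensor_power n" by (simp only: group_act_lin alg_tensor_power_0)
next
  case (add c xs g)
  then show "group_act bar \<sigma> (c *\<^sub>F ptensor xs + g) \<in> alg_tensor_power n"
    using group_act_ptensor[OF bar, of \<sigma> xs] \<sigma>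
    by (simp add: group_act_lin alg_tensor_power_add alg_tensor_power_smult alg_tensor_power_ptensor)
qed

lemma alg_inner_group_act:
  assumes bar: "selfadjoint_involution bar" and \<sigma>: "\<sigma> \<in> signed_perms n"
    and "f \<in> alg_tensor_power n" and h: "h \<in> alg_tensor_power n"
  shows "alg_inner (group_act bar \<sigma> f) h = alg_inner f (group_act bar (inv_into UNIV \<sigma>) h)"
  using assms(3)
proof (induction rule: alg_tensor_power_induct)
  case zero
  note h' = group_act_alg[OF bar signed_perms_inv[OF \<sigma>] h]
  show "alg_inner (group_act bar \<sigma> 0) h = alg_inner 0 (group_act bar (inv_into UNIV \<sigma>) h)"
    using alg_inner_zero_left[OF h] alg_inner_zero_left[OF h'] by (simp only: group_act_lin)
next
  case (add c xs f)
  note h' = group_act_alg[OF bar signed_perms_inv[OF \<sigma>] h]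
  have p: "group_act bar \<sigma> (ptensor xs) = ptensor (signed_permute bar \<sigma> xs)"
    using group_act_ptensor[OF bar, of \<sigma> xs] \<sigma> add(1) by simp
  have "alg_inner (group_act bar \<sigma> (c *\<^sub>F ptensor xs + f)) h =
      cnj c * alg_inner (ptensor (signed_permute bar \<sigma> xs)) h + alg_inner (group_act bar \<sigma> f) h"
    using add h
    by (simp add: group_act_lin p alg_inner_add_left[of _ n] group_act_alg[OF bar \<sigma>]
        alg_inner_smult_left[of _ n] alg_tensor_power_smult alg_tensor_power_ptensor)
  also have "alg_inner (ptensor (signed_permute bar \<sigma> xs)) h =
      alg_inner (ptensor xs) (group_act bar (inv_into UNIV \<sigma>) h)"
    using alg_inner_ptensor[OF h] alg_inner_ptensor[OF h'] B_groupD(4)[OF \<sigma>]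
    by (simp add: group_act_def)
  also have "cnj c * \<dots> + alg_inner (group_act bar \<sigma> f) h =
      alg_inner (c *\<^sub>F ptensor xs + f) (group_act bar (inv_into UNIV \<sigma>) h)"
    using add h'
    by (simp add: alg_inner_add_left[of _ n] alg_inner_smult_left[of _ n] alg_tensor_power_smult
        alg_tensor_power_ptensor)
  finally show ?case .
qed

lemma group_act_id: "group_act bar id f = f"
proof
  fix ys
  have "signed_permute bar id ys = ys"
    by (rule nth_equalityI) (simp_all add: nth_signed_permute signed_nth_def nat_add_distrib)
  then show "group_act bar id f ys = f ys" by (simp add: group_act_def)
qed

lemma alg_norm_group_act:
  assumes bar: "selfadjoint_involution bar" and \<sigma>: "\<sigma> \<in> signed_perms n"
    and f: "f \<in> alg_tensor_power n"
  shows "alg_norm (group_act bar \<sigma> f) = alg_norm f"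
proof -
  have "inv_into UNIV \<sigma> \<circ> \<sigma> = id"
    using permutes_inv_o[OF B_groupD(1)[OF \<sigma>]] by simp
  then have "group_act bar (inv_into UNIV \<sigma>) (group_act bar \<sigma> f) = f"
    using group_act_comp[OF bar signed_perms_inv[OF \<sigma>] \<sigma> alg_subset_tensor_power[OF f]]
    by (simp only: group_act_id)
  then show ?thesis
    using alg_inner_group_act[OF bar \<sigma> f group_act_alg[OF bar \<sigma> f]] by (simp add: alg_norm_def)
qed

lemma tensor_power_group_act:
  assumes bar: "selfadjoint_involution bar" and \<sigma>: "\<sigma> \<in> signed_perms n"
    and "f \<in> tensor_power n"
  shows "group_act bar \<sigma> f \<in> tensor_power n"
proof -
  obtain s where s: "approximates n s f" using assms(3) by (rule tensor_powerE)
  have "approximates n (\<lambda>k. group_act bar \<sigma> (s k)) (group_act bar \<sigma> f)"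
  proof (rule approximates_map[OF s, where C = 1])
    show "(\<lambda>k. group_act bar \<sigma> (s k) ys) \<longlonglongrightarrow> group_act bar \<sigma> f ys" for ys
      using approximatesD(2)[OF s] by (simp add: group_act_def)
    show "group_act bar \<sigma> (f - g) = group_act bar \<sigma> f - group_act bar \<sigma> g" for f g
      by (rule group_act_lin)
  qed (simp_all only: group_act_alg[OF bar \<sigma>] alg_norm_group_act[OF bar \<sigma>] mult_1_left order_refl)
  then show ?thesis by (rule approximates_tensor_power)
qed

section \<open>Injectivity of the symmetrization operator\<close>

lemma P_level_apply:
  "P_level bar q n f ys = (\<Sum>\<sigma>\<in>D_group n. complex_of_real (q ^ inv_number n \<sigma>) * group_act bar \<sigma> f ys)"
  by (simp add: P_level_def sum_fun_apply D_length_eq)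

lemma tensor_power_P_level:
  assumes "selfadjoint_involution bar" "f \<in> tensor_power n"
  shows "P_level bar q n f \<in> tensor_power n"
  unfolding P_level_def
  by (intro tensor_power_sum tensor_power_smult tensor_power_group_act assms D_group_subset_B)

text \<open>
  Along the orbit of a list, \<open>P h\<close> is obtained from \<open>h\<close> by the matrix with entries \<open>q\<close> to the power
  \<open>length(\<tau>\<^sup>-\<^sup>1 \<rho>)\<close>, which is nonsingular by the symmetric difference formula for lengths and \<open>sym_diff_kernel\<close>.
\<close>

lemma P_level_kernel:
  assumes bar: "selfadjoint_involution bar" and q: "\<bar>q\<bar> < 1" and h: "h \<in> tensor_power n"
    and 0: "P_level bar q n h = 0"
  shows "h = 0"
proof
  fix ys
  define v where "v \<sigma> = group_act bar \<sigma> h ys" for \<sigma>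
  let ?inv = "inv_into UNIV :: (int \<Rightarrow> int) \<Rightarrow> _"
  have inv_inv: "?inv (?inv \<sigma>) = \<sigma>" if "\<sigma> \<in> D_group n" for \<sigma>
    using B_groupD(4)[OF D_group_subset_B[OF that]] .
  have "(\<Sum>\<rho>\<in>D_group n. complex_of_real (q ^ card (sym_diff (inversions n (?inv \<tau>)) (inversions n (?inv \<rho>)))) * v \<rho>) = 0"
    if \<tau>: "\<tau> \<in> D_group n" for \<tau>
  proof -
    note T = D_group_subset_B[OF \<tau>]
    have c: "\<tau> \<circ> (?inv \<tau> \<circ> \<rho>) = \<rho>" "?inv \<tau> \<circ> (\<tau> \<circ> \<rho>) = \<rho>" for \<rho>
      using signed_perms_inv_comp[OF T] by (simp_all add: o_assoc)
    have "0 = P_level bar q n h (signed_permute bar (?inv \<tau>) ys)"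
      by (simp add: 0)
    also have "\<dots> = (\<Sum>\<sigma>\<in>D_group n. complex_of_real (q ^ inv_number n \<sigma>) * v (\<tau> \<circ> \<sigma>))"
      unfolding P_level_apply
    proof (intro sum.cong refl)
      fix \<sigma> assume "\<sigma> \<in> D_group n"
      then have "v (\<tau> \<circ> \<sigma>) = group_act bar \<tau> (group_act bar \<sigma> h) ys"
        unfolding v_def using group_act_comp[OF bar T D_group_subset_B h] by simp
      then show "complex_of_real (q ^ inv_number n \<sigma>) * group_act bar \<sigma> h (signed_permute bar (?inv \<tau>) ys) =
          complex_of_real (q ^ inv_number n \<sigma>) * v (\<tau> \<circ> \<sigma>)"
        by (simp add: group_act_def)
    qed
    also have "\<dots> = (\<Sum>\<rho>\<in>D_group n. complex_of_real (q ^ inv_number n (?inv \<tau> \<circ> \<rho>)) * v \<rho>)"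
      by (rule sum.reindex_bij_witness[of _ "\<lambda>\<rho>. ?inv \<tau> \<circ> \<rho>" "\<lambda>\<sigma>. \<tau> \<circ> \<sigma>"])
        (simp_all only: c D_comp D_inv \<tau>)
    also have "\<dots> = (\<Sum>\<rho>\<in>D_group n. complex_of_real
        (q ^ card (sym_diff (inversions n (?inv \<tau>)) (inversions n (?inv \<rho>)))) * v \<rho>)"
    proof (intro sum.cong refl)
      fix \<rho> assume \<rho>: "\<rho> \<in> D_group n"
      have "inv_number n (?inv \<tau> \<circ> \<rho>) = card (sym_diff (inversions n (?inv \<tau>)) (inversions n (?inv \<rho>)))"
        using inv_number_eq_sym_diff[OF signed_perms_inv[OF T] signed_perms_inv[OF D_group_subset_B[OF \<rho>]]]
        unfolding inv_inv[OF \<rho>] .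
      then show "complex_of_real (q ^ inv_number n (?inv \<tau> \<circ> \<rho>)) * v \<rho> = complex_of_real
          (q ^ card (sym_diff (inversions n (?inv \<tau>)) (inversions n (?inv \<rho>)))) * v \<rho>"
        by (simp only:)
    qed
    finally show ?thesis by simp
  qed
  moreover have "id \<in> D_group n" by (simp add: D_group_eq signed_perms_id sign_prod_def)
  moreover have "inj_on (\<lambda>\<sigma>. inversions n (?inv \<sigma>)) (D_group n)"
  proof (rule inj_onI)
    fix \<sigma> \<tau> assume st: "\<sigma> \<in> D_group n" "\<tau> \<in> D_group n"
      and eq: "inversions n (?inv \<sigma>) = inversions n (?inv \<tau>)"
    have "?inv \<sigma> = ?inv \<tau>"
      by (rule inj_onD[OF inversions_inj_on_D eq D_inv[OF st(1)] D_inv[OF st(2)]])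
    from arg_cong[OF this, of ?inv] show "\<sigma> = \<tau>"
      unfolding inv_inv[OF st(1)] inv_inv[OF st(2)] .
  qed
  moreover have "(\<lambda>\<sigma>. inversions n (?inv \<sigma>)) ` D_group n \<subseteq> Pow (pos_roots n)"
    by (auto simp: inversions_def)
  ultimately have "v id = 0"
    using sym_diff_kernel[OF finite_pos_roots q, of "\<lambda>\<sigma>. inversions n (?inv \<sigma>)" "D_group n" n v id]
    by blast
  then show "h ys = 0 ys" by (simp add: v_def group_act_id)
qed

section \<open>An explicit formula for the annihilation operator\<close>

text \<open>
  For \<open>g = x\<^sub>0 \<otimes> \<dots> \<otimes> x\<^sub>n\<close> with \<open>n \<ge> 1\<close> this is \<open>\<Sum>\<^sub>i q\<^sup>i \<langle>x, x\<^sub>i\<rangle>\<close> times the tensor with \<open>x\<^sub>i\<close> removed, plus the sum of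
  \<open>q\<close> to the power \<open>2n - i\<close> times \<open>\<langle>x, bar x\<^sub>i\<rangle>\<close> times the same tensor with \<open>bar\<close> applied to its last remaining
  factor.
\<close>

definition twisted_contraction :: "('a \<Rightarrow> 'a) \<Rightarrow> real \<Rightarrow> 'a \<Rightarrow> 'a fock \<Rightarrow> 'a fock" where
  "twisted_contraction bar q x g = (\<lambda>zs.
     (\<Sum>i\<le>length zs. complex_of_real (q ^ i) * g (insert_at i x zs)) +
     (if zs = [] then 0 else
       \<Sum>i\<le>length zs. complex_of_real (q ^ (2 * length zs - i)) * g (insert_at i (bar x) (map_last bar zs))))"

lemma P_level_even_words:
  assumes "length ys = n"
  shows "P_level bar q n f ys =
    (\<Sum>w\<in>even_words n. complex_of_real (q ^ word_inv w) * f (arrange bar ys w))"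
proof -
  have "P_level bar q n f ys = (\<Sum>\<sigma>\<in>D_group n.
      complex_of_real (q ^ word_inv (window n \<sigma>)) * f (arrange bar ys (window n \<sigma>)))"
    unfolding P_level_apply
    by (intro sum.cong refl)
      (simp add: inv_number_eq_word_inv D_group_subset_B group_act_def signed_permute_inv[OF _ assms])
  also have "\<dots> = (\<Sum>w\<in>even_words n. complex_of_real (q ^ word_inv w) * f (arrange bar ys w))"
    by (rule sum.reindex_bij_betw[OF bij_betw_window])
  finally show ?thesis .
qed

lemma arrange_insert_at:
  assumes "0 \<notin> set w" "\<bar>s\<bar> = 1"
  shows "arrange bar (x # zs) (insert_at i s (map shift w)) =
    insert_at i (if s = 1 then x else bar x) (arrange bar zs w)"
proof -
  have "signed_nth bar (x # zs) (shift a) = signed_nth bar zs a" if "a \<in> set w" for a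
  proof -
    have "a \<noteq> 0" using that assms(1) by auto
    then consider "0 < a" "0 < shift a" "nat (shift a) - 1 = Suc (nat a - 1)"
      | "\<not> 0 < a" "\<not> 0 < shift a" "nat (- shift a) - 1 = Suc (nat (- a) - 1)"
      by (cases "0 < a") (auto simp: shift_def)
    then show ?thesis by cases (simp_all only: signed_nth_def if_True if_False nth_Cons_Suc)
  qed
  then have "map (signed_nth bar (x # zs)) (map shift w) = map (signed_nth bar zs) w"
    by simp
  moreover have "signed_nth bar (x # zs) s = (if s = 1 then x else bar x)"
    using assms(2) by (auto simp: signed_nth_def abs_if split: if_splits)
  ultimately show ?thesis by (simp only: arrange_def map_insert_at)
qed

lemma arrange_map_last:
  assumes bar: "selfadjoint_involution bar" and "0 \<notin> set w"
  shows "arrange bar zs (map_last uminus w) = map_last bar (arrange bar zs w)"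
  unfolding arrange_def
proof (rule map_map_last)
  fix a assume "a \<in> set w"
  then have "a \<noteq> 0" using assms(2) by auto
  then show "signed_nth bar zs (- a) = bar (signed_nth bar zs a)"
    using bar by (auto simp: signed_nth_def selfadjoint_involution_def)
qed

text \<open>
  The sum over \<open>D(n + 1)\<close> on the left is split by the position and sign of the letter that carries \<open>x\<close>.
\<close>

lemma contract_left_P_level:
  assumes bar: "selfadjoint_involution bar" and "length zs = n"
  shows "P_level bar q (Suc n) g (x # zs) = P_level bar q n (twisted_contraction bar q x g) zs"
proof -
  have "P_level bar q (Suc n) g (x # zs) =
      (\<Sum>w\<in>even_words (Suc n). complex_of_real (q ^ word_inv w) * g (arrange bar (x # zs) w))"
    using assms(2) by (intro P_level_even_words) simp
  also have "\<dots> = (\<Sum>w\<in>even_words n. complex_of_real (q ^ word_inv w) *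
      twisted_contraction bar q x g (arrange bar zs w))"
    unfolding even_words_Suc
  proof (rule sum.cong[OF refl])
    fix w assume "w \<in> even_words n"
    then have w: "w \<in> signed_words n" by (simp add: even_words_def)
    then have len: "length w = n" and nz: "0 \<notin> set w"
      using signed_words_nz by (auto simp: signed_words_def)
    have nz': "0 \<notin> set (map_last uminus w)"
      using signed_words_nz[OF map_last_in_signed_words[OF w]] by auto
    have big: "2 \<le> \<bar>a\<bar>" if "a \<in> set (map shift u)" "0 \<notin> set u" for a u
      using that shift_simps(1) by (auto simp: image_iff) metis
    have pos: "complex_of_real (q ^ word_inv (insert_at i 1 (map shift w))) *
        g (arrange bar (x # zs) (insert_at i 1 (map shift w))) =
        complex_of_real (q ^ word_inv w) * (complex_of_real (q ^ i) * g (insert_at i x (arrange bar zs w)))"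
      if "i \<le> n" for i
    proof -
      have "word_inv (insert_at i 1 (map shift w)) = word_inv w + i"
        using word_inv_insert_at(1)[of "map shift w" i] big[OF _ nz] that len word_inv_map_shift[OF nz]
        by simp
      then show ?thesis by (simp add: arrange_insert_at[OF nz] power_add)
    qed
    have neg: "complex_of_real (q ^ word_inv (insert_at i (- 1) (map shift (map_last uminus w)))) *
        g (arrange bar (x # zs) (insert_at i (- 1) (map shift (map_last uminus w)))) =
        complex_of_real (q ^ word_inv w) * (complex_of_real (q ^ (2 * n - i)) *
          g (insert_at i (bar x) (map_last bar (arrange bar zs w))))"
      if "i \<le> n" for i
    proof -
      have "word_inv (insert_at i (- 1) (map shift (map_last uminus w))) = word_inv w + (2 * n - i)"
        using word_inv_insert_at(2)[of "map shift (map_last uminus w)" i] big[OF _ nz'] that len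
          word_inv_map_shift[OF nz'] word_inv_map_last[of w]
        by simp
      then show ?thesis by (simp add: arrange_insert_at[OF nz'] arrange_map_last[OF bar nz] power_add)
    qed
    show "(\<Sum>i\<le>n. complex_of_real (q ^ word_inv (insert_at i 1 (map shift w))) *
            g (arrange bar (x # zs) (insert_at i 1 (map shift w)))) +
        (if n = 0 then 0 else \<Sum>i\<le>n.
            complex_of_real (q ^ word_inv (insert_at i (- 1) (map shift (map_last uminus w)))) *
            g (arrange bar (x # zs) (insert_at i (- 1) (map shift (map_last uminus w))))) =
        complex_of_real (q ^ word_inv w) * twisted_contraction bar q x g (arrange bar zs w)"
    proof -
      have "arrange bar zs w = [] \<longleftrightarrow> n = 0" using len by (auto simp: arrange_def)
      then show ?thesis
        by (simp add: twisted_contraction_def len pos neg sum_distrib_left distrib_left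
            del: of_real_power)
    qed
  qed
  also have "\<dots> = P_level bar q n (twisted_contraction bar q x g) zs"
    using assms(2) by (rule P_level_even_words[symmetric])
  finally show ?thesis .
qed

text \<open>
  Each summand of \<open>twisted_contraction\<close> is the contraction of a unitarily transformed \<open>g\<close>, hence again
  in the completion.
\<close>

lemma arrange_in_tensor_power:
  assumes bar: "selfadjoint_involution bar" and g: "g \<in> tensor_power (Suc n)"
    and w: "w \<in> signed_words (Suc n)"
  shows "(\<lambda>zs. if length zs = n then g (arrange bar (x # zs) w) else 0) \<in> tensor_power n"
proof -
  let ?s = "of_window w"
  note s = of_window_in_B[OF w]
  have lw: "length w = Suc n" using w by (simp add: signed_words_def)
  have "contract_left x (group_act bar ?s g) zs =
      (if length zs = n then g (arrange bar (x # zs) w) else 0)" for zs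
    using tensor_power_eq_0[OF g] signed_permute_inv[OF s, of "x # zs"] window_of_window[OF lw]
    by (simp add: contract_left_def group_act_def)
  then have "contract_left x (group_act bar ?s g) =
      (\<lambda>zs. if length zs = n then g (arrange bar (x # zs) w) else 0)"
    by (rule ext)
  then show ?thesis
    using tensor_power_contract_left[OF tensor_power_group_act[OF bar s g], of x] by (simp only:)
qed

lemma tensor_power_twisted_contraction:
  assumes bar: "selfadjoint_involution bar" and g: "g \<in> tensor_power (Suc n)"
  shows "twisted_contraction bar q x g \<in> tensor_power n"
proof -
  \<comment> \<open>the identity word, so that only the insertion rearranges the list\<close>
  let ?u = "[1..int n]"
  have u: "?u \<in> signed_words n" using window_in_signed_words[OF signed_perms_id, of n] by (simp add: window_def)
  note v = map_last_in_signed_words[OF u]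
  have nz: "0 \<notin> set ?u" "0 \<notin> set (map_last uminus ?u)"
    using signed_words_nz[OF u] signed_words_nz[OF v] by auto
  define p where "p i = (\<lambda>zs. if length zs = n then g (arrange bar (x # zs) (insert_at i 1 (map shift ?u))) else 0)" for i
  define m where "m i = (\<lambda>zs. if length zs = n then g (arrange bar (x # zs) (insert_at i (- 1) (map shift (map_last uminus ?u)))) else 0)" for i
  have pm: "p i \<in> tensor_power n" "m i \<in> tensor_power n" for i
    unfolding p_def m_def using u v
    by (auto intro!: arrange_in_tensor_power[OF bar g] insert_at_in_signed_words)
  have id: "arrange bar zs ?u = zs" if "length zs = n" for zs
    by (rule nth_equalityI) (use that in \<open>auto simp: arrange_def signed_nth_def nth_upto nat_add_distrib\<close>)
  have "twisted_contraction bar q x g = (\<Sum>i\<le>n. complex_of_real (q ^ i) *\<^sub>F p i) +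
      (if n = 0 then 0 else \<Sum>i\<le>n. complex_of_real (q ^ (2 * n - i)) *\<^sub>F m i)" (is "_ = ?R")
  proof
    fix zs
    show "twisted_contraction bar q x g zs = ?R zs"
    proof (cases "length zs = n")
      case True
      then show ?thesis
        by (auto simp: twisted_contraction_def p_def m_def sum_fun_apply arrange_insert_at[OF nz(1)]
            arrange_insert_at[OF nz(2)] arrange_map_last[OF bar nz(1)] id simp del: of_real_power)
    next
      case False
      then show ?thesis
        using tensor_power_eq_0[OF g]
        by (simp add: twisted_contraction_def p_def m_def sum_fun_apply)
    qed
  qed
  then show ?thesis
    by (simp only:) (intro tensor_power_add tensor_power_sum tensor_power_smult pm,
        simp add: tensor_power_0 tensor_power_sum tensor_power_smult pm)
qed

section \<open>Characterization of the adjoint\<close>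

lemma fock_component_apply: "fock_component n f ys = (if length ys = n then f ys else 0)"
  by (simp add: fock_component_def)

lemma fock_component_tensor_power:
  assumes "f \<in> tensor_power n"
  shows "fock_component k f = (if k = n then f else 0)"
  using tensor_power_eq_0[OF assms] by (auto simp: fun_eq_iff fock_component_apply)

lemma tensor_power_subset_fock_fin: "f \<in> tensor_power n \<Longrightarrow> f \<in> fock_fin"
  by (simp add: fock_fin_def fock_component_tensor_power tensor_power_0)

lemma fock_component_mem: "f \<in> fock_fin \<Longrightarrow> fock_component n f \<in> tensor_power n"
  by (simp add: fock_fin_def)

lemma P_level_off_degree:
  assumes "\<And>ys. length ys \<noteq> n \<Longrightarrow> f ys = 0" "length ys \<noteq> n"
  shows "P_level bar q n f ys = 0"
  using assms by (simp add: P_level_apply group_act_def)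

lemma fock_component_P_op:
  "fock_component n (P_op bar q f) = P_level bar q n (fock_component n f)"
proof
  fix ys
  show "fock_component n (P_op bar q f) ys = P_level bar q n (fock_component n f) ys"
  proof (cases "length ys = n")
    case False
    then show ?thesis
      using P_level_off_degree[of n "fock_component n f" ys] by (simp add: fock_component_apply)
  qed (auto simp: fock_component_apply P_op_def)
qed

lemma P_level_lin: "P_level bar q n 0 = 0" "P_level bar q n (f - g) = P_level bar q n f - P_level bar q n g"
  by (simp_all add: fun_eq_iff P_level_apply group_act_def right_diff_distrib sum_subtractf)

lemma inner0_single:
  assumes "\<And>k. k \<noteq> n \<Longrightarrow> fock_component k f = 0 \<or> fock_component k g = 0"
    and "fock_component n f \<in> tensor_power n" "fock_component n g \<in> tensor_power n"
  shows "inner0 f g = tensor_inner n (fock_component n f) (fock_component n g)"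
proof (cases "fock_component n f = 0 \<or> fock_component n g = 0")
  case True
  then have "\<not> (fock_component k f \<noteq> 0 \<and> fock_component k g \<noteq> 0)" for k
    using assms(1)[of k] by (cases "k = n") auto
  then have "{k. fock_component k f \<noteq> 0 \<and> fock_component k g \<noteq> 0} = {}"
    by (simp only: Collect_empty_eq) simp
  then have "inner0 f g = 0" unfolding inner0_def by (simp only: sum.empty)
  with True show ?thesis
    using tensor_inner_zero[OF assms(2)] tensor_inner_zero[OF assms(3)] by auto
next
  case False
  then have "(fock_component k f \<noteq> 0 \<and> fock_component k g \<noteq> 0) = (k = n)" for k
    using assms(1)[of k] by (cases "k = n") auto
  then have "{k. fock_component k f \<noteq> 0 \<and> fock_component k g \<noteq> 0} = {n}"
    by (simp only: singleton_conv)
  then show ?thesis unfolding inner0_def by simp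
qed

lemma inner_q_homogeneous:
  assumes bar: "selfadjoint_involution bar" and f: "fock_component n f \<in> tensor_power n"
    and h: "h \<in> tensor_power n"
  shows "inner_q bar q f h = tensor_inner n (fock_component n f) (P_level bar q n h)"
proof -
  have comp: "fock_component k (P_op bar q h) = (if k = n then P_level bar q n h else 0)" for k
    unfolding fock_component_P_op fock_component_tensor_power[OF h] by (simp add: P_level_lin)
  show ?thesis
    unfolding inner_q_def
    using inner0_single[of n f "P_op bar q h"] f tensor_power_P_level[OF bar h]
    by (simp add: comp)
qed

lemma inner_q_ptensor:
  assumes bar: "selfadjoint_involution bar" and h: "h \<in> fock_fin"
  shows "inner_q bar q (ptensor ys) h = P_level bar q (length ys) (fock_component (length ys) h) ys"
proof -
  have p: "ptensor ys \<in> tensor_power (length ys)"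
    by (intro alg_subset_tensor_power alg_tensor_power_ptensor refl)
  note Ph = tensor_power_P_level[OF bar fock_component_mem[OF h, of "length ys"], of q]
  have "inner_q bar q (ptensor ys) h =
      tensor_inner (length ys) (fock_component (length ys) (ptensor ys)) (fock_component (length ys) (P_op bar q h))"
    unfolding inner_q_def
    by (rule inner0_single) (simp_all add: fock_component_tensor_power[OF p] fock_component_P_op p Ph)
  also have "\<dots> = P_level bar q (length ys) (fock_component (length ys) h) ys"
    using tensor_inner_ptensor[OF refl Ph] by (simp add: fock_component_tensor_power[OF p] fock_component_P_op)
  finally show ?thesis .
qed

text \<open>
  Testing against simple tensors recovers the values of \<open>P h\<close>, so injectivity of \<open>P\<close> suffices.
\<close>

lemma inner_q_nondegenerate:
  fixes h h' :: "'a::complex_hilbert_space fock"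
  assumes bar: "selfadjoint_involution bar" and q: "\<bar>q\<bar> < 1"
    and h: "h \<in> fock_fin" "h' \<in> fock_fin"
    and eq: "\<And>f. f \<in> fock_fin \<Longrightarrow> inner_q bar q f h = inner_q bar q f h'"
  shows "h = h'"
proof
  fix ys :: "'a list"
  let ?n = "length ys"
  let ?d = "fock_component ?n h - fock_component ?n h'"
  have d: "?d \<in> tensor_power ?n"
    unfolding fock_diff_eq by (intro tensor_power_add tensor_power_smult fock_component_mem h)
  have "P_level bar q ?n ?d = 0"
  proof
    fix zs
    show "P_level bar q ?n ?d zs = 0 zs"
    proof (cases "length zs = ?n")
      case True
      have "ptensor zs \<in> fock_fin"
        by (rule tensor_power_subset_fock_fin[OF alg_subset_tensor_power[OF alg_tensor_power_ptensor[OF refl]]])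
      from eq[OF this] show ?thesis
        unfolding inner_q_ptensor[OF bar h(1)] inner_q_ptensor[OF bar h(2)] True
        by (simp add: P_level_lin)
    next
      case False
      then show ?thesis
        using tensor_power_eq_0[OF tensor_power_P_level[OF bar d]] by simp
    qed
  qed
  then have "?d = 0" by (rule P_level_kernel[OF bar q d])
  then have "?d ys = 0" by simp
  then show "h ys = h' ys" by (simp add: fock_component_apply)
qed

lemma annihilation_eqI:
  assumes "selfadjoint_involution bar" "\<bar>q\<bar> < 1" "h \<in> fock_fin"
    and "\<And>f. f \<in> fock_fin \<Longrightarrow> inner_q bar q f h = inner_q bar q (creation x f) g"
  shows "annihilation bar q x g = h"
  unfolding annihilation_def
  by (rule the_equality) (use assms inner_q_nondegenerate[OF assms(1,2)] in auto)

lemma fock_component_creation: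
  "fock_component (Suc n) (creation x f) = creation x (fock_component n f)"
  "fock_component 0 (creation x f) = 0"
  by (auto simp: fun_eq_iff fock_component_apply creation_def split: list.splits)

lemma annihilation_eq_twisted_contraction:
  assumes bar: "selfadjoint_involution bar" and q: "\<bar>q\<bar> < 1" and g: "g \<in> tensor_power (Suc n)"
  shows "annihilation bar q x g = twisted_contraction bar q x g"
proof (rule annihilation_eqI[OF bar q])
  let ?h = "twisted_contraction bar q x g"
  note h = tensor_power_twisted_contraction[OF bar g, of q x]
  show "?h \<in> fock_fin" by (rule tensor_power_subset_fock_fin[OF h])
  fix f :: "'a fock" assume f: "f \<in> fock_fin"
  note fn = fock_component_mem[OF f, of n]
  have Pg: "contract_left x (P_level bar q (Suc n) g) = P_level bar q n ?h"
  proof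
    fix zs
    show "contract_left x (P_level bar q (Suc n) g) zs = P_level bar q n ?h zs"
    proof (cases "length zs = n")
      case True
      then show ?thesis using contract_left_P_level[OF bar True] by (simp add: contract_left_def)
    next
      case False
      then show ?thesis
        using tensor_power_eq_0[OF tensor_power_P_level[OF bar h]]
          tensor_power_eq_0[OF tensor_power_P_level[OF bar g]]
        by (simp add: contract_left_def)
    qed
  qed
  have "inner_q bar q (creation x f) g =
      tensor_inner (Suc n) (creation x (fock_component n f)) (P_level bar q (Suc n) g)"
    using inner_q_homogeneous[OF bar _ g, of "creation x f"] tensor_power_creation[OF fn]
    by (simp only: fock_component_creation)
  also have "\<dots> = tensor_inner n (fock_component n f) (P_level bar q n ?h)"
    unfolding tensor_inner_creation[OF fn tensor_power_P_level[OF bar g]] Pg ..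
  also have "\<dots> = inner_q bar q f ?h"
    by (rule inner_q_homogeneous[OF bar fn h, symmetric])
  finally show "inner_q bar q f ?h = inner_q bar q (creation x f) g" ..
qed

lemma annihilation_scalar:
  assumes bar: "selfadjoint_involution bar" and q: "\<bar>q\<bar> < 1" and g: "g \<in> tensor_power 0"
  shows "annihilation bar q x g = 0"
proof (rule annihilation_eqI[OF bar q])
  show "0 \<in> (fock_fin :: 'a fock set)" by (rule tensor_power_subset_fock_fin[OF tensor_power_0])
  fix f :: "'a fock" assume f: "f \<in> fock_fin"
  note Pg = tensor_power_P_level[OF bar g, of q]
  have "inner_q bar q (creation x f) g = tensor_inner 0 0 (P_level bar q 0 g)"
    using inner_q_homogeneous[OF bar _ g, of "creation x f"] tensor_power_0[of 0]
    by (simp only: fock_component_creation)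
  also have "\<dots> = 0" by (rule tensor_inner_zero[OF Pg])
  finally show "inner_q bar q f 0 = inner_q bar q (creation x f) g"
    using inner_q_homogeneous[OF bar fock_component_mem[OF f] tensor_power_0, where n = 0 and q = q]
      tensor_inner_zero(1)[OF fock_component_mem[OF f, of 0]]
    by (simp only: P_level_lin)
qed

section \<open>The commutation relation\<close>

lemma insert_at_0: "insert_at 0 x w = x # w"
  by (simp add: insert_at_def)

lemma insert_at_Suc: "insert_at (Suc i) x (z # w) = z # insert_at i x w"
  by (simp add: insert_at_def)

lemma map_last_Cons: "w \<noteq> [] \<Longrightarrow> map_last g (z # w) = z # map_last g w"
  by (simp add: map_last_def)

lemma creation_Cons: "creation x f (z # zs) = cinner z x * f zs"
  by (simp add: creation_def)

lemma J_op_eq_map_last: "zs \<noteq> [] \<Longrightarrow> J_op bar f zs = f (map_last bar zs)"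
  by (simp add: J_op_def map_last_def)

text \<open>
  The insertion at the front meets \<open>y\<close>. Every other insertion leaves \<open>z\<close> paired with \<open>y\<close>, loses one power
  of \<open>q\<close>, and is an insertion into \<open>us\<close>. Nonemptiness of \<open>us\<close> ensures that flipping the last factor of
  \<open>z # us\<close> does not touch \<open>z\<close>.
\<close>

lemma twisted_contraction_creation:
  assumes "us \<noteq> []"
  shows "twisted_contraction bar q x (creation y f) (z # us) =
    cinner x y * f (z # us) + cinner (bar x) y * complex_of_real (q ^ (2 * length (z # us))) * f (map_last bar (z # us))
    + complex_of_real q * (cinner z y * twisted_contraction bar q x f us)"
proof -
  let ?m = "length us"
  have exp: "q ^ (2 * Suc ?m - Suc i) = q * q ^ (2 * ?m - i)" if "i \<le> ?m" for i
  proof -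
    have "2 * Suc ?m - Suc i = Suc (2 * ?m - i)" using that by simp
    then show ?thesis by simp
  qed
  have "(\<Sum>i\<le>?m. complex_of_real (q ^ (2 * Suc ?m - Suc i)) *
        (cinner z y * f (insert_at i (bar x) (map_last bar us)))) =
      complex_of_real q * (cinner z y *
        (\<Sum>i\<le>?m. complex_of_real (q ^ (2 * ?m - i)) * f (insert_at i (bar x) (map_last bar us))))"
    unfolding sum_distrib_left
  proof (intro sum.cong refl)
    fix i assume "i \<in> {..?m}"
    then have "i \<le> ?m" by simp
    show "complex_of_real (q ^ (2 * Suc ?m - Suc i)) *
        (cinner z y * f (insert_at i (bar x) (map_last bar us))) =
      complex_of_real q * (cinner z y *
        (complex_of_real (q ^ (2 * ?m - i)) * f (insert_at i (bar x) (map_last bar us))))"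
      unfolding exp[OF \<open>i \<le> ?m\<close>] of_real_mult by (simp only: mult_ac)
  qed
  moreover have "(\<Sum>i\<le>?m. complex_of_real (q ^ Suc i) * (cinner z y * f (insert_at i x us))) =
      complex_of_real q * (cinner z y * (\<Sum>i\<le>?m. complex_of_real (q ^ i) * f (insert_at i x us)))"
    unfolding sum_distrib_left by (intro sum.cong refl) (simp only: power_Suc of_real_mult mult_ac)
  ultimately show ?thesis
    using assms unfolding twisted_contraction_def
    by (simp add: sum.atMost_Suc_shift insert_at_0 insert_at_Suc map_last_Cons creation_Cons
        distrib_left del: sum.atMost_Suc power_Suc of_real_power mult_Suc_right)
qed

theorem proposition3p5:
  fixes bar :: "'a::complex_hilbert_space \<Rightarrow> 'a"
    and q :: real and x y :: 'a and n :: nat and f :: "'a fock"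
  assumes "selfadjoint_involution bar"
    and "-1 < q" and "q < 1"
    and "n \<noteq> 1"
    and "f \<in> tensor_power n"
  shows "annihilation bar q x (creation y f) - complex_of_real q *\<^sub>F creation y (annihilation bar q x f)
         = cinner x y *\<^sub>F f + (cinner x (bar y) * complex_of_real (q ^ (2 * n))) *\<^sub>F J_op bar f"
proof
  fix zs
  note bar = assms(1) and f = assms(5)
  have q: "\<bar>q\<bar> < 1" using assms(2,3) by simp
  have swap: "cinner (bar x) y = cinner x (bar y)"
    using bar by (simp add: selfadjoint_involution_def)
  note g = tensor_power_creation[OF f, of y]
  note Ag = annihilation_eq_twisted_contraction[OF bar q g, of x]
  note Tg = tensor_power_twisted_contraction[OF bar g, of q x]
  show "(annihilation bar q x (creation y f) - complex_of_real q *\<^sub>F creation y (annihilation bar q x f)) zs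
      = (cinner x y *\<^sub>F f + (cinner x (bar y) * complex_of_real (q ^ (2 * n))) *\<^sub>F J_op bar f) zs"
  proof (cases n)
    case 0
    have A0: "annihilation bar q x f = 0"
      using f unfolding 0 by (rule annihilation_scalar[OF bar q])
    show ?thesis
    proof (cases zs)
      case Nil
      then show ?thesis
        unfolding Ag A0 creation_lin
        by (simp add: twisted_contraction_def insert_at_0 creation_Cons J_op_def)
    next
      case (Cons z us)
      then show ?thesis
        unfolding Ag A0 creation_lin
        using tensor_power_eq_0[OF Tg, of zs] tensor_power_eq_0[OF f, of zs]
          tensor_power_eq_0[OF f, of "map_last bar zs"]
        by (simp add: 0 J_op_eq_map_last)
    qed
  next
    case (Suc m)
    have f': "f \<in> tensor_power (Suc m)" using f Suc by simp
    note Af = annihilation_eq_twisted_contraction[OF bar q f', of x]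
    note Tf = tensor_power_creation[OF tensor_power_twisted_contraction[OF bar f', of q x], of y]
    show ?thesis
    proof (cases "length zs = n")
      case True
      then obtain z us where zs: "zs = z # us" "length us = m" using Suc by (cases zs) auto
      have "us \<noteq> []" using zs(2) Suc assms(4) by auto
      from twisted_contraction_creation[OF this, of bar q x y f z]
      have "twisted_contraction bar q x (creation y f) zs =
          cinner x y * f zs + cinner x (bar y) * complex_of_real (q ^ (2 * n)) * f (map_last bar zs)
          + complex_of_real q * creation y (twisted_contraction bar q x f) zs"
        unfolding zs(1)[symmetric] True swap unfolding zs(1) creation_Cons .
      moreover have "zs \<noteq> []" using zs(1) by simp
      ultimately show ?thesis
        unfolding Ag Af by (simp add: J_op_eq_map_last del: of_real_power)
    next
      case False
      then have "J_op bar f zs = 0"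
        using tensor_power_eq_0[OF f, of "map_last bar zs"]
        by (cases "zs = []") (simp_all add: J_op_eq_map_last, simp add: J_op_def)
      with False show ?thesis
        unfolding Ag Af
        using tensor_power_eq_0[OF Tg, of zs] tensor_power_eq_0[OF Tf, of zs] tensor_power_eq_0[OF f, of zs] Suc
        by simp
    qed
  qed
qed

end
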